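(* Let $D$ be a positive squarefree integer, let $R_{D}$ denote the ring of integers of the imaginary quadratic field $\mathbb{Q}\left( i \sqrt{D} \right)$, and let $f \colon \widehat{\mathbb{C}} \rightarrow \widehat{\mathbb{C}}$ be a quadratic rational map (that is, a rational map of degree $2$) whose multiplier at each cycle with period less than or equal to $5$ lies in $R_{D}$. Then $f$ is a power map, a Chebyshev map or a Latt\`{e}s map.
   Context: $\widehat{\mathbb{C}} = \mathbb{C} \cup \lbrace \infty \rbrace$ is the Riemann sphere, and $f^{\circ n}$ is the $n$th iterate of $f$. A point $z_{0} \in \widehat{\mathbb{C}}$ is periodic for a rational map $f$ if $f^{\circ n}(z_{0}) = z_{0}$ for some $n \geq 1$; the least such $n$ is its period, and its forward orbit $\lbrace f^{\circ k}(z_{0}) : k \geq 0 \rbrace$, of cardinality $n$, is called a cycle (with period $n$). The multiplier of $f$ at $z_{0}$ is the unique eigenvalue of the differential of $f^{\circ n}$ at $z_{0}$ (as a linear endomorphism of the complex tangent line at $z_{0}$); it is the same at every point of the cycle and is called the multiplier of $f$ at the cycle. Two rational maps $f, g$ are conjugate if there is a M\"{o}bius transformation $\phi$ with $\phi \circ f = g \circ \phi$. A rational map of degree $d \geq 2$ is a power map if it is conjugate to $z \mapsto z^{d}$ or to $z \mapsto z^{-d}$. For $d \geq 2$, the Chebyshev polynomial $T_{d} \in \mathbb{C}[z]$ is the unique polynomial such that $T_{d}(z + z^{-1}) = z^{d} + z^{-d}$; a rational map of degree $d \geq 2$ is a Chebyshev map if it is conjugate to $T_{d}$ or to $-T_{d}$.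 A rational map $f$ of degree $d \geq 2$ is a Latt\`{e}s map if there exist a torus $\mathbb{T} = \mathbb{C}/\Lambda$, with $\Lambda$ a lattice in $\mathbb{C}$, a holomorphic map $L \colon \mathbb{T} \rightarrow \mathbb{T}$ and a nonconstant holomorphic map $p \colon \mathbb{T} \rightarrow \widehat{\mathbb{C}}$ such that $f \circ p = p \circ L$. *)

theory Defs
  imports
    "HOL-Complex_Analysis.Complex_Analysis"
    "HOL-Computational_Algebra.Computational_Algebra"
begin

datatype rsphere = Fin complex | Infty

text \<open>
  The atlas consists of \<open>coord\<close> on the complement of \<open>Infty\<close> and \<open>coord \<circ> rinv\<close> on the
  complement of \<open>Fin 0\<close>; the inverse charts are \<open>Fin\<close> and \<open>rinv \<circ> Fin\<close>. The value
  \<open>coord Infty = 0\<close> is a dummy.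
\<close>

fun coord :: "rsphere \<Rightarrow> complex" where
  "coord (Fin z) = z"
| "coord Infty = 0"

fun rinv :: "rsphere \<Rightarrow> rsphere" where
  "rinv (Fin z) = (if z = 0 then Infty else Fin (inverse z))"
| "rinv Infty = Fin 0"

definition sphere_holomorphic :: "(complex \<Rightarrow> rsphere) \<Rightarrow> bool" where
  "sphere_holomorphic g \<longleftrightarrow>
     (\<forall>z. \<exists>U. open U \<and> z \<in> U \<and>
        ((\<forall>w\<in>U. g w \<noteq> Infty) \<and> (\<lambda>w. coord (g w)) holomorphic_on U \<or>
         (\<forall>w\<in>U. g w \<noteq> Fin 0) \<and> (\<lambda>w. coord (rinv (g w))) holomorphic_on U))"

text \<open>
  The map of the sphere induced by \<open>p / q\<close>, for coprime \<open>p\<close> and \<open>q\<close>. The value at infinity is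
  obtained by homogenizing both polynomials to degree \<open>max (degree p) (degree q)\<close>.
\<close>

fun rat_fun :: "complex poly \<Rightarrow> complex poly \<Rightarrow> rsphere \<Rightarrow> rsphere" where
  "rat_fun p q (Fin z) = (if poly q z = 0 then Infty else Fin (poly p z / poly q z))"
| "rat_fun p q Infty =
     (let d = max (degree p) (degree q)
      in if coeff q d = 0 then Infty else Fin (coeff p d / coeff q d))"

definition rational_map :: "nat \<Rightarrow> (rsphere \<Rightarrow> rsphere) \<Rightarrow> bool" where
  "rational_map d f \<longleftrightarrow>
     (\<exists>p q. coprime p q \<and> max (degree p) (degree q) = d \<and> f = rat_fun p q)"

definition moebius :: "(rsphere \<Rightarrow> rsphere) \<Rightarrow> bool" where
  "moebius \<phi> \<longleftrightarrow> (\<exists>a b c d. a * d - b * c \<noteq> 0 \<and> \<phi> = rat_fun [:b, a:] [:d, c:])"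

definition conjugate :: "(rsphere \<Rightarrow> rsphere) \<Rightarrow> (rsphere \<Rightarrow> rsphere) \<Rightarrow> bool" where
  "conjugate f g \<longleftrightarrow> (\<exists>\<phi>. moebius \<phi> \<and> \<phi> \<circ> f = g \<circ> \<phi>)"

definition periodic :: "('a \<Rightarrow> 'a) \<Rightarrow> 'a \<Rightarrow> bool" where
  "periodic f x \<longleftrightarrow> (\<exists>n\<ge>1. (f ^^ n) x = x)"

definition period :: "('a \<Rightarrow> 'a) \<Rightarrow> 'a \<Rightarrow> nat" where
  "period f x = (LEAST n. n \<ge> 1 \<and> (f ^^ n) x = x)"

definition forward_orbit :: "('a \<Rightarrow> 'a) \<Rightarrow> 'a \<Rightarrow> 'a set" where
  "forward_orbit f x = {(f ^^ k) x | k. True}"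

definition is_cycle :: "('a \<Rightarrow> 'a) \<Rightarrow> nat \<Rightarrow> 'a set \<Rightarrow> bool" where
  "is_cycle f n C \<longleftrightarrow> (\<exists>x. periodic f x \<and> period f x = n \<and> C = forward_orbit f x)"

text \<open>
  At a fixed point of \<open>g\<close> the differential is an endomorphism of a complex line, that is, the
  multiplication by a complex number: the derivative at that point of the expression of \<open>g\<close> in
  any single chart around it, used both at the source and at the target.
\<close>

fun fixpoint_deriv :: "(rsphere \<Rightarrow> rsphere) \<Rightarrow> rsphere \<Rightarrow> complex" where
  "fixpoint_deriv g (Fin z) = deriv (\<lambda>w. coord (g (Fin w))) z"
| "fixpoint_deriv g Infty = deriv (\<lambda>w. coord (rinv (g (rinv (Fin w))))) 0"

definition multiplier :: "(rsphere \<Rightarrow> rsphere) \<Rightarrow> rsphere \<Rightarrow> complex" where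
  "multiplier f x = fixpoint_deriv (f ^^ period f x) x"

definition imag_quadratic_field :: "nat \<Rightarrow> complex set" where
  "imag_quadratic_field D = {of_rat a + of_rat b * (\<i> * of_real (sqrt (real D))) | a b. True}"

definition imag_quadratic_integers :: "nat \<Rightarrow> complex set" where
  "imag_quadratic_integers D = {x \<in> imag_quadratic_field D. algebraic_int x}"

definition power_map :: "(rsphere \<Rightarrow> rsphere) \<Rightarrow> bool" where
  "power_map f \<longleftrightarrow>
     (\<exists>d\<ge>2. rational_map d f \<and>
        (conjugate f (rat_fun (monom 1 d) 1) \<or> conjugate f (rat_fun 1 (monom 1 d))))"

definition chebyshev_poly :: "nat \<Rightarrow> complex poly" where
  "chebyshev_poly d =
     (THE T. \<forall>z. z \<noteq> 0 \<longrightarrow> poly T (z + inverse z) = z ^ d + inverse z ^ d)"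

lemma chebyshev_poly_ex1:
  "\<exists>!T :: complex poly. \<forall>z. z \<noteq> 0 \<longrightarrow> poly T (z + inverse z) = z ^ d + inverse z ^ d"
proof (rule ex_ex1I)
  show "\<exists>T :: complex poly. \<forall>z. z \<noteq> 0 \<longrightarrow> poly T (z + inverse z) = z ^ d + inverse z ^ d"
  proof (induction d rule: less_induct)
    case (less d)
    consider "d = 0" | "d = 1" | n where "d = Suc (Suc n)"
      by (metis One_nat_def not0_implies_Suc)
    then show ?case
    proof cases
      case 1
      then show ?thesis by (intro exI[of _ "[:2:]"]) simp
    next
      case 2
      then show ?thesis by (intro exI[of _ "[:0, 1:]"]) simp
    next
      case 3
      obtain P where P: "\<forall>z::complex. z \<noteq> 0 \<longrightarrow> poly P (z + inverse z) = z ^ n + inverse z ^ n"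
        using less[of n] 3 by auto
      obtain Q where Q: "\<forall>z::complex. z \<noteq> 0 \<longrightarrow>
          poly Q (z + inverse z) = z ^ Suc n + inverse z ^ Suc n"
        using less[of "Suc n"] 3 by blast
      have "poly ([:0, 1:] * Q - P) (z + inverse z) = z ^ d + inverse z ^ d"
        if "z \<noteq> 0" for z :: complex
      proof -
        have "poly ([:0, 1:] * Q - P) (z + inverse z) =
            (z + inverse z) * (z ^ Suc n + inverse z ^ Suc n) - (z ^ n + inverse z ^ n)"
          using P Q that by simp
        also have "\<dots> = z ^ Suc (Suc n) + inverse z ^ Suc (Suc n)
            + (z * inverse z - 1) * (z ^ n + inverse z ^ n)"
          by (simp add: algebra_simps)
        finally show ?thesis using that 3 by simp
      qed
      then show ?thesis by blast
    qed
  qed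
next
  fix S T :: "complex poly"
  assume S: "\<forall>z. z \<noteq> 0 \<longrightarrow> poly S (z + inverse z) = z ^ d + inverse z ^ d"
     and T: "\<forall>z. z \<noteq> 0 \<longrightarrow> poly T (z + inverse z) = z ^ d + inverse z ^ d"
  have "poly S x = poly T x" for x
  proof -
    define z where "z = (x + csqrt (x\<^sup>2 - 4)) / 2"
    have sq: "csqrt (x\<^sup>2 - 4) ^ 2 = x\<^sup>2 - 4" by simp
    have "z * (x - z) = (x\<^sup>2 - csqrt (x\<^sup>2 - 4) ^ 2) / 4"
      by (simp add: z_def field_simps power2_eq_square)
    then have one: "z * (x - z) = 1" unfolding sq by simp
    then have nz: "z \<noteq> 0" by auto
    then have "inverse z = x - z" using one by (simp add: field_simps)
    then have "z + inverse z = x" by simp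
    then show ?thesis using S T nz by metis
  qed
  then show "S = T" by (simp add: poly_eq_poly_eq_iff[symmetric] fun_eq_iff)
qed

lemma poly_chebyshev_poly:
  "z \<noteq> 0 \<Longrightarrow> poly (chebyshev_poly d) (z + inverse z) = z ^ d + inverse z ^ d"
  using theI'[OF chebyshev_poly_ex1[of d]] unfolding chebyshev_poly_def by blast

definition chebyshev_map :: "(rsphere \<Rightarrow> rsphere) \<Rightarrow> bool" where
  "chebyshev_map f \<longleftrightarrow>
     (\<exists>d\<ge>2. rational_map d f \<and>
        (conjugate f (rat_fun (chebyshev_poly d) 1) \<or>
         conjugate f (rat_fun (- chebyshev_poly d) 1)))"

definition is_lattice :: "complex set \<Rightarrow> bool" where
  "is_lattice \<Lambda> \<longleftrightarrow>
     (\<exists>\<omega>1 \<omega>2. \<omega>2 / \<omega>1 \<notin> \<real> \<and> \<Lambda> = {of_int m * \<omega>1 + of_int n * \<omega>2 | m n. True})"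

definition torus_rel :: "complex set \<Rightarrow> (complex \<times> complex) set" where
  "torus_rel \<Lambda> = {(x, y). x - y \<in> \<Lambda>}"

definition torus :: "complex set \<Rightarrow> complex set set" where
  "torus \<Lambda> = UNIV // torus_rel \<Lambda>"

definition torus_proj :: "complex set \<Rightarrow> complex \<Rightarrow> complex set" where
  "torus_proj \<Lambda> z = torus_rel \<Lambda> `` {z}"

text \<open>
  The charts of the torus are the local inverses of \<open>torus_proj\<close>. Hence a self-map of the torus
  is holomorphic iff it lifts locally, through \<open>torus_proj\<close>, to holomorphic functions, and a map
  from the torus to the sphere is holomorphic iff its composition with \<open>torus_proj\<close> is.
\<close>

definition torus_holomorphic_self :: "complex set \<Rightarrow> (complex set \<Rightarrow> complex set) \<Rightarrow> bool" where
  "torus_holomorphic_self \<Lambda> L \<longleftrightarrow>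
     L ` torus \<Lambda> \<subseteq> torus \<Lambda> \<and>
     (\<forall>z. \<exists>U h. open U \<and> z \<in> U \<and> h holomorphic_on U \<and>
        (\<forall>w\<in>U. L (torus_proj \<Lambda> w) = torus_proj \<Lambda> (h w)))"

definition torus_holomorphic_sphere :: "complex set \<Rightarrow> (complex set \<Rightarrow> rsphere) \<Rightarrow> bool" where
  "torus_holomorphic_sphere \<Lambda> p \<longleftrightarrow> sphere_holomorphic (\<lambda>z. p (torus_proj \<Lambda> z))"

definition lattes_map :: "(rsphere \<Rightarrow> rsphere) \<Rightarrow> bool" where
  "lattes_map f \<longleftrightarrow>
     (\<exists>d\<ge>2. rational_map d f) \<and>
     (\<exists>\<Lambda> L p. is_lattice \<Lambda> \<and> torus_holomorphic_self \<Lambda> L \<and>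
        torus_holomorphic_sphere \<Lambda> p \<and> \<not> p constant_on torus \<Lambda> \<and>
        (\<forall>x\<in>torus \<Lambda>. f (p x) = p (L x)))"

end

theory Submission
  imports Defs
begin

text \<open>
  Every quadratic rational map has either three distinct fixed points, a double one and a simple
  one, or a triple one. Placing two fixed points with multipliers \<open>p\<close> and \<open>q\<close> at \<open>0\<close> and \<open>\<infinity>\<close> gives the
  normal form \<open>z (z + p) / (q z + 1)\<close>; only a triple fixed point escapes it and gives \<open>z + 1 / z\<close>
  (\<open>quadratic_normal_form\<close>). The hypothesis on cycles passes to the normal form because the
  multiplier of a cycle is invariant under conjugation (\<open>multiplier_of_conjugate\<close>).
  
  The period-one hypothesis makes \<open>p\<close>, \<open>q\<close> and the third multiplier \<open>r\<close> integers of the imaginary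
  quadratic field, and the holomorphic fixed point formula says that
  \<open>1 / (1 - p) + 1 / (1 - q) + 1 / (1 - r) = 1\<close>. Comparing real parts puts two of the three
  denominators into bounded horodiscs, so if no multiplier is \<open>0\<close> or \<open>1\<close> only finitely many triples
  remain, over finitely many fields (\<open>unit_fraction_sum_catalogued\<close>). There are two infinite
  families left: polynomials (some multiplier is \<open>0\<close>) and maps with a parabolic fixed point (some
  multiplier is \<open>1\<close>). In both the multipliers of the two 3-cycles are conjugate over the field
  generated by \<open>p\<close> and \<open>q\<close>; as they lie in the quadratic field, a discriminant is a square there,
  so \<open>8\<close> or \<open>9\<close> is a product of two integers whose sum is an affine function of the parameter. That
  again leaves finitely many parameters (\<open>polynomial_family\<close>, \<open>parabolic_family\<close>).
  
  Each remaining map that is not in the conclusion is excluded by one cycle of period at most five.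
  An interval Newton computation in fixed-point disc arithmetic encloses the cycle and its multiplier
  so tightly that the multiplier is visibly not an integer of the field (\<open>certified_sound\<close>,
  \<open>certified_cycle_table\<close>).
  
  The few maps that survive are power maps, Chebyshev maps or Lattes maps. For the last kind the
  function \<open>\<wp>\<close> of the lattice \<open>\<int> + \<int> a\<close>, where \<open>a\<close> is a quadratic integer of norm \<open>2\<close>, is built up to an
  additive constant as a sum of \<open>\<pi>\<^sup>2 / sin\<^sup>2\<close> over one period. Multiplication by \<open>a\<close> has degree two, and
  it descends through \<open>\<wp>\<close> to a map \<open>(z + 1 / z + \<kappa>) / a\<^sup>2\<close>, where \<open>\<kappa>\<close> is found from the values of \<open>\<wp>\<close> at
  half periods (\<open>even_trace_uniformized\<close>, \<open>odd_trace_uniformized\<close>).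
\<close>

section \<open>Rigorous disc arithmetic and certified cycles\<close>

text \<open>
  The unit of the fixed-point representation; \<open>2\<^sup>3\<^sup>2\<close> is precise enough for all cycles below.
\<close>

definition scale :: int where "scale = 4294967296"

text \<open>
  A disc \<open>(x, y, r)\<close> has centre \<open>(x + i y) / scale\<close> and radius \<open>r / scale\<close>. Integers, rather than
  rationals, keep the numerals short when the simplifier evaluates the arithmetic.
\<close>

type_synonym disc = "int \<times> int \<times> int"

fun in_disc :: "disc \<Rightarrow> complex \<Rightarrow> bool" where
  "in_disc (x, y, r) z \<longleftrightarrow> cmod (of_int scale * z - Complex x y) \<le> r"

text \<open>
  An upper bound of the modulus on the disc, with the 1-norm of the centre in place of the modulus to avoid square roots.
\<close>

fun disc_size :: "disc \<Rightarrow> int" where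
  "disc_size (x, y, r) = \<bar>x\<bar> + \<bar>y\<bar> + r"

text \<open>
  A lower bound of the modulus on the disc, by the maximum norm of the centre.
\<close>

fun disc_dist :: "disc \<Rightarrow> int" where
  "disc_dist (x, y, r) = max \<bar>x\<bar> \<bar>y\<bar> - r"

fun disc_add :: "disc \<Rightarrow> disc \<Rightarrow> disc" where
  "disc_add (x, y, r) (x', y', r') = (x + x', y + y', r + r')"

fun disc_sub :: "disc \<Rightarrow> disc \<Rightarrow> disc" where
  "disc_sub (x, y, r) (x', y', r') = (x - x', y - y', r + r')"

text \<open>
  The constant 3 absorbs the rounding of both coordinates of the centre and of the radius.
\<close>

fun disc_mul :: "disc \<Rightarrow> disc \<Rightarrow> disc" where
  "disc_mul (x, y, r) (x', y', r') =
     ((x * x' - y * y') div scale, (x * y' + y * x') div scale,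
      ((\<bar>x\<bar> + \<bar>y\<bar>) * r' + (\<bar>x'\<bar> + \<bar>y'\<bar> + r') * r) div scale + 3)"

text \<open>
  The arguments \<open>n\<close> and \<open>l\<close> are the squared modulus of the centre \<open>c\<close> and a lower bound of its modulus:
  if \<open>z\<close> is within \<open>r\<close> of \<open>c\<close>, then \<open>1 / z\<close> is within \<open>r / (l (l - r))\<close> of \<open>1 / c\<close>.
\<close>

fun disc_inv_aux :: "int \<Rightarrow> int \<Rightarrow> int \<Rightarrow> int \<Rightarrow> int \<Rightarrow> disc" where
  "disc_inv_aux x y r n l =
     (x * (scale * scale) div n, - (y * (scale * scale)) div n,
      r * (scale * scale) div (l * (l - r)) + 3)"

fun disc_inv :: "disc \<Rightarrow> disc" where
  "disc_inv (x, y, r) = disc_inv_aux x y r (x * x + y * y) (max \<bar>x\<bar> \<bar>y\<bar>)"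

lemma scale_pos: "scale > 0" "real_of_int scale > 0" "complex_of_int scale \<noteq> 0"
  by (auto simp: scale_def)

lemma cmod_Complex_le: "cmod (Complex x y) \<le> \<bar>x\<bar> + \<bar>y\<bar>"
  using cmod_le[of "Complex x y"] by simp

lemma cmod_Complex_ge: "of_int (max \<bar>x\<bar> \<bar>y\<bar>) \<le> cmod (Complex (of_int x) (of_int y))"
  using abs_Re_le_cmod[of "Complex x y"] abs_Im_le_cmod[of "Complex x y"]
  by (auto simp: max_def simp del: abs_Re_le_cmod abs_Im_le_cmod)

lemma div_floor_error: "\<bar>real_of_int a / real_of_int b - real_of_int (a div b)\<bar> \<le> 1"
  using floor_divide_of_int_eq[of a b, where 'a = real] by linarith

lemma div_floor_upper: "real_of_int a / real_of_int b \<le> real_of_int (a div b) + 1"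
  using floor_divide_of_int_eq[of a b, where 'a = real] by linarith

lemma rounding_error:
  "cmod (Complex (a / b) (c / d) - Complex (a div b) (c div d)) \<le> 2" for a b c d :: int
proof -
  have "cmod (Complex (a / b - (a div b)) (c / d - (c div d))) \<le> 1 + 1"
    using div_floor_error[of a b] div_floor_error[of c d]
    by (intro order.trans[OF cmod_Complex_le] add_mono) auto
  then show ?thesis by (simp add: complex_diff)
qed

lemma in_disc_size: "in_disc d z \<Longrightarrow> cmod (of_int scale * z) \<le> disc_size d"
proof (cases d)
  case (fields x y r)
  assume "in_disc d z"
  then have "cmod (of_int scale * z - Complex x y) \<le> r" using fields by simp
  moreover have "cmod (of_int scale * z) \<le> cmod (of_int scale * z - Complex x y) + cmod (Complex x y)"
    using norm_triangle_ineq[of "of_int scale * z - Complex x y" "Complex x y"] by simp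
  ultimately show ?thesis using cmod_Complex_le[of x y] fields by simp
qed

lemma in_disc_dist: "in_disc d z \<Longrightarrow> disc_dist d \<le> cmod (of_int scale * z)"
proof (cases d)
  case (fields x y r)
  assume "in_disc d z"
  then have "cmod (of_int scale * z - Complex x y) \<le> r" using fields by simp
  moreover have "cmod (Complex x y) \<le> cmod (of_int scale * z - Complex x y) + cmod (of_int scale * z)"
    using norm_triangle_ineq4[of "of_int scale * z" "of_int scale * z - Complex x y"] by simp
  ultimately show ?thesis using cmod_Complex_ge[of x y] fields by simp
qed

lemma in_disc_dist_nonzero: "in_disc d z \<Longrightarrow> disc_dist d > 0 \<Longrightarrow> z \<noteq> 0"
  using in_disc_dist[of d z] by auto

lemma in_disc_add: "in_disc d z \<Longrightarrow> in_disc e w \<Longrightarrow> in_disc (disc_add d e) (z + w)"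
proof (cases d; cases e)
  fix x y r x' y' r'
  assume *: "in_disc d z" "in_disc e w" "d = (x, y, r)" "e = (x', y', r')"
  have "of_int scale * (z + w) - Complex (x + x') (y + y') =
      (of_int scale * z - Complex x y) + (of_int scale * w - Complex x' y')"
    by (simp add: complex_eq_iff algebra_simps)
  then show ?thesis using * norm_triangle_ineq[of "of_int scale * z - Complex x y" "of_int scale * w - Complex x' y'"]
    by simp
qed

lemma in_disc_sub: "in_disc d z \<Longrightarrow> in_disc e w \<Longrightarrow> in_disc (disc_sub d e) (z - w)"
proof (cases d; cases e)
  fix x y r x' y' r'
  assume *: "in_disc d z" "in_disc e w" "d = (x, y, r)" "e = (x', y', r')"
  have "of_int scale * (z - w) - Complex (x - x') (y - y') =
      (of_int scale * z - Complex x y) - (of_int scale * w - Complex x' y')"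
    by (simp add: complex_eq_iff algebra_simps)
  then show ?thesis using * norm_triangle_ineq4[of "of_int scale * z - Complex x y" "of_int scale * w - Complex x' y'"]
    by simp
qed

lemma in_disc_mul: "in_disc d z \<Longrightarrow> in_disc e w \<Longrightarrow> in_disc (disc_mul d e) (z * w)"
proof (cases d; cases e)
  fix x y r x' y' r'
  assume *: "in_disc d z" "in_disc e w" and de: "d = (x, y, r)" "e = (x', y', r')"
  let ?s = "complex_of_int scale"
  let ?c = "Complex x y" and ?c' = "Complex x' y'"
  define a b where "a = ?s * z" and "b = ?s * w"
  have a: "cmod (a - ?c) \<le> r" and b: "cmod (b - ?c') \<le> r'" using * de by (auto simp: a_def b_def)
  have r0: "0 \<le> real_of_int r" using a norm_ge_zero order.trans by blast
  have bs: "cmod b \<le> \<bar>x'\<bar> + \<bar>y'\<bar> + r'" using in_disc_size[of e w] * de by (simp add: b_def)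
  have "a * b - ?c * ?c' = ?c * (b - ?c') + (a - ?c) * b" by (simp add: algebra_simps)
  then have "cmod (a * b - ?c * ?c') \<le> cmod ?c * cmod (b - ?c') + cmod (a - ?c) * cmod b"
    by (metis norm_mult norm_triangle_ineq)
  also have "\<dots> \<le> (\<bar>real_of_int x\<bar> + \<bar>real_of_int y\<bar>) * r' + r * (\<bar>real_of_int x'\<bar> + \<bar>real_of_int y'\<bar> + r')"
    using a b bs r0 cmod_Complex_le[of x y]
    by (intro add_mono mult_mono) auto
  finally have 1: "cmod (a * b - ?c * ?c') \<le>
      of_int ((\<bar>x\<bar> + \<bar>y\<bar>) * r' + (\<bar>x'\<bar> + \<bar>y'\<bar> + r') * r)" (is "_ \<le> of_int ?e")
    by (simp add: algebra_simps)
  have "cmod ((a * b - ?c * ?c') / ?s) = cmod (a * b - ?c * ?c') / scale"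
    using scale_pos by (simp add: norm_divide)
  also have "\<dots> \<le> of_int ?e / scale" using 1 scale_pos by (intro divide_right_mono) auto
  also have "\<dots> \<le> of_int (?e div scale) + 1" by (rule div_floor_upper)
  finally have 2: "cmod ((a * b - ?c * ?c') / ?s) \<le> of_int (?e div scale) + 1" .
  let ?u = "x * x' - y * y'" and ?v = "x * y' + y * x'"
  have 3: "?c * ?c' / ?s = Complex (?u / scale) (?v / scale)"
    using scale_pos by (simp add: complex_eq_iff field_simps)
  have "?s * (z * w) - Complex (?u div scale) (?v div scale) =
      (a * b - ?c * ?c') / ?s + (?c * ?c' / ?s - Complex (?u div scale) (?v div scale))"
    using scale_pos by (simp add: a_def b_def field_simps)
  then have "cmod (?s * (z * w) - Complex (?u div scale) (?v div scale)) \<le> of_int (?e div scale) + 1 + 2"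
    using 2 rounding_error[of ?u scale ?v scale] unfolding 3
    by (metis (no_types, lifting) add_mono norm_triangle_mono)
  then show ?thesis using de by simp
qed

lemma in_disc_inv:
  assumes "in_disc d z" and "disc_dist d > 0"
  shows "in_disc (disc_inv d) (inverse z)"
proof (cases d)
  case (fields x y r)
  let ?s = "complex_of_int scale" and ?c = "Complex x y"
  define a where "a = ?s * z"
  define l where "l = max \<bar>x\<bar> \<bar>y\<bar>"
  define n where "n = x * x + y * y"
  have a: "cmod (a - ?c) \<le> r" using assms fields by (simp add: a_def)
  have r0: "0 \<le> real_of_int r" using a norm_ge_zero order.trans by blast
  then have r0': "0 \<le> r" by simp
  have lr: "l - r > 0" using assms(2) fields by (simp add: l_def)
  have ca: "of_int (l - r) \<le> cmod a"
    using in_disc_dist[OF assms(1)] fields by (simp add: a_def l_def)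
  have cc: "of_int l \<le> cmod ?c" using cmod_Complex_ge[of x y] by (simp add: l_def)
  have l0: "l > 0" using lr r0' by simp
  have az: "a \<noteq> 0" "?c \<noteq> 0" "z \<noteq> 0"
    using ca cc lr l0 by (auto simp: a_def)
  have n0: "n > 0"
  proof -
    have "x \<noteq> 0 \<or> y \<noteq> 0" using l0 by (auto simp: l_def)
    then show ?thesis unfolding n_def by (metis not_square_less_zero not_sum_squares_lt_zero sum_squares_gt_zero_iff)
  qed
  have inv: "?s ^ 2 / ?c = Complex ((x * (scale * scale)) / n) ((- (y * (scale * scale))) / n)"
  proof -
    define u v S N where uv: "u = real_of_int x" "v = real_of_int y" "S = real_of_int scale" "N = real_of_int n"
    have N: "N \<noteq> 0" "N = u * u + v * v" using n0 by (auto simp: n_def uv)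
    have "u * (u * (S * S) / N) - v * (- (v * (S * S)) / N) = (u * u + v * v) * (S * S) / N"
      by (simp add: algebra_simps add_divide_distrib)
    also have "\<dots> = S * S" using N by simp
    finally have "u * (u * (S * S) / N) - v * (- (v * (S * S)) / N) = S * S"
      and "u * (- (v * (S * S)) / N) + v * (u * (S * S) / N) = 0"
      by (auto simp: algebra_simps)
    then have "?c * Complex ((x * (scale * scale)) / n) ((- (y * (scale * scale))) / n) = ?s ^ 2"
      by (simp add: complex_eq_iff power2_eq_square uv)
    then show ?thesis using az by (simp add: field_simps)
  qed
  have "cmod (?s ^ 2 / a - ?s ^ 2 / ?c) = scale * scale * cmod (a - ?c) / (cmod ?c * cmod a)"
  proof -
    have "?s ^ 2 / a - ?s ^ 2 / ?c = ?s ^ 2 * (?c - a) / (?c * a)"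
      using az by (simp add: field_simps)
    then show ?thesis using scale_pos by (simp add: norm_mult norm_divide norm_power power2_eq_square norm_minus_commute)
  qed
  also have "\<dots> \<le> scale * scale * r / (of_int l * of_int (l - r))"
    using a ca cc l0 lr r0 scale_pos by (intro frac_le mult_mono mult_left_mono mult_pos_pos) auto
  also have "\<dots> = of_int (r * (scale * scale)) / of_int (l * (l - r))" by simp
  also have "\<dots> \<le> of_int (r * (scale * scale) div (l * (l - r))) + 1" by (rule div_floor_upper)
  finally have 1: "cmod (?s ^ 2 / a - ?s ^ 2 / ?c) \<le> of_int (r * (scale * scale) div (l * (l - r))) + 1" .
  have "?s * inverse z = ?s ^ 2 / a" using az scale_pos by (simp add: a_def power2_eq_square field_simps)
  then have "?s * inverse z - Complex (x * (scale * scale) div n) (- (y * (scale * scale)) div n) =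
    (?s ^ 2 / a - ?s ^ 2 / ?c) + (?s ^ 2 / ?c - Complex (x * (scale * scale) div n) (- (y * (scale * scale)) div n))"
    by simp
  then have "cmod (?s * inverse z - Complex (x * (scale * scale) div n) (- (y * (scale * scale)) div n))
     \<le> of_int (r * (scale * scale) div (l * (l - r))) + 1 + 2"
    using 1 rounding_error[of "x * (scale * scale)" n "- (y * (scale * scale))" n] unfolding inv
    by (metis (no_types, lifting) add_mono norm_triangle_mono of_int_minus)
  then show ?thesis using fields by (simp add: n_def l_def)
qed

lemma in_disc_of_int: "in_disc (k * scale, 0, 0) (of_int k)"
  by (simp add: complex_eq_iff)

text \<open>
  The family \<open>(z\<^sup>2 + p z + s) / (q z + t)\<close> contains both normal forms: \<open>s = 0, t = 1\<close> has fixed points \<open>0\<close>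
  and \<open>\<infinity>\<close> with multipliers \<open>p\<close> and \<open>q\<close>, and \<open>p = 0, q = 1, s = 1, t = 0\<close> is \<open>z + 1 / z\<close>.
\<close>

definition quad :: "complex \<Rightarrow> complex \<Rightarrow> int \<Rightarrow> int \<Rightarrow> complex \<Rightarrow> complex" where
  "quad p q s t z = (z * (z + p) + of_int s) / (q * z + of_int t)"

definition quad_deriv :: "complex \<Rightarrow> complex \<Rightarrow> int \<Rightarrow> int \<Rightarrow> complex \<Rightarrow> complex" where
  "quad_deriv p q s t z = (z + z + p - q * quad p q s t z) / (q * z + of_int t)"

text \<open>
  The step is split into small definitions, each of which receives the intermediate discs as
  arguments, so that evaluation by rewriting computes every disc only once.
\<close>

definition disc_step_value :: "disc \<Rightarrow> int \<Rightarrow> disc \<Rightarrow> disc \<Rightarrow> disc" where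
  "disc_step_value P s X V = disc_mul (disc_add (disc_mul X (disc_add X P)) (s * scale, 0, 0)) V"

definition disc_step_deriv :: "disc \<Rightarrow> disc \<Rightarrow> disc \<Rightarrow> disc \<Rightarrow> disc \<Rightarrow> disc" where
  "disc_step_deriv P Q X V Y = disc_mul (disc_sub (disc_add (disc_add X X) P) (disc_mul Q Y)) V"

definition disc_step_pair :: "disc \<Rightarrow> disc \<Rightarrow> disc \<Rightarrow> disc \<Rightarrow> disc \<Rightarrow> disc \<times> disc" where
  "disc_step_pair P Q X V Y = (Y, disc_step_deriv P Q X V Y)"

definition disc_step_inv :: "disc \<Rightarrow> disc \<Rightarrow> int \<Rightarrow> disc \<Rightarrow> disc \<Rightarrow> disc \<times> disc" where
  "disc_step_inv P Q s X V = disc_step_pair P Q X V (disc_step_value P s X V)"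

definition disc_step_den :: "disc \<Rightarrow> disc \<Rightarrow> int \<Rightarrow> disc \<Rightarrow> disc \<Rightarrow> bool \<times> disc \<times> disc" where
  "disc_step_den P Q s X W = (0 < disc_dist W, disc_step_inv P Q s X (disc_inv W))"

definition disc_step :: "disc \<Rightarrow> disc \<Rightarrow> int \<Rightarrow> int \<Rightarrow> disc \<Rightarrow> bool \<times> disc \<times> disc" where
  "disc_step P Q s t X = disc_step_den P Q s X (disc_add (disc_mul Q X) (t * scale, 0, 0))"

type_synonym disc_state = "bool \<times> disc list \<times> disc \<times> disc"

fun disc_record :: "disc_state \<Rightarrow> bool \<times> disc \<times> disc \<Rightarrow> disc_state" where
  "disc_record (ok, orb, X, L) (b, Y, D) = (ok \<and> b, orb @ [X], Y, disc_mul L D)"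

fun disc_advance :: "disc \<Rightarrow> disc \<Rightarrow> int \<Rightarrow> int \<Rightarrow> disc_state \<Rightarrow> disc_state" where
  "disc_advance P Q s t (ok, orb, X, L) = disc_record (ok, orb, X, L) (disc_step P Q s t X)"

primrec disc_orbit :: "disc \<Rightarrow> disc \<Rightarrow> int \<Rightarrow> int \<Rightarrow> nat \<Rightarrow> disc_state \<Rightarrow> disc_state" where
  "disc_orbit P Q s t 0 S = S"
| "disc_orbit P Q s t (Suc n) S = disc_orbit P Q s t n (disc_advance P Q s t S)"

lemma quad_has_derivative:
  assumes "q * z + of_int t \<noteq> 0"
  shows "(quad p q s t has_field_derivative quad_deriv p q s t z) (at z)"
proof -
  have "((\<lambda>z. (z * (z + p) + of_int s) / (q * z + of_int t)) has_field_derivative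
      ((1 * (z + p) + z * 1) * (q * z + of_int t) - (z * (z + p) + of_int s) * q)
        / (q * z + of_int t)\<^sup>2) (at z)"
    using assms by (auto intro!: derivative_eq_intros simp: power2_eq_square)
  moreover have "((1 * (z + p) + z * 1) * (q * z + of_int t) - (z * (z + p) + of_int s) * q)
        / (q * z + of_int t)\<^sup>2 = quad_deriv p q s t z"
    using assms by (simp add: quad_deriv_def quad_def divide_simps power2_eq_square)
  ultimately show ?thesis by (simp add: quad_def[abs_def])
qed

lemma quad_iter_has_derivative:
  assumes "\<And>i. i < n \<Longrightarrow> q * (quad p q s t ^^ i) z + of_int t \<noteq> 0"
  shows "(quad p q s t ^^ n has_field_derivative
    (\<Prod>i<n. quad_deriv p q s t ((quad p q s t ^^ i) z))) (at z)"
  using assms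
proof (induction n)
  case 0
  then show ?case by (simp add: id_def)
next
  case (Suc n)
  have "(quad p q s t \<circ> (quad p q s t ^^ n) has_field_derivative
      quad_deriv p q s t ((quad p q s t ^^ n) z) * (\<Prod>i<n. quad_deriv p q s t ((quad p q s t ^^ i) z))) (at z)"
    by (intro DERIV_chain quad_has_derivative Suc) (use Suc.prems in auto)
  then show ?case by (simp add: mult.commute comp_def)
qed

lemma disc_orbit_ok: "fst (disc_orbit P Q s t n S) \<Longrightarrow> fst S"
proof (induction n arbitrary: S)
  case (Suc n)
  then have "fst (disc_advance P Q s t S)" by simp
  then show ?case by (cases S; cases "disc_step P Q s t (fst (snd (snd S)))") simp
qed simp

text \<open>
  A disc orbit encloses all point orbits that start in the first disc, together with the
  derivative of the iterate, which is the product of the derivatives along the orbit.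
\<close>

lemma disc_orbit_sound:
  assumes "in_disc P p" and "in_disc Q q"
  shows "disc_orbit P Q s t n (ok, orb, X, L) = (True, orb', X', L') \<Longrightarrow> in_disc X z \<Longrightarrow> in_disc L l \<Longrightarrow>
    ok \<and> (\<exists>os. orb' @ [X'] = orb @ os \<and> length os = Suc n \<and>
    (\<forall>i\<le>n. in_disc (os ! i) ((quad p q s t ^^ i) z)) \<and>
    (\<forall>i<n. q * (quad p q s t ^^ i) z + of_int t \<noteq> 0) \<and>
    in_disc L' (l * (\<Prod>i<n. quad_deriv p q s t ((quad p q s t ^^ i) z))))"
proof (induction n arbitrary: ok X L orb z l)
  case 0
  then show ?case by auto
next
  case (Suc n)
  let ?g = "quad p q s t" and ?d = "quad_deriv p q s t"
  define W where "W = disc_add (disc_mul Q X) (t * scale, 0, 0)"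
  define V where "V = disc_inv W"
  define Y where "Y = disc_step_value P s X V"
  define D where "D = disc_step_deriv P Q X V Y"
  have st: "disc_orbit P Q s t n (ok \<and> 0 < disc_dist W, orb @ [X], Y, disc_mul L D) = (True, orb', X', L')"
    using Suc.prems(1) by (simp add: disc_step_def disc_step_den_def disc_step_inv_def disc_step_pair_def
        W_def[symmetric] V_def[symmetric] Y_def[symmetric] D_def[symmetric])
  have W: "disc_dist W > 0" and ok: "ok"
    using disc_orbit_ok[of P Q s t n "(ok \<and> 0 < disc_dist W, orb @ [X], Y, disc_mul L D)"] st by auto
  have Wz: "in_disc W (q * z + of_int t)"
    unfolding W_def using assms Suc.prems by (intro in_disc_add in_disc_mul in_disc_of_int) auto
  have Vz: "in_disc V (inverse (q * z + of_int t))"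
    unfolding V_def by (rule in_disc_inv[OF Wz W])
  have nz: "q * z + of_int t \<noteq> 0" using in_disc_dist_nonzero[OF Wz W] .
  have "in_disc Y ((z * (z + p) + of_int s) * inverse (q * z + of_int t))"
    unfolding Y_def disc_step_value_def using assms Suc.prems Vz by (intro in_disc_add in_disc_mul in_disc_of_int) auto
  then have Yz: "in_disc Y (?g z)" by (simp add: quad_def divide_inverse)
  have "in_disc D ((z + z + p - q * ?g z) * inverse (q * z + of_int t))"
    unfolding D_def disc_step_deriv_def using assms Suc.prems Vz Yz
    by (intro in_disc_add in_disc_sub in_disc_mul in_disc_of_int) auto
  then have Dz: "in_disc D (?d z)" by (simp add: quad_deriv_def divide_inverse)
  obtain os where orb: "orb' @ [X'] = (orb @ [X]) @ os" and IH: "length os = Suc n \<and>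
    (\<forall>i\<le>n. in_disc (os ! i) ((?g ^^ i) (?g z))) \<and>
    (\<forall>i<n. q * (?g ^^ i) (?g z) + of_int t \<noteq> 0) \<and>
    in_disc L' ((l * ?d z) * (\<Prod>i<n. ?d ((?g ^^ i) (?g z))))"
    using Suc.IH[OF st Yz in_disc_mul[OF Suc.prems(3) Dz]] by blast
  have it: "(?g ^^ Suc i) z = (?g ^^ i) (?g z)" for i by (simp add: funpow_swap1)
  have "\<forall>i\<le>Suc n. in_disc ((X # os) ! i) ((?g ^^ i) z)"
  proof (intro allI impI)
    fix i assume "i \<le> Suc n"
    then show "in_disc ((X # os) ! i) ((?g ^^ i) z)"
      using IH Suc.prems(2) it by (cases i) auto
  qed
  moreover have "\<forall>i<Suc n. q * (?g ^^ i) z + of_int t \<noteq> 0"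
  proof (intro allI impI)
    fix i assume "i < Suc n"
    then show "q * (?g ^^ i) z + of_int t \<noteq> 0"
      using IH nz it by (cases i) auto
  qed
  moreover have "in_disc L' (l * (\<Prod>i<Suc n. ?d ((?g ^^ i) z)))"
  proof -
  have "l * (\<Prod>i<Suc n. ?d ((?g ^^ i) z)) = (l * ?d z) * (\<Prod>i<n. ?d ((?g ^^ i) (?g z)))"
    unfolding prod.lessThan_Suc_shift by (simp add: it del: funpow.simps)
  then show ?thesis using IH by (simp only:)
  qed
  ultimately show ?case using IH orb ok by (intro conjI exI[of _ "X # os"]) simp_all
qed

text \<open>
  The first argument encloses the derivative \<open>\<lambda>\<close> of the \<open>n\<close>-th iterate \<open>g\<close> on the disc of centre \<open>c\<close> and
  radius \<open>\<rho>\<close>, the third one encloses \<open>g c - c\<close>. With \<open>l\<close> the centre and \<open>e\<close> the radius of the first, the map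
  \<open>z \<mapsto> z - (g z - z) / (l - 1)\<close> has derivative at most \<open>e / \<bar>l - 1\<bar> < 1\<close>, and the inequality says that it
  maps the disc into itself.
\<close>

fun newton_contracts :: "disc \<Rightarrow> disc \<Rightarrow> disc \<Rightarrow> bool" where
  "newton_contracts (lx, ly, le) (x, y, \<rho>) (dx, dy, dr) \<longleftrightarrow>
     0 \<le> \<rho> \<and> le < disc_dist (lx - scale, ly, 0) \<and>
     le * \<rho> + scale * (\<bar>dx\<bar> + \<bar>dy\<bar> + dr) \<le> \<rho> * disc_dist (lx - scale, ly, 0)"

text \<open>
  The first state is the orbit of the whole disc, the second that of its centre; later
  discs of the orbit must be disjoint from the initial one, so that the period is exact.
\<close>

fun cycle_check_aux :: "disc \<Rightarrow> disc_state \<Rightarrow> disc_state \<Rightarrow> (disc \<Rightarrow> bool) \<Rightarrow> bool" where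
  "cycle_check_aux X (ok, orb, Y, L) (ok', orb', Y', L') C \<longleftrightarrow>
     ok \<and> ok' \<and> list_all (\<lambda>Z. 0 < disc_dist (disc_sub Z X)) (tl orb) \<and>
     newton_contracts L X (disc_sub Y' (hd orb')) \<and> C L"

fun cycle_check :: "disc \<Rightarrow> disc \<Rightarrow> int \<Rightarrow> int \<Rightarrow> nat \<Rightarrow> disc \<Rightarrow> (disc \<Rightarrow> bool) \<Rightarrow> bool" where
  "cycle_check P Q s t n (x, y, \<rho>) C \<longleftrightarrow>
     cycle_check_aux (x, y, \<rho>) (disc_orbit P Q s t n (True, [], (x, y, \<rho>), (scale, 0, 0)))
       (disc_orbit P Q s t n (True, [], (x, y, 0), (scale, 0, 0))) C"

text \<open>
  The simplified Newton map is a contraction of the disc into itself, and its fixed point is a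
  fixed point of the iterate. The multiplier lies in the derivative disc because the fixed point lies in
  the initial disc.
\<close>

lemma cycle_check_sound:
  assumes "cycle_check P Q s t n X C" and "in_disc P p" and "in_disc Q q" and n: "1 \<le> n"
  shows "\<exists>z L. (\<forall>i<n. q * (quad p q s t ^^ i) z + of_int t \<noteq> 0) \<and>
    (quad p q s t ^^ n) z = z \<and> (\<forall>i. 0 < i \<longrightarrow> i < n \<longrightarrow> (quad p q s t ^^ i) z \<noteq> z) \<and>
    C L \<and> in_disc L (\<Prod>i<n. quad_deriv p q s t ((quad p q s t ^^ i) z))"
proof -
  let ?g = "quad p q s t"
  let ?m = "\<lambda>z. \<Prod>i<n. quad_deriv p q s t ((?g ^^ i) z)"
  obtain x y \<rho> where X: "X = (x, y, \<rho>)" by (cases X)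
  obtain ok orb Y L where 1: "disc_orbit P Q s t n (True, [], (x, y, \<rho>), (scale, 0, 0)) = (ok, orb, Y, L)"
    by (metis prod_cases4)
  obtain ok' orb' Y' L' where 2: "disc_orbit P Q s t n (True, [], (x, y, 0), (scale, 0, 0)) = (ok', orb', Y', L')"
    by (metis prod_cases4)
  have c: "ok" "ok'" "list_all (\<lambda>Z. 0 < disc_dist (disc_sub Z X)) (tl orb)"
    "newton_contracts L X (disc_sub Y' (hd orb'))" "C L"
    using assms(1) X 1 2 by auto
  obtain lx ly le where L: "L = (lx, ly, le)" by (cases L)
  define x0 where "x0 = Complex x y / of_int scale"
  define l0 where "l0 = Complex lx ly / of_int scale"
  define r where "r = real_of_int \<rho> / scale"
  define B where "B = cball x0 r"
  have r0: "r \<ge> 0" using c(4) X L scale_pos unfolding r_def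
    by (cases "disc_sub Y' (hd orb')") auto
  have inB: "in_disc X z \<longleftrightarrow> z \<in> B" for z
  proof -
    have "of_int scale * z - Complex x y = of_int scale * (z - x0)"
      using scale_pos by (simp add: x0_def field_simps)
    then have "cmod (of_int scale * z - Complex x y) = scale * dist x0 z"
      using scale_pos by (simp add: norm_mult dist_norm norm_minus_commute)
    then show ?thesis using scale_pos by (simp add: X B_def r_def field_simps)
  qed
  have one: "in_disc (scale, 0, 0) 1" using in_disc_of_int[of 1] by simp
  have snd1: "length (orb @ [Y]) = Suc n \<and> (\<forall>i\<le>n. in_disc ((orb @ [Y]) ! i) ((?g ^^ i) z)) \<and>
    (\<forall>i<n. q * (?g ^^ i) z + of_int t \<noteq> 0) \<and> in_disc L (?m z)" if "in_disc X z" for z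
    using disc_orbit_sound[OF assms(2,3) 1[unfolded eqTrueI[OF c(1)] X[symmetric]] that one] by simp
  have x0: "in_disc (x, y, 0) x0" using scale_pos by (simp add: x0_def)
  have snd2: "length (orb' @ [Y']) = Suc n" "\<And>i. i \<le> n \<Longrightarrow> in_disc ((orb' @ [Y']) ! i) ((?g ^^ i) x0)"
    using disc_orbit_sound[OF assms(2,3) 2[unfolded eqTrueI[OF c(2)]] x0 one] by auto
  define \<delta> where "\<delta> = cmod ((?g ^^ n) x0 - x0)"
  obtain dx dy dr where d: "disc_sub Y' (hd orb') = (dx, dy, dr)"
    by (metis prod_cases3)
  have "in_disc (dx, dy, dr) ((?g ^^ n) x0 - x0)"
  proof -
    have "in_disc Y' ((?g ^^ n) x0)" using snd2(2)[of n] snd2(1) by (simp add: nth_append)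
    moreover have "in_disc (hd orb') x0"
      using snd2(2)[of 0] snd2(1) n by (cases orb') auto
    ultimately show ?thesis using d in_disc_sub by metis
  qed
  then have dl: "scale * \<delta> \<le> \<bar>dx\<bar> + \<bar>dy\<bar> + dr"
    using in_disc_size[of "(dx, dy, dr)"] scale_pos by (simp add: \<delta>_def norm_mult)
  define m where "m = disc_dist (lx - scale, ly, 0)"
  have le: "le < m" "le * \<rho> + scale * (\<bar>dx\<bar> + \<bar>dy\<bar> + dr) \<le> \<rho> * m"
    using c(4) X L d by (auto simp: m_def)
  have ml: "m \<le> scale * cmod (l0 - 1)"
  proof -
    have "in_disc (lx - scale, ly, 0) (l0 - 1)"
      using scale_pos by (simp add: l0_def complex_eq_iff field_simps)
    then have "m \<le> cmod (of_int scale * (l0 - 1))" unfolding m_def by (rule in_disc_dist)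
    then show ?thesis using scale_pos by (simp add: norm_mult)
  qed
  have lm: "in_disc L (?m z)" "cmod (?m z - l0) \<le> le / scale" if "z \<in> B" for z
  proof -
    show 1: "in_disc L (?m z)" using snd1[of z] inB that by blast
    have "of_int scale * ?m z - Complex lx ly = of_int scale * (?m z - l0)"
      using scale_pos by (simp add: l0_def field_simps)
    then show "cmod (?m z - l0) \<le> le / scale"
      using 1 scale_pos unfolding L in_disc.simps
      by (simp only: norm_mult norm_of_int) (simp add: pos_le_divide_eq mult.commute)
  qed
  have x0B: "x0 \<in> B" using r0 by (simp add: B_def)
  have le0: "le \<ge> 0"
    using lm(2)[OF x0B] scale_pos by (metis norm_ge_zero order_trans of_int_0_le_iff zero_le_divide_iff not_le)
  have m0: "m > 0" using le le0 by simp
  have l01: "l0 \<noteq> 1" "cmod (l0 - 1) \<ge> m / scale" "cmod (l0 - 1) > 0"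
    using ml m0 scale_pos by (auto simp: field_simps)
  define T where "T = (\<lambda>z. z - ((?g ^^ n) z - z) / (l0 - 1))"
  define k where "k = real_of_int le / m"
  have k: "0 \<le> k" "k < 1" using le le0 m0 by (auto simp: k_def)
  have dT: "(T has_field_derivative (l0 - ?m z) / (l0 - 1)) (at z within B)" if "z \<in> B" for z
  proof -
    have "(?g ^^ n has_field_derivative ?m z) (at z)"
      using snd1[of z] inB[of z] that by (intro quad_iter_has_derivative) blast
    then have "(T has_field_derivative 1 - (?m z - 1) / (l0 - 1)) (at z)"
      unfolding T_def using l01 by (auto intro!: derivative_eq_intros)
    also have "1 - (?m z - 1) / (l0 - 1) = (l0 - ?m z) / (l0 - 1)"
      using l01 by (simp add: field_simps)
    finally show ?thesis by (rule has_field_derivative_at_within)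
  qed
  have bT: "cmod ((l0 - ?m z) / (l0 - 1)) \<le> k" if "z \<in> B" for z
  proof -
    have "cmod ((l0 - ?m z) / (l0 - 1)) = cmod (?m z - l0) / cmod (l0 - 1)"
      by (simp add: norm_divide norm_minus_commute)
    also have "\<dots> \<le> (le / scale) / (m / scale)"
      using lm(2)[OF that] l01 m0 le0 scale_pos by (intro frac_le) auto
    finally show ?thesis using scale_pos by (simp add: k_def)
  qed
  have lip: "dist (T z) (T w) \<le> k * dist z w" if "z \<in> B" "w \<in> B" for z w
    using field_differentiable_bound[of B T "\<lambda>z. (l0 - ?m z) / (l0 - 1)" k z w] dT bT that
    by (simp add: B_def dist_norm)
  have TB: "T ` B \<subseteq> B"
  proof
    fix w assume "w \<in> T ` B"
    then obtain z where z: "z \<in> B" "w = T z" by auto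
    have "dist (T x0) x0 = \<delta> / cmod (l0 - 1)"
      by (simp add: T_def \<delta>_def dist_norm norm_divide norm_minus_commute)
    also have "\<dots> \<le> \<delta> / (m / scale)"
      using l01 m0 scale_pos by (intro divide_left_mono) (auto simp: \<delta>_def)
    finally have 1: "dist (T x0) x0 \<le> scale * \<delta> / m" by (simp add: mult.commute)
    have "dist x0 z \<le> r" using z by (simp add: B_def)
    then have "dist (T z) (T x0) \<le> k * r"
      using lip[OF z(1) x0B] k by (smt (verit) dist_commute mult_left_mono)
    then have "dist w x0 \<le> k * r + scale * \<delta> / m"
      using 1 dist_triangle[of "T z" x0 "T x0"] z by simp
    also have "\<dots> \<le> r"
    proof -
      have "real_of_int scale * (scale * \<delta>) \<le> real_of_int scale * real_of_int (\<bar>dx\<bar> + \<bar>dy\<bar> + dr)"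
        using dl scale_pos(2) by (intro mult_left_mono) auto
      moreover have "real_of_int (le * \<rho> + scale * (\<bar>dx\<bar> + \<bar>dy\<bar> + dr)) \<le> real_of_int (\<rho> * m)"
        using le(2) by (subst of_int_le_iff)
      ultimately have "le * \<rho> + scale * (scale * \<delta>) \<le> real_of_int \<rho> * m" by simp
      then have "(le * \<rho> + scale * (scale * \<delta>)) / (real_of_int m * scale) \<le> real_of_int \<rho> * m / (real_of_int m * scale)"
        using m0 scale_pos by (intro divide_right_mono) auto
      moreover have "k * r + scale * \<delta> / m = (le * \<rho> + scale * (scale * \<delta>)) / (real_of_int m * scale)"
        using m0 scale_pos by (simp add: k_def r_def add_divide_distrib)
      moreover have "real_of_int \<rho> * m / (real_of_int m * scale) = r" using m0 by (simp add: r_def)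
      ultimately show ?thesis by simp
    qed
    finally show "w \<in> B" by (simp add: B_def dist_commute)
  qed
  have "\<exists>!z\<in>B. T z = z"
    using k lip TB x0B by (intro Banach_fix[of B k T]) (auto simp: B_def complete_eq_closed)
  then obtain z where z: "z \<in> B" "T z = z" by auto
  have fixed: "(?g ^^ n) z = z" using z(2) l01 by (simp add: T_def)
  have "(?g ^^ i) z \<noteq> z" if "0 < i" "i < n" for i
  proof -
    have len: "length orb = n" using snd1[of z] inB[of z] z(1) by simp
    have "in_disc ((orb @ [Y]) ! i) ((?g ^^ i) z)" "in_disc X z"
      using snd1[of z] inB[of z] z(1) that by auto
    then have "in_disc (disc_sub (orb ! i) X) ((?g ^^ i) z - z)"
      using that len by (intro in_disc_sub) (simp_all add: nth_append)
    moreover have "orb ! i = tl orb ! (i - 1)" "i - 1 < length (tl orb)"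
      using that len by (simp_all add: nth_tl)
    then have "0 < disc_dist (disc_sub (orb ! i) X)" using c(3) by (simp add: list_all_length)
    ultimately show ?thesis using in_disc_dist_nonzero by fastforce
  qed
  then show ?thesis using snd1[of z] inB[of z] z(1) fixed c(5) lm(1)[OF z(1)] by blast
qed

text \<open>
  Half-integral coordinates \<open>(t + y \<surd>(-D)) / 2\<close> represent all integers of the field, for every
  residue of \<open>D\<close> modulo 4.
\<close>

fun surd :: "int \<Rightarrow> int \<times> int \<Rightarrow> complex" where
  "surd D (t, y) = Complex (of_int t / 2) (of_int y * sqrt (of_int D) / 2)"

text \<open>
  The argument \<open>r\<close> is \<open>scale * sqrt D\<close> rounded down.
\<close>

fun surd_disc :: "int \<Rightarrow> int \<times> int \<Rightarrow> disc" where
  "surd_disc r (t, y) = (t * scale div 2, y * r div 2, \<bar>y\<bar> + 1)"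

lemma in_disc_surd:
  assumes "r \<ge> 0" "r * r \<le> D * (scale * scale)" "D * (scale * scale) < (r + 1) * (r + 1)"
  shows "in_disc (surd_disc r e) (surd D e)"
proof (cases e)
  case (Pair t y)
  define d where "d = sqrt (of_int D) * of_int scale"
  have D0: "D \<ge> 0"
  proof -
    have "0 \<le> r * r" by simp
    then have "0 \<le> D * (scale * scale)" using assms(2) by linarith
    then show ?thesis using scale_pos(1) by (metis mult_neg_pos mult_pos_pos not_le)
  qed
  have d0: "d \<ge> 0" using scale_pos D0 by (simp add: d_def)
  have dd: "d * d = of_int (D * (scale * scale))"
    using D0 real_sqrt_mult_self[of "of_int D"] by (simp add: d_def mult_ac)
  have "of_int (r * r) \<le> d * d" "d * d < of_int ((r + 1) * (r + 1))"
    unfolding dd using assms(2,3) by (simp_all only: of_int_le_iff of_int_less_iff)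
  then have "(of_int r)\<^sup>2 \<le> d\<^sup>2" "d\<^sup>2 < (of_int (r + 1))\<^sup>2" by (simp_all add: power2_eq_square)
  then have rd: "of_int r \<le> d" "d < of_int r + 1"
    using power2_le_imp_le[of "of_int r" d] power2_less_imp_less[of d "of_int (r + 1)"] d0 assms(1) by auto
  have ev: "real_of_int (t * scale div 2) = t * of_int scale / 2"
    by (simp add: scale_def real_of_int_div)
  have "\<bar>of_int y * (d - of_int r)\<bar> \<le> of_int \<bar>y\<bar> * 1"
    unfolding abs_mult using rd by (intro mult_mono) auto
  then have "\<bar>of_int y * d / 2 - of_int (y * r) / 2\<bar> \<le> of_int \<bar>y\<bar>"
    by (simp add: algebra_simps abs_le_iff)
  moreover have "\<bar>of_int (y * r) / 2 - of_int (y * r div 2)\<bar> \<le> (1::real)"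
    using div_floor_error[of "y * r" 2] by simp
  ultimately have "\<bar>of_int y * d / 2 - of_int (y * r div 2)\<bar> \<le> of_int \<bar>y\<bar> + 1" by linarith
  moreover have "of_int scale * surd D e - Complex (t * scale div 2) (y * r div 2) =
      Complex 0 (of_int y * d / 2 - of_int (y * r div 2))"
    using ev Pair by (simp add: complex_eq_iff d_def)
  ultimately show ?thesis using Pair by (simp del: complex_diff add: complex_norm)
qed

text \<open>
  Twice the real part of the points of the disc lies strictly between two consecutive integers.
\<close>

fun avoids_re :: "disc \<Rightarrow> bool" where
  "avoids_re (x, y, r) \<longleftrightarrow>
     2 * (x - r) div scale = 2 * (x + r) div scale \<and> 2 * (x - r) mod scale \<noteq> 0"

text \<open>
  Twice the imaginary part lies strictly between \<open>k \<surd>D\<close> and \<open>(k + 1) \<surd>D\<close> in absolute value;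
  squaring turns this into integer inequalities.
\<close>

fun avoids_im :: "int \<Rightarrow> int \<Rightarrow> disc \<Rightarrow> bool" where
  "avoids_im D k (x, y, r) \<longleftrightarrow> 0 < \<bar>y\<bar> - r \<and> 0 \<le> k \<and>
     k * k * D * (scale * scale) < 4 * ((\<bar>y\<bar> - r) * (\<bar>y\<bar> - r)) \<and>
     4 * ((\<bar>y\<bar> + r) * (\<bar>y\<bar> + r)) < (k + 1) * (k + 1) * D * (scale * scale)"

lemma in_disc_components:
  assumes "in_disc (x, y, r) z"
  shows "of_int (x - r) \<le> of_int scale * Re z" "of_int scale * Re z \<le> of_int (x + r)"
    "of_int (\<bar>y\<bar> - r) \<le> of_int scale * \<bar>Im z\<bar>" "of_int scale * \<bar>Im z\<bar> \<le> of_int (\<bar>y\<bar> + r)"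
proof -
  let ?d = "of_int scale * z - Complex x y"
  have "\<bar>Re ?d\<bar> \<le> r" "\<bar>Im ?d\<bar> \<le> r"
    using assms abs_Re_le_cmod[of ?d] abs_Im_le_cmod[of ?d] by auto
  then have *: "\<bar>of_int scale * Re z - x\<bar> \<le> r" "\<bar>of_int scale * Im z - y\<bar> \<le> r" by auto
  have "of_int scale * \<bar>Im z\<bar> = \<bar>of_int scale * Im z\<bar>" using scale_pos by (simp add: abs_mult)
  with * show "of_int (x - r) \<le> of_int scale * Re z" "of_int scale * Re z \<le> of_int (x + r)"
    "of_int (\<bar>y\<bar> - r) \<le> of_int scale * \<bar>Im z\<bar>" "of_int scale * \<bar>Im z\<bar> \<le> of_int (\<bar>y\<bar> + r)"
    by auto
qed

lemma avoids_re_sound: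
  assumes "avoids_re d" "in_disc d z"
  shows "2 * Re z \<noteq> of_int k"
proof
  assume k: "2 * Re z = of_int k"
  obtain x y r where d: "d = (x, y, r)" by (cases d)
  define s where "s = scale"
  have "of_int (2 * (x - r)) \<le> (of_int (s * k) :: real)" "of_int (s * k) \<le> (of_int (2 * (x + r)) :: real)"
    using in_disc_components(1,2)[of x y r z] assms(2) d k[symmetric] by (simp_all add: s_def)
  then have *: "2 * (x - r) \<le> s * k" "s * k \<le> 2 * (x + r)" by (simp_all only: of_int_le_iff)
  have s: "s > 0" using scale_pos by (simp add: s_def)
  have c: "2 * (x - r) div s = 2 * (x + r) div s" "2 * (x - r) mod s \<noteq> 0"
    using assms(1) d by (auto simp: s_def)
  have "k \<le> 2 * (x + r) div s" using *(2) s by (metis zdiv_mono1 nonzero_mult_div_cancel_left less_irrefl)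
  moreover have "2 * (x - r) div s < k"
  proof (rule ccontr)
    assume "\<not> 2 * (x - r) div s < k"
    then have "k * s \<le> 2 * (x - r) div s * s" using s by (intro mult_right_mono) auto
    moreover have "2 * (x - r) div s * s + 2 * (x - r) mod s = 2 * (x - r)" by (rule div_mult_mod_eq)
    moreover have "2 * (x - r) mod s > 0" using c(2) s by (metis pos_mod_sign order_le_less)
    moreover have "k * s = s * k" by simp
    ultimately show False using *(1) by linarith
  qed
  ultimately show False using c(1) by simp
qed

lemma avoids_im_sound:
  assumes "avoids_im D k d" "in_disc d z" "D > 0"
  shows "2 * Im z \<noteq> of_int y' * sqrt (of_int D)"
proof
  assume y': "2 * Im z = of_int y' * sqrt (of_int D)"
  obtain x y r where d: "d = (x, y, r)" by (cases d)
  define s where "s = real_of_int scale"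
  have s: "s > 0" using scale_pos by (simp add: s_def)
  have c: "0 < \<bar>y\<bar> - r" "0 \<le> k" "k * k * D * (scale * scale) < 4 * ((\<bar>y\<bar> - r) * (\<bar>y\<bar> - r))"
     "4 * ((\<bar>y\<bar> + r) * (\<bar>y\<bar> + r)) < (k + 1) * (k + 1) * D * (scale * scale)"
    using assms(1) d by auto
  note b = in_disc_components(3,4)[OF assms(2)[unfolded d], folded s_def]
  have sq: "4 * (s * \<bar>Im z\<bar>)\<^sup>2 = of_int (y' * y' * D * (scale * scale))"
  proof -
    have "4 * (s * \<bar>Im z\<bar>)\<^sup>2 = s\<^sup>2 * (2 * Im z)\<^sup>2" by (simp add: power_mult_distrib)
    also have "\<dots> = s\<^sup>2 * (of_int y')\<^sup>2 * of_int D"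
      unfolding y' using assms(3) by (simp add: power_mult_distrib)
    finally show ?thesis by (simp add: s_def power2_eq_square mult_ac)
  qed
  have "of_int (4 * ((\<bar>y\<bar> - r) * (\<bar>y\<bar> - r))) \<le> 4 * (s * \<bar>Im z\<bar>)\<^sup>2"
    using power_mono[OF b(1), of 2] c(1) by (simp add: power2_eq_square)
  then have "of_int (4 * ((\<bar>y\<bar> - r) * (\<bar>y\<bar> - r))) \<le> (of_int (y' * y' * D * (scale * scale)) :: real)"
    using sq by simp
  then have "4 * ((\<bar>y\<bar> - r) * (\<bar>y\<bar> - r)) \<le> y' * y' * D * (scale * scale)" by (simp only: of_int_le_iff)
  then have "k * k * D * (scale * scale) < y' * y' * D * (scale * scale)" using c(3) by linarith
  then have k1: "k * k < y' * y'" using assms(3) scale_pos(1) by (simp add: mult_less_cancel_right)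
  have "4 * (s * \<bar>Im z\<bar>)\<^sup>2 \<le> of_int (4 * ((\<bar>y\<bar> + r) * (\<bar>y\<bar> + r)))"
    using power_mono[OF b(2), of 2] s by (simp add: power2_eq_square)
  then have "of_int (y' * y' * D * (scale * scale)) \<le> (of_int (4 * ((\<bar>y\<bar> + r) * (\<bar>y\<bar> + r))) :: real)"
    using sq by simp
  then have "y' * y' * D * (scale * scale) \<le> 4 * ((\<bar>y\<bar> + r) * (\<bar>y\<bar> + r))" by (simp only: of_int_le_iff)
  then have "y' * y' * D * (scale * scale) < (k + 1) * (k + 1) * D * (scale * scale)" using c(4) by linarith
  then have k2: "y' * y' < (k + 1) * (k + 1)" using assms(3) scale_pos(1) by (simp add: mult_less_cancel_right)
  have "k\<^sup>2 < \<bar>y'\<bar>\<^sup>2" "\<bar>y'\<bar>\<^sup>2 < (k + 1)\<^sup>2" using k1 k2 by (simp_all add: power2_eq_square)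
  then have "k < \<bar>y'\<bar>" "\<bar>y'\<bar> < k + 1"
    using power2_less_imp_less[of k "\<bar>y'\<bar>"] power2_less_imp_less[of "\<bar>y'\<bar>" "k + 1"] c(2) by auto
  then show False by simp
qed

fun avoids_integers :: "int \<Rightarrow> int option \<Rightarrow> disc \<Rightarrow> bool" where
  "avoids_integers D None d = avoids_re d"
| "avoids_integers D (Some k) d = avoids_im D k d"

text \<open>
  The entries of \<open>(D, r, p, q, s, t, n, X, k)\<close>: the field, the rounded square root, the parameters of the
  map, the period, a disc around a point of the cycle, and the way in which the multiplier misses the ring:
  \<open>None\<close> for its real part, \<open>Some k\<close> for the interval of its imaginary part.
\<close>

type_synonym certificate =
  "int \<times> int \<times> (int \<times> int) \<times> (int \<times> int) \<times> int \<times> int \<times> nat \<times> disc \<times> int option"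

fun certified :: "certificate \<Rightarrow> bool" where
  "certified (D, r, p, q, s, t, n, X, k) \<longleftrightarrow>
     0 \<le> r \<and> r * r \<le> D * (scale * scale) \<and> D * (scale * scale) < (r + 1) * (r + 1) \<and>
     cycle_check (surd_disc r p) (surd_disc r q) s t n X (avoids_integers D k)"

definition quad_cycle :: "complex \<Rightarrow> complex \<Rightarrow> int \<Rightarrow> int \<Rightarrow> nat \<Rightarrow> complex \<Rightarrow> bool" where
  "quad_cycle p q s t n m \<longleftrightarrow> 1 \<le> n \<and>
     (\<exists>z. (\<forall>i<n. q * (quad p q s t ^^ i) z + of_int t \<noteq> 0) \<and> (quad p q s t ^^ n) z = z \<and>
       (\<forall>i. 0 < i \<longrightarrow> i < n \<longrightarrow> (quad p q s t ^^ i) z \<noteq> z) \<and>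
       m = (\<Prod>i<n. quad_deriv p q s t ((quad p q s t ^^ i) z)))"

text \<open>
  Complex conjugation maps the cycles of a map to those of the map with conjugate parameters, so one certificate serves both.
\<close>

lemma quad_cycle_cnj:
  assumes "quad_cycle p q s t n m"
  shows "quad_cycle (cnj p) (cnj q) s t n (cnj m)"
proof -
  have g: "quad (cnj p) (cnj q) s t (cnj z) = cnj (quad p q s t z)" for z
    by (simp add: quad_def)
  have it: "(quad (cnj p) (cnj q) s t ^^ i) (cnj z) = cnj ((quad p q s t ^^ i) z)" for i z
    by (induction i) (simp_all add: g)
  have d: "quad_deriv (cnj p) (cnj q) s t (cnj z) = cnj (quad_deriv p q s t z)" for z
    by (simp add: quad_deriv_def g)
  have nz: "cnj q * cnj w + of_int t \<noteq> 0" if "q * w + of_int t \<noteq> 0" for w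
    using that by (metis complex_cnj_add complex_cnj_mult complex_cnj_of_int complex_cnj_zero_iff)
  from assms obtain z where "1 \<le> n" "\<forall>i<n. q * (quad p q s t ^^ i) z + of_int t \<noteq> 0"
    "(quad p q s t ^^ n) z = z" "\<forall>i. 0 < i \<longrightarrow> i < n \<longrightarrow> (quad p q s t ^^ i) z \<noteq> z"
    "m = (\<Prod>i<n. quad_deriv p q s t ((quad p q s t ^^ i) z))"
    unfolding quad_cycle_def by blast
  then show ?thesis
    unfolding quad_cycle_def by (intro conjI exI[of _ "cnj z"]) (auto simp: it d nz)
qed

lemma certified_sound:
  assumes "certified (D, r, p, q, s, t, n, X, k)" and "D > 0" and "1 \<le> n"
  shows "\<exists>m. quad_cycle (surd D p) (surd D q) s t n m \<and>
    (case k of None \<Rightarrow> (\<forall>j. 2 * Re m \<noteq> of_int j) | Some _ \<Rightarrow> (\<forall>j. 2 * Im m \<noteq> of_int j * sqrt (of_int D)))"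
proof -
  have "in_disc (surd_disc r p) (surd D p)" "in_disc (surd_disc r q) (surd D q)"
    using assms(1) by (auto intro!: in_disc_surd)
  moreover have "cycle_check (surd_disc r p) (surd_disc r q) s t n X (avoids_integers D k)"
    using assms(1) by auto
  ultimately obtain z L where z: "(\<forall>i<n. surd D q * (quad (surd D p) (surd D q) s t ^^ i) z + of_int t \<noteq> 0)"
    "(quad (surd D p) (surd D q) s t ^^ n) z = z"
    "(\<forall>i. 0 < i \<longrightarrow> i < n \<longrightarrow> (quad (surd D p) (surd D q) s t ^^ i) z \<noteq> z)"
    and L: "avoids_integers D k L"
      "in_disc L (\<Prod>i<n. quad_deriv (surd D p) (surd D q) s t ((quad (surd D p) (surd D q) s t ^^ i) z))"
    using cycle_check_sound[of "surd_disc r p" "surd_disc r q" s t n X "avoids_integers D k" "surd D p" "surd D q"] assms(3)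
    by blast
  let ?m = "\<Prod>i<n. quad_deriv (surd D p) (surd D q) s t ((quad (surd D p) (surd D q) s t ^^ i) z)"
  show ?thesis
  proof (intro exI conjI)
    show "quad_cycle (surd D p) (surd D q) s t n ?m"
      unfolding quad_cycle_def using z assms(3) by blast
  next
    show "case k of None \<Rightarrow> (\<forall>j. 2 * Re ?m \<noteq> of_int j) | Some _ \<Rightarrow> (\<forall>j. 2 * Im ?m \<noteq> of_int j * sqrt (of_int D))"
    proof (cases k)
      case None
      then show ?thesis using L avoids_re_sound[of L ?m] by simp
    next
      case (Some k')
      then show ?thesis using L avoids_im_sound[of D k' L ?m] assms(2) by simp
    qed
  qed
qed

section \<open>Quadratic maps in homogeneous coordinates\<close>

text \<open>
  Homogeneous coordinates remove the case distinctions at infinity: a rational map acts by two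
  forms, and conjugacies become polynomial identities.
\<close>

definition pt :: "complex \<Rightarrow> complex \<Rightarrow> rsphere" where
  "pt u v = (if v = 0 then Infty else Fin (u / v))"

lemma pt_eq_iff:
  assumes "u \<noteq> 0 \<or> v \<noteq> 0" "u' \<noteq> 0 \<or> v' \<noteq> 0"
  shows "pt u v = pt u' v' \<longleftrightarrow> u * v' = u' * v"
  using assms by (auto simp: pt_def field_simps)

lemma Fin_pt: "Fin z = pt z 1" and Infty_pt: "Infty = pt 1 0"
  by (auto simp: pt_def)

lemma pt_cases:
  obtains u v where "u \<noteq> 0 \<or> v \<noteq> 0" "x = pt u v"
  by (cases x) (metis Fin_pt zero_neq_one, metis Infty_pt zero_neq_one)

definition mob :: "complex \<Rightarrow> complex \<Rightarrow> complex \<Rightarrow> complex \<Rightarrow> rsphere \<Rightarrow> rsphere" where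
  "mob a b c d = rat_fun [:b, a:] [:d, c:]"

lemma moebius_mob: "a * d - b * c \<noteq> 0 \<Longrightarrow> moebius (mob a b c d)"
  unfolding moebius_def mob_def by blast

lemma moebius_cases:
  assumes "moebius \<phi>"
  obtains a b c d where "a * d - b * c \<noteq> 0" "\<phi> = mob a b c d"
  using assms unfolding moebius_def mob_def by blast

lemma linear_nonzero:
  fixes a b c d u v :: complex
  assumes "a * d - b * c \<noteq> 0" "u \<noteq> 0 \<or> v \<noteq> 0"
  shows "a * u + b * v \<noteq> 0 \<or> c * u + d * v \<noteq> 0"
proof (rule ccontr)
  assume "\<not> ?thesis"
  then have "a * u + b * v = 0" "c * u + d * v = 0" by auto
  moreover have "(a * d - b * c) * u = d * (a * u + b * v) - b * (c * u + d * v)"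
    and "(a * d - b * c) * v = a * (c * u + d * v) - c * (a * u + b * v)"
    by (simp_all add: algebra_simps)
  ultimately have "(a * d - b * c) * u = 0" "(a * d - b * c) * v = 0" by simp_all
  then show False using assms by simp
qed

lemma mob_pt:
  assumes "a * d - b * c \<noteq> 0" "u \<noteq> 0 \<or> v \<noteq> 0"
  shows "mob a b c d (pt u v) = pt (a * u + b * v) (c * u + d * v)"
proof (cases "v = 0")
  case True
  have "a \<noteq> 0 \<or> c \<noteq> 0" using assms(1) by auto
  then have "max (degree [:b, a:]) (degree [:d, c:]) = 1" by auto
  then show ?thesis using True assms by (auto simp: mob_def pt_def Let_def)
next
  case False
  have "c * u + d * v = 0 \<longleftrightarrow> d + u / v * c = 0" using False by (simp add: field_simps)
  moreover have "d + u / v * c \<noteq> 0 \<Longrightarrow> (b + u / v * a) / (d + u / v * c) = (a * u + b * v) / (c * u + d * v)"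
    using False by (simp add: divide_simps) (simp add: algebra_simps)
  ultimately show ?thesis using False by (auto simp: mob_def pt_def)
qed

lemma mob_comp:
  assumes "a * d - b * c \<noteq> 0" "a' * d' - b' * c' \<noteq> 0"
  shows "mob a b c d \<circ> mob a' b' c' d' =
    mob (a * a' + b * c') (a * b' + b * d') (c * a' + d * c') (c * b' + d * d')"
proof
  fix x
  obtain u v where x: "u \<noteq> 0 \<or> v \<noteq> 0" "x = pt u v" by (rule pt_cases)
  have "(a * a' + b * c') * (c * b' + d * d') - (a * b' + b * d') * (c * a' + d * c') =
      (a * d - b * c) * (a' * d' - b' * c')" by (simp add: algebra_simps)
  then have det: "(a * a' + b * c') * (c * b' + d * d') - (a * b' + b * d') * (c * a' + d * c') \<noteq> 0"
    using assms by simp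
  have "a * (a' * u + b' * v) + b * (c' * u + d' * v) = (a * a' + b * c') * u + (a * b' + b * d') * v"
    and "c * (a' * u + b' * v) + d * (c' * u + d' * v) = (c * a' + d * c') * u + (c * b' + d * d') * v"
    by (simp_all add: algebra_simps)
  then show "(mob a b c d \<circ> mob a' b' c' d') x =
      mob (a * a' + b * c') (a * b' + b * d') (c * a' + d * c') (c * b' + d * d') x"
    using mob_pt[OF assms(1) linear_nonzero[OF assms(2) x(1)]] mob_pt[OF assms(2) x(1)] mob_pt[OF det x(1)] x(2)
    by simp
qed

lemma mob_inverse:
  assumes "a * d - b * c \<noteq> 0"
  shows "mob d (- b) (- c) a (mob a b c d x) = x" "mob a b c d (mob d (- b) (- c) a x) = x"
proof -
  obtain u v where x: "u \<noteq> 0 \<or> v \<noteq> 0" "x = pt u v" by (rule pt_cases)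
  have det: "d * a - (- b) * (- c) \<noteq> 0" using assms by (simp add: mult.commute)
  have "mob d (- b) (- c) a (mob a b c d x) = pt ((a * d - b * c) * u) ((a * d - b * c) * v)"
    using assms det x linear_nonzero[OF assms x(1)] by (simp add: mob_pt) (simp add: algebra_simps)
  then show "mob d (- b) (- c) a (mob a b c d x) = x" using x assms by (auto simp: pt_def)
  have "mob a b c d (mob d (- b) (- c) a x) = pt ((a * d - b * c) * u) ((a * d - b * c) * v)"
    using assms det x linear_nonzero[OF det x(1)] by (simp add: mob_pt) (simp add: algebra_simps)
  then show "mob a b c d (mob d (- b) (- c) a x) = x" using x assms by (auto simp: pt_def)
qed

lemma conjugate_sym: assumes "conjugate f g" shows "conjugate g f"
proof -
  obtain \<phi> where \<phi>: "moebius \<phi>" "\<phi> \<circ> f = g \<circ> \<phi>" using assms unfolding conjugate_def by blast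
  obtain a b c d where m: "a * d - b * c \<noteq> 0" "\<phi> = mob a b c d" using \<phi>(1) by (rule moebius_cases)
  have det: "d * a - (- b) * (- c) \<noteq> 0" using m(1) by (simp add: mult.commute)
  have "(mob d (- b) (- c) a \<circ> g) x = (f \<circ> mob d (- b) (- c) a) x" for x
    using fun_cong[OF \<phi>(2), of "mob d (- b) (- c) a x"] mob_inverse[OF m(1)] m(2)
    by (metis comp_apply)
  then show ?thesis unfolding conjugate_def using moebius_mob[OF det] by blast
qed

lemma conjugate_trans: assumes "conjugate f g" "conjugate g h" shows "conjugate f h"
proof -
  obtain \<phi> \<psi> where \<phi>: "moebius \<phi>" "\<phi> \<circ> f = g \<circ> \<phi>" and \<psi>: "moebius \<psi>" "\<psi> \<circ> g = h \<circ> \<psi>"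
    using assms unfolding conjugate_def by blast
  obtain a b c d where m: "a * d - b * c \<noteq> 0" "\<phi> = mob a b c d" using \<phi>(1) by (rule moebius_cases)
  obtain a' b' c' d' where m': "a' * d' - b' * c' \<noteq> 0" "\<psi> = mob a' b' c' d'" using \<psi>(1) by (rule moebius_cases)
  have "(a' * a + b' * c) * (c' * b + d' * d) - (a' * b + b' * d) * (c' * a + d' * c) =
      (a' * d' - b' * c') * (a * d - b * c)" by (simp add: algebra_simps)
  then have "moebius (\<psi> \<circ> \<phi>)"
    unfolding m(2) m'(2) mob_comp[OF m'(1) m(1)] using m(1) m'(1) by (intro moebius_mob) simp
  moreover have "(\<psi> \<circ> \<phi>) \<circ> f = h \<circ> (\<psi> \<circ> \<phi>)" using \<phi>(2) \<psi>(2) by (metis comp_assoc)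
  ultimately show ?thesis unfolding conjugate_def by blast
qed

definition qform :: "complex \<Rightarrow> complex \<Rightarrow> complex \<Rightarrow> complex \<Rightarrow> complex \<Rightarrow> complex" where
  "qform c0 c1 c2 u v = c2 * u\<^sup>2 + c1 * u * v + c0 * v\<^sup>2"

definition qmap :: "complex \<Rightarrow> complex \<Rightarrow> complex \<Rightarrow> complex \<Rightarrow> complex \<Rightarrow> complex \<Rightarrow> rsphere \<Rightarrow> rsphere" where
  "qmap p0 p1 p2 q0 q1 q2 = rat_fun [:p0, p1, p2:] [:q0, q1, q2:]"

definition nondeg :: "complex \<Rightarrow> complex \<Rightarrow> complex \<Rightarrow> complex \<Rightarrow> complex \<Rightarrow> complex \<Rightarrow> bool" where
  "nondeg p0 p1 p2 q0 q1 q2 \<longleftrightarrow>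
     (\<forall>u v. u \<noteq> 0 \<or> v \<noteq> 0 \<longrightarrow> qform p0 p1 p2 u v \<noteq> 0 \<or> qform q0 q1 q2 u v \<noteq> 0)"

lemma qmap_pt:
  assumes "nondeg p0 p1 p2 q0 q1 q2" "u \<noteq> 0 \<or> v \<noteq> 0"
  shows "qmap p0 p1 p2 q0 q1 q2 (pt u v) = pt (qform p0 p1 p2 u v) (qform q0 q1 q2 u v)"
proof (cases "v = 0")
  case True
  have "qform p0 p1 p2 1 0 \<noteq> 0 \<or> qform q0 q1 q2 1 0 \<noteq> 0"
    using assms(1) unfolding nondeg_def by simp
  then have "p2 \<noteq> 0 \<or> q2 \<noteq> 0" by (simp add: qform_def)
  then have "max (degree [:p0, p1, p2:]) (degree [:q0, q1, q2:]) = 2" by auto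
  moreover have "coeff [:a, b, c:] 2 = c" for a b c :: complex by (simp add: numeral_2_eq_2)
  ultimately show ?thesis using True assms by (auto simp: qmap_def pt_def Let_def qform_def)
next
  case False
  have e: "poly [:c0, c1, c2:] (u / v) = qform c0 c1 c2 u v / v\<^sup>2" for c0 c1 c2
    using False by (simp add: qform_def field_simps power2_eq_square)
  show ?thesis using False unfolding pt_def qmap_def by (simp add: e del: poly_pCons)
qed

lemma rational_map_2_cases:
  assumes "rational_map 2 f"
  obtains p0 p1 p2 q0 q1 q2 where "nondeg p0 p1 p2 q0 q1 q2" "f = qmap p0 p1 p2 q0 q1 q2"
proof -
  obtain p q where pq: "coprime p q" "max (degree p) (degree q) = 2" "f = rat_fun p q"
    using assms unfolding rational_map_def by blast
  have e: "r = [:coeff r 0, coeff r 1, coeff r 2:]" if "degree r \<le> 2" for r :: "complex poly"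
  proof (rule poly_eqI)
    fix n :: nat
    consider "n = 0" | "n = 1" | "n = 2" | "n > 2" by linarith
    then show "coeff r n = coeff [:coeff r 0, coeff r 1, coeff r 2:] n"
      using that by cases (auto simp: numeral_2_eq_2 coeff_eq_0 coeff_pCons split: nat.splits)
  qed
  have p: "p = [:coeff p 0, coeff p 1, coeff p 2:]" and q: "q = [:coeff q 0, coeff q 1, coeff q 2:]"
    using pq(2) by (intro e; simp add: max_def split: if_splits)+
  have "nondeg (coeff p 0) (coeff p 1) (coeff p 2) (coeff q 0) (coeff q 1) (coeff q 2)"
    unfolding nondeg_def
  proof (intro allI impI, rule ccontr)
    fix u v :: complex assume uv: "u \<noteq> 0 \<or> v \<noteq> 0"
      and "\<not> (qform (coeff p 0) (coeff p 1) (coeff p 2) u v \<noteq> 0 \<or> qform (coeff q 0) (coeff q 1) (coeff q 2) u v \<noteq> 0)"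
    then have z: "qform (coeff p 0) (coeff p 1) (coeff p 2) u v = 0" "qform (coeff q 0) (coeff q 1) (coeff q 2) u v = 0"
      by auto
    show False
    proof (cases "v = 0")
      case True
      then have "coeff p 2 = 0" "coeff q 2 = 0" using z uv by (auto simp: qform_def)
      moreover have "degree p = 2 \<or> degree q = 2" using pq(2) by (auto simp: max_def split: if_splits)
      ultimately show False by (metis leading_coeff_0_iff degree_0 zero_neq_numeral)
    next
      case False
      have "poly [:c0, c1, c2:] (u / v) = qform c0 c1 c2 u v / v\<^sup>2" for c0 c1 c2
        using False by (simp add: qform_def field_simps power2_eq_square)
      then have "poly p (u / v) = 0" "poly q (u / v) = 0" using z p q by (metis div_0)+
      then have "[:- (u / v), 1:] dvd p" "[:- (u / v), 1:] dvd q" by (simp_all add: poly_eq_0_iff_dvd)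
      then have "is_unit [:- (u / v), 1:]" using pq(1) coprime_common_divisor by blast
      then show False by (simp add: is_unit_iff_degree)
    qed
  qed
  moreover have "f = qmap (coeff p 0) (coeff p 1) (coeff p 2) (coeff q 0) (coeff q 1) (coeff q 2)"
    unfolding qmap_def p[symmetric] q[symmetric] by (rule pq(3))
  ultimately show ?thesis by (rule that)
qed

text \<open>
  A conjugacy of nondegenerate quadratic maps amounts to one identity between binary cubic forms.
\<close>

lemma conjugate_qmap:
  assumes f: "nondeg p0 p1 p2 q0 q1 q2" and g: "nondeg p0' p1' p2' q0' q1' q2'" and det: "a * d - b * c \<noteq> 0"
    and eq: "\<And>u v.
      (a * qform p0 p1 p2 u v + b * qform q0 q1 q2 u v) * qform q0' q1' q2' (a * u + b * v) (c * u + d * v) =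
      (c * qform p0 p1 p2 u v + d * qform q0 q1 q2 u v) * qform p0' p1' p2' (a * u + b * v) (c * u + d * v)"
  shows "mob a b c d \<circ> qmap p0 p1 p2 q0 q1 q2 = qmap p0' p1' p2' q0' q1' q2' \<circ> mob a b c d"
    "conjugate (qmap p0 p1 p2 q0 q1 q2) (qmap p0' p1' p2' q0' q1' q2')"
proof -
  show "mob a b c d \<circ> qmap p0 p1 p2 q0 q1 q2 = qmap p0' p1' p2' q0' q1' q2' \<circ> mob a b c d"
  proof
    fix x
    obtain u v where x: "u \<noteq> 0 \<or> v \<noteq> 0" "x = pt u v" by (rule pt_cases)
    have fz: "qform p0 p1 p2 u v \<noteq> 0 \<or> qform q0 q1 q2 u v \<noteq> 0" using f x unfolding nondeg_def by blast
    have l: "a * u + b * v \<noteq> 0 \<or> c * u + d * v \<noteq> 0" by (rule linear_nonzero[OF det x(1)])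
    have gz: "qform p0' p1' p2' (a * u + b * v) (c * u + d * v) \<noteq> 0 \<or> qform q0' q1' q2' (a * u + b * v) (c * u + d * v) \<noteq> 0"
      using g l unfolding nondeg_def by blast
    show "(mob a b c d \<circ> qmap p0 p1 p2 q0 q1 q2) x = (qmap p0' p1' p2' q0' q1' q2' \<circ> mob a b c d) x"
      using x fz l gz eq[of u v] linear_nonzero[OF det fz]
      by (simp add: qmap_pt[OF f] qmap_pt[OF g] mob_pt[OF det] pt_eq_iff mult.commute)
  qed
  then show "conjugate (qmap p0 p1 p2 q0 q1 q2) (qmap p0' p1' p2' q0' q1' q2')"
    unfolding conjugate_def using moebius_mob[OF det] by blast
qed

definition qpolar :: "complex \<Rightarrow> complex \<Rightarrow> complex \<Rightarrow> complex \<Rightarrow> complex \<Rightarrow> complex \<Rightarrow> complex \<Rightarrow> complex" where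
  "qpolar c0 c1 c2 u v u' v' = 2 * c2 * u * u' + c1 * (u * v' + u' * v) + 2 * c0 * v * v'"

lemma qform_linear:
  "qform c0 c1 c2 (x * u + x' * v) (y * u + y' * v) =
     qform (qform c0 c1 c2 x' y') (qpolar c0 c1 c2 x y x' y') (qform c0 c1 c2 x y) u v"
  by (simp add: qform_def qpolar_def algebra_simps power2_eq_square)

lemma change_of_basis:
  assumes f: "nondeg p0 p1 p2 q0 q1 q2" and det: "x * y' - x' * y \<noteq> 0"
  defines "A \<equiv> \<lambda>P Q. y' * P - x' * Q" and "B \<equiv> \<lambda>P Q. x * Q - y * P"
  defines "p0' \<equiv> A (qform p0 p1 p2 x' y') (qform q0 q1 q2 x' y')"
    and "p1' \<equiv> A (qpolar p0 p1 p2 x y x' y') (qpolar q0 q1 q2 x y x' y')"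
    and "p2' \<equiv> A (qform p0 p1 p2 x y) (qform q0 q1 q2 x y)"
    and "q0' \<equiv> B (qform p0 p1 p2 x' y') (qform q0 q1 q2 x' y')"
    and "q1' \<equiv> B (qpolar p0 p1 p2 x y x' y') (qpolar q0 q1 q2 x y x' y')"
    and "q2' \<equiv> B (qform p0 p1 p2 x y) (qform q0 q1 q2 x y)"
  shows "nondeg p0' p1' p2' q0' q1' q2'"
    "qmap p0' p1' p2' q0' q1' q2' \<circ> mob y' (- x') (- y) x = mob y' (- x') (- y) x \<circ> qmap p0 p1 p2 q0 q1 q2"
    "conjugate (qmap p0 p1 p2 q0 q1 q2) (qmap p0' p1' p2' q0' q1' q2')"
proof -
  have det': "y' * x - (- x') * (- y) \<noteq> 0" using det by (simp add: algebra_simps)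
  have P: "qform p0' p1' p2' u v = A (qform p0 p1 p2 (x * u + x' * v) (y * u + y' * v)) (qform q0 q1 q2 (x * u + x' * v) (y * u + y' * v))"
    and Q: "qform q0' q1' q2' u v = B (qform p0 p1 p2 (x * u + x' * v) (y * u + y' * v)) (qform q0 q1 q2 (x * u + x' * v) (y * u + y' * v))" for u v :: complex
    unfolding qform_linear unfolding p0'_def p1'_def p2'_def q0'_def q1'_def q2'_def A_def B_def qform_def[of _ _ _ u v]
    by (simp_all add: algebra_simps)
  show nd: "nondeg p0' p1' p2' q0' q1' q2'"
    unfolding nondeg_def
  proof (intro allI impI)
    fix u v :: complex assume "u \<noteq> 0 \<or> v \<noteq> 0"
    then have "x * u + x' * v \<noteq> 0 \<or> y * u + y' * v \<noteq> 0" using det by (intro linear_nonzero) auto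
    then have "qform p0 p1 p2 (x * u + x' * v) (y * u + y' * v) \<noteq> 0 \<or> qform q0 q1 q2 (x * u + x' * v) (y * u + y' * v) \<noteq> 0"
      using f unfolding nondeg_def by blast
    from linear_nonzero[OF det' this] show "qform p0' p1' p2' u v \<noteq> 0 \<or> qform q0' q1' q2' u v \<noteq> 0"
      unfolding P Q A_def B_def by simp
  qed
  have e: "qform c0 c1 c2 (x * (y' * u + - x' * v) + x' * (- y * u + x * v)) (y * (y' * u + - x' * v) + y' * (- y * u + x * v)) =
      (x * y' - x' * y)\<^sup>2 * qform c0 c1 c2 u v" for c0 c1 c2 u v :: complex
  proof -
    have "x * (y' * u + - x' * v) + x' * (- y * u + x * v) = (x * y' - x' * y) * u"
      and "y * (y' * u + - x' * v) + y' * (- y * u + x * v) = (x * y' - x' * y) * v"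
      by (simp_all add: algebra_simps)
    then show ?thesis by (simp add: qform_def algebra_simps power2_eq_square)
  qed
  have "(y' * qform p0 p1 p2 u v + - x' * qform q0 q1 q2 u v) * qform q0' q1' q2' (y' * u + - x' * v) (- y * u + x * v) =
      (- y * qform p0 p1 p2 u v + x * qform q0 q1 q2 u v) * qform p0' p1' p2' (y' * u + - x' * v) (- y * u + x * v)" for u v :: complex
    unfolding P Q e unfolding A_def B_def by (simp add: algebra_simps)
  note * = conjugate_qmap[OF f nd det' this]
  show "conjugate (qmap p0 p1 p2 q0 q1 q2) (qmap p0' p1' p2' q0' q1' q2')" using *(2) .
  show "qmap p0' p1' p2' q0' q1' q2' \<circ> mob y' (- x') (- y) x = mob y' (- x') (- y) x \<circ> qmap p0 p1 p2 q0 q1 q2"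
    using *(1) by simp
qed

lemma qmap_fixed_iff:
  assumes "nondeg p0 p1 p2 q0 q1 q2" "u \<noteq> 0 \<or> v \<noteq> 0"
  shows "qmap p0 p1 p2 q0 q1 q2 (pt u v) = pt u v \<longleftrightarrow> qform p0 p1 p2 u v * v = u * qform q0 q1 q2 u v"
proof -
  have "qform p0 p1 p2 u v \<noteq> 0 \<or> qform q0 q1 q2 u v \<noteq> 0" using assms unfolding nondeg_def by blast
  then show ?thesis using assms by (simp add: qmap_pt pt_eq_iff)
qed

lemma nonconstant_poly_root:
  fixes p :: "complex poly"
  assumes "degree p > 0" obtains z where "poly p z = 0"
  using fundamental_theorem_of_algebra[of p] assms by (auto simp: constant_degree)

lemma qmap_has_fixed_point:
  assumes "nondeg p0 p1 p2 q0 q1 q2"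
  obtains u v where "u \<noteq> 0 \<or> v \<noteq> 0" "qform p0 p1 p2 u v * v = u * qform q0 q1 q2 u v"
proof (cases "q2 = 0")
  case True
  then show ?thesis using that[of 1 0] by (simp add: qform_def)
next
  case False
  then have "degree [:- p0, q0 - p1, q1 - p2, q2:] > 0" by simp
  then obtain z where "poly [:- p0, q0 - p1, q1 - p2, q2:] z = 0" by (rule nonconstant_poly_root)
  then show ?thesis using that[of z 1] by (simp add: qform_def algebra_simps power2_eq_square)
qed

definition quadratic :: "complex \<Rightarrow> complex \<Rightarrow> int \<Rightarrow> int \<Rightarrow> rsphere \<Rightarrow> rsphere" where
  "quadratic p q s t = qmap (of_int s) p 1 (of_int t) q 0"

lemma nondeg_quadratic: "p * q \<noteq> 1 \<Longrightarrow> nondeg (of_int 0) p 1 (of_int 1) q 0"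
  unfolding nondeg_def
proof (intro allI impI)
  fix u v :: complex assume pq: "p * q \<noteq> 1" and uv: "u \<noteq> 0 \<or> v \<noteq> 0"
  have e: "qform (of_int 0) p 1 u v = u * (u + p * v)" "qform (of_int 1) q 0 u v = v * (q * u + v)"
    by (simp_all add: qform_def algebra_simps power2_eq_square)
  have "False" if "u = - p * v" "v \<noteq> 0" "q * u + v = 0"
  proof -
    have "q * u + v = v * (1 - p * q)" using that(1) by (simp add: algebra_simps)
    then show False using that pq by simp
  qed
  then show "qform (of_int 0) p 1 u v \<noteq> 0 \<or> qform (of_int 1) q 0 u v \<noteq> 0"
    using uv unfolding e by (auto simp: add_eq_0_iff2)
qed

lemma nondeg_cauliflower: "nondeg (of_int 1) 0 1 (of_int 0) 1 0"
  unfolding nondeg_def by (auto simp: qform_def)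

lemma two_fixed_points_normal_form:
  assumes f: "nondeg p0 p1 p2 q0 q1 q2"
    and uv: "u * v' - u' * v \<noteq> 0"
    and "qform p0 p1 p2 u v * v = u * qform q0 q1 q2 u v"
    and "qform p0 p1 p2 u' v' * v' = u' * qform q0 q1 q2 u' v'"
  shows "\<exists>p q. p * q \<noteq> 1 \<and> conjugate (qmap p0 p1 p2 q0 q1 q2) (quadratic p q 0 1)"
proof -
  define r1 where "r1 = v' * qpolar p0 p1 p2 u v u' v' - u' * qpolar q0 q1 q2 u v u' v'"
  define r2 where "r2 = v' * qform p0 p1 p2 u v - u' * qform q0 q1 q2 u v"
  define s0 where "s0 = u * qform q0 q1 q2 u' v' - v * qform p0 p1 p2 u' v'"
  define s1 where "s1 = u * qpolar q0 q1 q2 u v u' v' - v * qpolar p0 p1 p2 u v u' v'"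
  have z: "v' * qform p0 p1 p2 u' v' - u' * qform q0 q1 q2 u' v' = 0" "u * qform q0 q1 q2 u v - v * qform p0 p1 p2 u v = 0"
    using assms(3,4) by (simp_all add: mult.commute)
  note * = change_of_basis[OF f uv, unfolded z, folded r1_def r2_def s0_def s1_def]
  have nd: "qform 0 r1 r2 u v \<noteq> 0 \<or> qform s0 s1 0 u v \<noteq> 0" if "u \<noteq> 0 \<or> v \<noteq> 0" for u v
    using *(1) that unfolding nondeg_def by blast
  have r2: "r2 \<noteq> 0" using nd[of 1 0] by (simp add: qform_def)
  have s0: "s0 \<noteq> 0" using nd[of 0 1] by (simp add: qform_def)
  have pq: "r1 / s0 * (s1 / r2) \<noteq> 1"
  proof
    assume "r1 / s0 * (s1 / r2) = 1"
    then have "r1 * s1 = s0 * r2" using r2 s0 by (simp add: field_simps)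
    then have "qform 0 r1 r2 r1 (- r2) = 0" "qform s0 s1 0 r1 (- r2) = 0"
      by (simp_all add: qform_def algebra_simps power2_eq_square)
    then show False using nd[of r1 "- r2"] r2 by simp
  qed
  have "conjugate (qmap 0 r1 r2 s0 s1 0) (quadratic (r1 / s0) (s1 / r2) 0 1)"
    unfolding quadratic_def
    by (rule conjugate_qmap(2)[OF *(1) nondeg_quadratic[OF pq], of r2 s0 0 0])
      (use r2 s0 in \<open>simp_all add: qform_def field_simps power2_eq_square\<close>)
  then show ?thesis using *(3) conjugate_trans pq by blast
qed

lemma one_fixed_point_normal_form:
  assumes f: "nondeg p0 p1 p2 q0 q1 q2"
    and uv: "u \<noteq> 0 \<or> v \<noteq> 0" "qform p0 p1 p2 u v * v = u * qform q0 q1 q2 u v"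
    and one: "\<And>x. qmap p0 p1 p2 q0 q1 q2 x = x \<Longrightarrow> x = pt u v"
  shows "conjugate (qmap p0 p1 p2 q0 q1 q2) (quadratic 0 1 1 0)"
proof -
  obtain u' v' where det: "u * v' - u' * v \<noteq> 0"
  proof (cases "u = 0")
    case True
    then show ?thesis using that[of 0 1] uv that[of 1 0] by simp
  next
    case False
    then show ?thesis using that[of 1 0] by simp
  qed
  define r0 where "r0 = v' * qform p0 p1 p2 u' v' - u' * qform q0 q1 q2 u' v'"
  define r1 where "r1 = v' * qpolar p0 p1 p2 u v u' v' - u' * qpolar q0 q1 q2 u v u' v'"
  define r2 where "r2 = v' * qform p0 p1 p2 u v - u' * qform q0 q1 q2 u v"
  define s0 where "s0 = u * qform q0 q1 q2 u' v' - v * qform p0 p1 p2 u' v'"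
  define s1 where "s1 = u * qpolar q0 q1 q2 u v u' v' - v * qpolar p0 p1 p2 u v u' v'"
  have z: "u * qform q0 q1 q2 u v - v * qform p0 p1 p2 u v = 0"
    using uv(2) by (simp add: mult.commute)
  note * = change_of_basis[OF f det, unfolded z, folded r0_def r1_def r2_def s0_def s1_def]
  let ?f = "qmap p0 p1 p2 q0 q1 q2" and ?g = "qmap r0 r1 r2 s0 s1 0"
  let ?\<phi> = "mob v' (- u') (- v) u" and ?\<psi> = "mob u u' v v'"
  have det': "v' * u - (- u') * (- v) \<noteq> 0" using det by (simp add: algebra_simps)
  have inv: "?\<psi> (?\<phi> x) = x" "?\<phi> (?\<psi> x) = x" for x
    using mob_inverse[OF det'] by simp_all
  have only: "x = Infty" if "?g x = x" for x
  proof -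
    have "?\<phi> (?f (?\<psi> x)) = x"
      using fun_cong[OF *(2), of "?\<psi> x"] that inv by simp
    then have "?f (?\<psi> x) = ?\<psi> x" using inv by metis
    then have "?\<psi> x = pt u v" by (rule one)
    then have "x = ?\<phi> (pt u v)" using inv by metis
    also have "\<dots> = pt (v' * u - u' * v) 0" using mob_pt[OF det' uv(1)] by (simp add: mult.commute)
    finally show ?thesis by (simp add: pt_def)
  qed
  have nofix: "qform r0 r1 r2 z 1 \<noteq> z * qform s0 s1 0 z 1" for z
    using only[of "Fin z"] qmap_fixed_iff[OF *(1), of z 1] Fin_pt[of z] by auto
  have nofix: "(r2 - s1) * z\<^sup>2 + (r1 - s0) * z + r0 \<noteq> 0" for z
    using nofix[of z] by (simp add: qform_def algebra_simps power2_eq_square)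
  have 1: "r2 = s1"
  proof (rule ccontr)
    assume "r2 \<noteq> s1"
    then have "degree [:r0, r1 - s0, r2 - s1:] > 0" by simp
    then obtain z where "poly [:r0, r1 - s0, r2 - s1:] z = 0" by (rule nonconstant_poly_root)
    then show False using nofix[of z] by (simp add: algebra_simps power2_eq_square)
  qed
  have 2: "r1 = s0"
  proof (rule ccontr)
    assume "r1 \<noteq> s0"
    then show False using nofix[of "- r0 / (r1 - s0)"] 1 by simp
  qed
  have 3: "r0 \<noteq> 0" using nofix[of 0] by simp
  have r2: "r2 \<noteq> 0"
    using *(1)[unfolded nondeg_def, rule_format, of 1 0] by (simp add: qform_def)
  define k where "k = csqrt (r0 * r2)"
  have k: "k * k = r0 * r2" "k \<noteq> 0" using 3 r2 by (auto simp: k_def power2_eq_square[symmetric])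
  have "conjugate ?g (quadratic 0 1 1 0)"
    unfolding quadratic_def
  proof (rule conjugate_qmap(2)[OF *(1) nondeg_cauliflower, of r2 k r1 0])
    fix x y
    have "qform r0 r1 r2 x y = x * (r2 * x + r1 * y) + r0 * y\<^sup>2" "qform s0 s1 0 x y = y * (r2 * x + r1 * y)"
      using 1 2 by (simp_all add: qform_def algebra_simps power2_eq_square)
    moreover have "qform (of_int 1) 0 1 X Y = X * X + Y * Y" "qform (of_int 0) 1 0 X Y = X * Y" for X Y
      by (simp_all add: qform_def power2_eq_square)
    moreover have "(r2 * (x * L + r0 * y\<^sup>2) + r1 * (y * L)) * (L * (0 * x + k * y)) =
      (0 * (x * L + r0 * y\<^sup>2) + k * (y * L)) * (L * L + (0 * x + k * y) * (0 * x + k * y))"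
      if L: "L = r2 * x + r1 * y" for L
    proof -
      have "(r2 * (x * L + r0 * y\<^sup>2) + r1 * (y * L)) * (L * (k * y)) = k * y * L * ((r2 * x + r1 * y) * L + (r0 * r2) * y\<^sup>2)"
        by (simp add: algebra_simps)
      also have "\<dots> = k * y * L * (L * L + (k * k) * y\<^sup>2)" unfolding k L ..
      finally show ?thesis by (simp add: algebra_simps power2_eq_square)
    qed
    ultimately show "(r2 * qform r0 r1 r2 x y + r1 * qform s0 s1 0 x y) * qform (of_int 0) 1 0 (r2 * x + r1 * y) (0 * x + k * y) =
      (0 * qform r0 r1 r2 x y + k * qform s0 s1 0 x y) * qform (of_int 1) 0 1 (r2 * x + r1 * y) (0 * x + k * y)"
      by simp
  qed (use k r2 in simp)
  then show ?thesis using *(3) conjugate_trans by blast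
qed

text \<open>
  A fixed point exists because the fixed point equation is a nonzero cubic form. With a second
  fixed point both can be moved to \<open>0\<close> and \<open>\<infinity>\<close>; otherwise the only one is moved to \<open>\<infinity>\<close>, where the fixed point
  equation has to be constant.
\<close>

theorem quadratic_normal_form:
  assumes "rational_map 2 f"
  shows "(\<exists>p q. p * q \<noteq> 1 \<and> conjugate f (quadratic p q 0 1)) \<or> conjugate f (quadratic 0 1 1 0)"
proof -
  obtain p0 p1 p2 q0 q1 q2 where f: "nondeg p0 p1 p2 q0 q1 q2" "f = qmap p0 p1 p2 q0 q1 q2"
    using assms by (rule rational_map_2_cases)
  obtain u v where uv: "u \<noteq> 0 \<or> v \<noteq> 0" "qform p0 p1 p2 u v * v = u * qform q0 q1 q2 u v"
    using f(1) by (rule qmap_has_fixed_point)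
  show ?thesis
  proof (cases "\<exists>x. f x = x \<and> x \<noteq> pt u v")
    case True
    then obtain x where x: "f x = x" "x \<noteq> pt u v" by blast
    obtain u' v' where x': "u' \<noteq> 0 \<or> v' \<noteq> 0" "x = pt u' v'" by (rule pt_cases)
    have "qform p0 p1 p2 u' v' * v' = u' * qform q0 q1 q2 u' v'"
      using x(1) qmap_fixed_iff[OF f(1) x'(1)] x'(2) f(2) by simp
    moreover have "u * v' - u' * v \<noteq> 0"
      using x(2) x' uv(1) pt_eq_iff[OF x'(1) uv(1)] by (auto simp: mult.commute)
    ultimately show ?thesis using two_fixed_points_normal_form[OF f(1) _ uv(2)] f(2) by blast
  next
    case False
    then show ?thesis using one_fixed_point_normal_form[OF f(1) uv] f(2) by blast
  qed
qed

lemma quadratic_Fin: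
  assumes "q * z + of_int t \<noteq> 0"
  shows "quadratic p q s t (Fin z) = Fin (quad p q s t z)"
  using assms by (simp add: quadratic_def qmap_def quad_def algebra_simps)

lemma quadratic_iter_Fin:
  assumes "\<And>i. i < n \<Longrightarrow> q * (quad p q s t ^^ i) z + of_int t \<noteq> 0"
  shows "(quadratic p q s t ^^ n) (Fin z) = Fin ((quad p q s t ^^ n) z)"
  using assms by (induction n) (simp_all add: quadratic_Fin)

lemma quad_iter_eventually_defined:
  assumes "\<And>i. i < n \<Longrightarrow> q * (quad p q s t ^^ i) z + of_int t \<noteq> 0"
  shows "\<forall>\<^sub>F w in nhds z. \<forall>i<n. q * (quad p q s t ^^ i) w + of_int t \<noteq> 0"
proof -
  have "\<forall>\<^sub>F w in nhds z. q * (quad p q s t ^^ i) w + of_int t \<noteq> 0" if "i < n" for i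
  proof -
    have "isCont (quad p q s t ^^ i) z"
      using quad_iter_has_derivative[of i q p s t z] assms that by (intro DERIV_isCont) auto
    then have "isCont (\<lambda>w. q * (quad p q s t ^^ i) w + of_int t) z"
      by (intro continuous_intros)
    then have "((\<lambda>w. q * (quad p q s t ^^ i) w + of_int t) \<longlongrightarrow> q * (quad p q s t ^^ i) z + of_int t) (nhds z)"
      by (simp add: isCont_def tendsto_nhds_iff)
    then show ?thesis by (rule tendsto_imp_eventually_ne) (use assms that in auto)
  qed
  then have "\<forall>\<^sub>F w in nhds z. \<forall>i\<in>{..<n}. q * (quad p q s t ^^ i) w + of_int t \<noteq> 0"
    by (intro eventually_ball_finite) auto
  then show ?thesis by (rule eventually_mono) simp
qed

fun chart :: "rsphere \<Rightarrow> rsphere \<Rightarrow> complex" where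
  "chart (Fin _) y = coord y"
| "chart Infty y = coord (rinv y)"

fun chart_inv :: "rsphere \<Rightarrow> complex \<Rightarrow> rsphere" where
  "chart_inv (Fin _) w = Fin w"
| "chart_inv Infty w = rinv (Fin w)"

lemma fixpoint_deriv_chart: "fixpoint_deriv g x = deriv (\<lambda>w. chart x (g (chart_inv x w))) (chart x x)"
  by (cases x) simp_all

text \<open>
  In charts every Moebius map is again a fractional linear expression, which treats finite and infinite points alike.
\<close>

lemma chart_mob:
  assumes "a * d - b * c \<noteq> 0"
  obtains a' b' c' d' where "a' * d' - b' * c' \<noteq> 0"
    "\<And>w. mob a b c d (chart_inv x w) = pt (a' * w + b') (c' * w + d')"
    "\<And>u. chart x (mob d (- b) (- c) a (Fin u)) = (d' * u - b') / (a' - c' * u)"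
proof (cases x)
  case (Fin z)
  have "d * a - (- b) * (- c) \<noteq> 0" using assms by (simp add: mult.commute)
  then have "mob d (- b) (- c) a (Fin u) = pt (d * u - b) (a - c * u)" for u
    using mob_pt[of d a "- b" "- c" u 1] by (simp add: Fin_pt)
  moreover have "mob a b c d (Fin w) = pt (a * w + b) (c * w + d)" for w
    using mob_pt[OF assms, of w 1] by (simp add: Fin_pt)
  ultimately show ?thesis using that[of a d b c] assms Fin by (simp add: pt_def)
next
  case Infty
  have "d * a - (- b) * (- c) \<noteq> 0" using assms by (simp add: mult.commute)
  then have m: "mob d (- b) (- c) a (Fin u) = pt (d * u - b) (a - c * u)" for u
    using mob_pt[of d a "- b" "- c" u 1] by (simp add: Fin_pt)
  have "rinv (Fin w) = pt 1 w" for w by (simp add: pt_def divide_inverse)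
  then have "mob a b c d (rinv (Fin w)) = pt (b * w + a) (d * w + c)" for w
    using mob_pt[OF assms, of 1 w] by (simp add: add.commute)
  moreover have "coord (rinv (pt u v)) = v / u" for u v
    by (simp add: pt_def)
  moreover have "(c * u - a) / (b - d * u) = (a - c * u) / (d * u - b)" for u
    by (metis minus_diff_eq minus_divide_divide)
  ultimately show ?thesis using that[of b c a d] assms Infty m by (simp add: mult.commute)
qed

text \<open>
  Near a point of the cycle and in the charts of the sphere, the iterate of \<open>f\<close> is conjugate by a local
  biholomorphism to that of the model, and the chain rule cancels the two outer derivatives.
\<close>

theorem multiplier_of_conjugate:
  assumes conj: "conjugate f (quadratic p q s t)" and m: "quad_cycle p q s t n m"
  obtains x where "is_cycle f n (forward_orbit f x)" "multiplier f x = m"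
proof -
  let ?g = "quadratic p q s t" and ?h = "quad p q s t"
  obtain \<phi> where "moebius \<phi>" and cj: "\<phi> \<circ> f = ?g \<circ> \<phi>" using conj unfolding conjugate_def by blast
  then obtain a b c d where det: "a * d - b * c \<noteq> 0" and \<phi>: "\<phi> = mob a b c d" by (metis moebius_cases)
  let ?\<psi> = "mob d (- b) (- c) a"
  note inv = mob_inverse[OF det, folded \<phi>]
  obtain z where z: "1 \<le> n" "\<And>i. i < n \<Longrightarrow> q * (?h ^^ i) z + of_int t \<noteq> 0" "(?h ^^ n) z = z"
    "\<And>i. 0 < i \<Longrightarrow> i < n \<Longrightarrow> (?h ^^ i) z \<noteq> z" "m = (\<Prod>i<n. quad_deriv p q s t ((?h ^^ i) z))"
    using m unfolding quad_cycle_def by blast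
  define x where "x = ?\<psi> (Fin z)"
  have \<phi>x: "\<phi> x = Fin z" by (simp add: x_def inv)
  have it: "\<phi> ((f ^^ i) y) = (?g ^^ i) (\<phi> y)" for i y
    by (induction i) (simp_all add: fun_cong[OF cj, simplified])
  then have fit: "(f ^^ i) y = ?\<psi> ((?g ^^ i) (\<phi> y))" for i y using inv by metis
  have gz: "(?g ^^ i) (Fin z) = Fin ((?h ^^ i) z)" if "i \<le> n" for i
    using z(2) that by (intro quadratic_iter_Fin) auto
  have fx: "(f ^^ n) x = x" using fit[of n x] gz[of n] z(3) \<phi>x by (simp add: x_def)
  have nfx: "(f ^^ i) x \<noteq> x" if "1 \<le> i" "i < n" for i
  proof
    assume "(f ^^ i) x = x"
    then have "Fin ((?h ^^ i) z) = Fin z" using it[of i x] gz[of i] that \<phi>x by simp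
    then show False using z(4)[of i] that by simp
  qed
  have per: "period f x = n" unfolding period_def
    using fx nfx z(1) by (intro Least_equality) (auto intro: leI)
  have cyc: "is_cycle f n (forward_orbit f x)"
    unfolding is_cycle_def periodic_def using fx z(1) per by blast
  obtain a' b' c' d' where ch: "a' * d' - b' * c' \<noteq> 0"
    "\<And>w. \<phi> (chart_inv x w) = pt (a' * w + b') (c' * w + d')"
    "\<And>u. chart x (?\<psi> (Fin u)) = (d' * u - b') / (a' - c' * u)"
    using chart_mob[OF det, of x] \<phi> by metis
  define w0 where "w0 = chart x x"
  have "chart_inv x w0 = x" by (cases x) (simp_all add: w0_def)
  then have "pt (a' * w0 + b') (c' * w0 + d') = Fin z" using ch(2)[of w0] \<phi>x by simp
  then have w0: "c' * w0 + d' \<noteq> 0" "(a' * w0 + b') / (c' * w0 + d') = z"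
    by (auto simp: pt_def split: if_splits)
  define A where "A = (\<lambda>w. (a' * w + b') / (c' * w + d'))"
  define B where "B = (\<lambda>u. (d' * u - b') / (a' - c' * u))"
  define e where "e = c' * w0 + d'"
  define \<Delta> where "\<Delta> = a' * d' - b' * c'"
  have e: "e \<noteq> 0" "A w0 = z" "\<Delta> \<noteq> 0" using w0 ch(1) by (simp_all add: A_def e_def \<Delta>_def)
  have ze: "a' - c' * z = \<Delta> / e"
    using e unfolding w0(2)[symmetric] \<Delta>_def e_def by (simp add: field_simps)
  have dA: "(A has_field_derivative \<Delta> / e\<^sup>2) (at w0)"
    unfolding A_def using w0(1)
    by (auto intro!: derivative_eq_intros simp: \<Delta>_def e_def power2_eq_square field_simps)
  have "a' - c' * z \<noteq> 0" unfolding ze using e by simp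
  then have "(B has_field_derivative (d' * (a' - c' * z) - (d' * z - b') * (- c')) / (a' - c' * z)\<^sup>2) (at z)"
    unfolding B_def by (auto intro!: derivative_eq_intros simp: power2_eq_square)
  moreover have "d' * (a' - c' * z) - (d' * z - b') * (- c') = \<Delta>"
    by (simp add: \<Delta>_def algebra_simps)
  ultimately have "(B has_field_derivative \<Delta> / (a' - c' * z)\<^sup>2) (at z)" by simp
  then have dB: "(B has_field_derivative e\<^sup>2 / \<Delta>) (at z)"
    unfolding ze using e by (simp add: power2_eq_square)
  have dh: "(?h ^^ n has_field_derivative m) (at z)"
    unfolding z(5) using z(2) by (intro quad_iter_has_derivative)
  have "(B \<circ> ((?h ^^ n) \<circ> A) has_field_derivative e\<^sup>2 / \<Delta> * (m * (\<Delta> / e\<^sup>2))) (at w0)"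
    using dA dB dh e(2) z(3) by (intro DERIV_chain) auto
  then have der: "(B \<circ> ((?h ^^ n) \<circ> A) has_field_derivative m) (at w0)"
    using e by simp
  have "isCont A w0" using dA by (rule DERIV_isCont)
  then have A: "filterlim A (nhds z) (nhds w0)" using e(2) by (simp add: isCont_def tendsto_nhds_iff)
  have 1: "\<forall>\<^sub>F w in nhds w0. \<forall>i<n. q * (?h ^^ i) (A w) + of_int t \<noteq> 0"
    using quad_iter_eventually_defined[OF z(2)] A by (rule eventually_compose_filterlim)
  have "isCont (\<lambda>w. c' * w + d') w0" by (intro continuous_intros)
  then have "((\<lambda>w. c' * w + d') \<longlongrightarrow> c' * w0 + d') (nhds w0)" by (simp add: isCont_def tendsto_nhds_iff)
  then have 2: "\<forall>\<^sub>F w in nhds w0. c' * w + d' \<noteq> 0" using w0(1) by (rule tendsto_imp_eventually_ne)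
  have "\<forall>\<^sub>F w in nhds w0. chart x ((f ^^ n) (chart_inv x w)) = (B \<circ> ((?h ^^ n) \<circ> A)) w"
    using 1 2
  proof eventually_elim
    case (elim w)
    have "\<phi> (chart_inv x w) = Fin (A w)" using ch(2)[of w] elim(2) by (simp add: pt_def A_def)
    then have "(f ^^ n) (chart_inv x w) = ?\<psi> (Fin ((?h ^^ n) (A w)))"
      using fit[of n] elim(1) by (simp add: quadratic_iter_Fin)
    then show ?case by (simp add: ch(3) B_def)
  qed
  then have "fixpoint_deriv (f ^^ n) x = deriv (B \<circ> ((?h ^^ n) \<circ> A)) w0"
    unfolding fixpoint_deriv_chart w0_def[symmetric] by (intro deriv_cong_ev) auto
  also have "\<dots> = m" using der by (rule DERIV_imp_deriv)
  finally have "multiplier f x = m" by (simp add: multiplier_def per)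
  with cyc show ?thesis by (rule that)
qed

section \<open>Cycles of period three\<close>

text \<open>
  In the form \<open>z\<^sup>2 + c\<close> the points of period three are the roots of a sextic, and \<open>s\<close> is the sum of the
  points of one 3-cycle; the two cycles give the two roots of a quadratic equation over the field of \<open>c\<close>. The
  two assumptions say that no 3-cycle degenerates to a fixed point, that is, that no finite fixed point has
  a primitive cube root of unity as its multiplier.
\<close>

lemma polynomial_three_cycle:
  fixes p :: complex
  assumes "p\<^sup>2 + p + 1 \<noteq> 0" "(2 - p)\<^sup>2 + (2 - p) + 1 \<noteq> 0"
  defines "c \<equiv> p / 2 - p\<^sup>2 / 4"
  shows "\<exists>s. s\<^sup>2 + s + 2 + c = 0 \<and> quad_cycle p 0 0 1 3 (8 * (1 + c + c * s))"
proof -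
  let ?\<Phi> = "[:c^3 + 2*c^2 + c + 1, c^2 + 2*c + 1, 3*c^2 + 3*c + 1, 2*c + 1, 3*c + 1, 1, 1:]"
  have "degree ?\<Phi> > 0" by simp
  then obtain x where "poly ?\<Phi> x = 0" by (rule nonconstant_poly_root)
  then have \<Phi>: "x^6 + x^5 + (3*c + 1)*x^4 + (2*c + 1)*x^3 + (3*c^2 + 3*c + 1)*x^2 + (c^2 + 2*c + 1)*x + (c^3 + 2*c^2 + c + 1) = 0"
    (is "?F = 0")
    by (simp add: algebra_simps power_numeral_reduce)
  define x2 x3 where "x2 = x\<^sup>2 + c" and "x3 = x2\<^sup>2 + c"
  have cyc: "x3\<^sup>2 + c = x"
  proof -
    have "(x3\<^sup>2 + c) - x = (x2 - x) * ?F" unfolding x3_def x2_def by algebra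
    then show ?thesis using \<Phi> by simp
  qed
  define s where "s = x + x2 + x3"
  have s: "s\<^sup>2 + s + 2 + c = 0"
  proof -
    have "s\<^sup>2 + s + 2 + c = (x\<^sup>2 - x + c + 2) * ?F" unfolding s_def x3_def x2_def by algebra
    then show ?thesis using \<Phi> by simp
  qed
  have m: "8 * x * x2 * x3 = 8 * (1 + c + c * s)"
  proof -
    have "8 * x * x2 * x3 - 8 * (1 + c + c * s) = 8 * (x - 1) * ?F" unfolding s_def x3_def x2_def by algebra
    then show ?thesis using \<Phi> by simp
  qed
  have ne: "x2 \<noteq> x"
  proof
    assume "x2 = x"
    then have c: "c = x - x\<^sup>2" by (simp add: x2_def algebra_simps)
    have "4 * x\<^sup>2 + 2 * x + 1 = ?F" unfolding c by algebra
    then have f: "4 * x\<^sup>2 + 2 * x + 1 = 0" using \<Phi> by simp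
    have "(2 * x - p) * (2 * x - (2 - p)) = 0"
    proof -
      have "(2 * x - p) * (2 * x - (2 - p)) = 4 * (c - (x - x\<^sup>2)) + (2 * p - p\<^sup>2 - 4 * c)" by algebra
      then show ?thesis using c by (simp add: c_def field_simps power2_eq_square)
    qed
    then consider "2 * x = p" | "2 * x = 2 - p" by auto
    then show False
    proof cases
      case 1
      have "p\<^sup>2 + p + 1 = 4 * x\<^sup>2 + 2 * x + 1" unfolding 1[symmetric] by (simp add: power_mult_distrib)
      then show False using f assms(1) by simp
    next
      case 2
      have "(2 - p)\<^sup>2 + (2 - p) + 1 = 4 * x\<^sup>2 + 2 * x + 1" unfolding 2[symmetric] by (simp add: power_mult_distrib)
      then show False using f assms(2) by simp
    qed
  qed
  let ?g = "quad p 0 0 1"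
  have g: "?g (y - p / 2) = (y\<^sup>2 + c) - p / 2" for y
    by (simp add: quad_def c_def field_simps power2_eq_square)
  have d: "quad_deriv p 0 0 1 (y - p / 2) = 2 * y" for y
    by (simp add: quad_deriv_def)
  have g1: "?g (x - p / 2) = x2 - p / 2" and g2: "?g (x2 - p / 2) = x3 - p / 2" and g3: "?g (x3 - p / 2) = x - p / 2"
    using g[of x] g[of x2] g[of x3] cyc by (simp_all add: x2_def x3_def)
  have ne3: "x3 \<noteq> x"
  proof
    assume "x3 = x"
    then have "x2 = x" using g1 g3 by simp
    then show False using ne by simp
  qed
  have "quad_cycle p 0 0 1 3 (8 * x * x2 * x3)"
    unfolding quad_cycle_def
  proof (intro conjI exI[of _ "x - p / 2"])
    show "\<forall>i. 0 < i \<longrightarrow> i < 3 \<longrightarrow> (?g ^^ i) (x - p / 2) \<noteq> x - p / 2"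
    proof (intro allI impI)
      fix i :: nat assume "0 < i" "i < 3"
      then have "i = 1 \<or> i = 2" by auto
      then show "(?g ^^ i) (x - p / 2) \<noteq> x - p / 2" using ne ne3 by (auto simp: g1 g2 numeral_2_eq_2)
    qed
  qed (simp_all add: numeral_3_eq_3 g1 g2 g3 d lessThan_Suc)
  then show ?thesis using s m by auto
qed

text \<open>
  As for polynomials, a symmetric function \<open>x\<close> of one 3-cycle satisfies a quadratic equation over the
  field of \<open>m\<close>; the excluded values of \<open>m\<close> are those for which a 3-cycle merges with a fixed point.
\<close>

lemma parabolic_three_cycle:
  fixes m :: complex
  assumes "m \<noteq> 1" "m\<^sup>2 + m + 1 \<noteq> 0"
  defines "\<gamma> \<equiv> 1 - m"
  shows "\<exists>x. x\<^sup>2 - 2 * \<gamma> * x + 3 * \<gamma> = 0 \<and> quad_cycle m 1 0 1 3 (19 - 12 * \<gamma> + 2 * \<gamma> * x)"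
proof -
  have \<gamma>: "\<gamma> \<noteq> 0" using assms(1) by (simp add: \<gamma>_def)
  let ?\<Phi> = "[:\<gamma>^3, - 6*\<gamma>^3, 11*\<gamma>^3 + 6*\<gamma>^2, - 6*\<gamma>^3 - 20*\<gamma>^2, 15*\<gamma>^2 + 9*\<gamma>, - 12*\<gamma>, 3:]"
  have "degree ?\<Phi> > 0" by simp
  then obtain w where "poly ?\<Phi> w = 0" by (rule nonconstant_poly_root)
  then have \<Phi>: "3*w^6 - 12*\<gamma>*w^5 + (15*\<gamma>^2 + 9*\<gamma>)*w^4 - (6*\<gamma>^3 + 20*\<gamma>^2)*w^3 + (11*\<gamma>^3 + 6*\<gamma>^2)*w^2 - 6*\<gamma>^3*w + \<gamma>^3 = 0"
    (is "?F = 0")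
    by (simp add: algebra_simps power_numeral_reduce)
  define A where "A = w\<^sup>2 - \<gamma> * w + \<gamma>"
  define B where "B = A\<^sup>2 - \<gamma> * A * w + \<gamma> * w\<^sup>2"
  have cyc: "B\<^sup>2 - \<gamma> * B * (A * w) + \<gamma> * (A * w)\<^sup>2 = w * (B * (A * w))"
  proof -
    have "B\<^sup>2 - \<gamma> * B * (A * w) + \<gamma> * (A * w)\<^sup>2 - w * (B * (A * w)) = \<gamma> * (1 - w) * ?F"
      unfolding B_def A_def by algebra
    then show ?thesis using \<Phi> by simp
  qed
  have w0: "w \<noteq> 0" using \<Phi> \<gamma> by auto
  have A0: "A \<noteq> 0"
  proof
    assume A: "A = 0"
    then have "B = \<gamma> * w\<^sup>2" by (simp add: B_def)
    then show False using cyc A w0 \<gamma> by simp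
  qed
  have B0: "B \<noteq> 0"
  proof
    assume "B = 0"
    then show False using cyc A0 w0 \<gamma> by simp
  qed
  define w2 w3 where "w2 = A / w" and "w3 = B / (A * w)"
  let ?h = "\<lambda>w. w - \<gamma> + \<gamma> / w"
  have h1: "?h w = w2" using w0 by (simp add: w2_def A_def field_simps power2_eq_square)
  have h2: "?h w2 = w3" using w0 A0 by (simp add: w2_def w3_def B_def field_simps power2_eq_square)
  have h3: "?h w3 = w"
  proof -
    have "?h w3 = (B\<^sup>2 - \<gamma> * B * (A * w) + \<gamma> * (A * w)\<^sup>2) / (B * (A * w))"
      using w0 A0 B0 by (simp add: w3_def field_simps power2_eq_square)
    then show ?thesis unfolding cyc using w0 A0 B0 by simp
  qed
  have nz: "w2 \<noteq> 0" "w3 \<noteq> 0" using w0 A0 B0 by (simp_all add: w2_def w3_def)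
  define x where "x = \<gamma>\<^sup>2 * w / B"
  have x: "x\<^sup>2 - 2 * \<gamma> * x + 3 * \<gamma> = 0"
  proof -
    have "\<gamma>^4 * w\<^sup>2 - 2 * \<gamma>^3 * w * B + 3 * \<gamma> * B\<^sup>2 = (\<gamma> * w\<^sup>2 - 2 * \<gamma>\<^sup>2 * w + 3 * \<gamma>\<^sup>2) * ?F"
      unfolding B_def A_def by algebra
    then have "\<gamma>^4 * w\<^sup>2 - 2 * \<gamma>^3 * w * B + 3 * \<gamma> * B\<^sup>2 = 0" using \<Phi> by simp
    then have "(\<gamma>^4 * w\<^sup>2 - 2 * \<gamma>^3 * w * B + 3 * \<gamma> * B\<^sup>2) / B\<^sup>2 = 0" by simp
    moreover have "(\<gamma>^4 * w\<^sup>2 - 2 * \<gamma>^3 * w * B + 3 * \<gamma> * B\<^sup>2) / B\<^sup>2 = x\<^sup>2 - 2 * \<gamma> * x + 3 * \<gamma>"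
      using B0 by (simp add: x_def field_simps power2_eq_square power3_eq_cube power4_eq_xxxx)
    ultimately show ?thesis by simp
  qed
  have mult: "(1 - \<gamma> / w\<^sup>2) * (1 - \<gamma> / w2\<^sup>2) * (1 - \<gamma> / w3\<^sup>2) = 19 - 12 * \<gamma> + 2 * \<gamma> * x"
  proof -
    have "(w\<^sup>2 - \<gamma>) * (A\<^sup>2 - \<gamma> * w\<^sup>2) * (B\<^sup>2 - \<gamma> * A\<^sup>2 * w\<^sup>2)
        - w\<^sup>2 * A\<^sup>2 * B\<^sup>2 * (19 - 12 * \<gamma>) - 2 * \<gamma>^3 * w^3 * A\<^sup>2 * B =
      (4*w^8*\<gamma> - 6*w^8 - 16*w^7*\<gamma>^2 + 24*w^7*\<gamma> + 20*w^6*\<gamma>^3 - 10*w^6*\<gamma>^2 - 31*w^6*\<gamma> - 8*w^5*\<gamma>^4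
       - 34*w^5*\<gamma>^3 + 70*w^5*\<gamma>^2 + 26*w^4*\<gamma>^4 - 12*w^4*\<gamma>^3 - 44*w^4*\<gamma>^2 - 28*w^3*\<gamma>^4 + 44*w^3*\<gamma>^3
       + 9*w^2*\<gamma>^4 - 18*w^2*\<gamma>^3 + 2*w*\<gamma>^4 - \<gamma>^4) * ?F"
      unfolding B_def A_def by algebra
    then have "(w\<^sup>2 - \<gamma>) * (A\<^sup>2 - \<gamma> * w\<^sup>2) * (B\<^sup>2 - \<gamma> * A\<^sup>2 * w\<^sup>2)
        - (w\<^sup>2 * A\<^sup>2 * B\<^sup>2 * (19 - 12 * \<gamma>) + 2 * \<gamma>^3 * w^3 * A\<^sup>2 * B) = 0"
      by (simp only: \<Phi> mult_zero_right diff_diff_eq)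
    then have "(w\<^sup>2 - \<gamma>) * (A\<^sup>2 - \<gamma> * w\<^sup>2) * (B\<^sup>2 - \<gamma> * A\<^sup>2 * w\<^sup>2) =
        w\<^sup>2 * A\<^sup>2 * B\<^sup>2 * (19 - 12 * \<gamma>) + 2 * \<gamma>^3 * w^3 * A\<^sup>2 * B" by (simp only: right_minus_eq)
    then have "(w\<^sup>2 - \<gamma>) * (A\<^sup>2 - \<gamma> * w\<^sup>2) * (B\<^sup>2 - \<gamma> * A\<^sup>2 * w\<^sup>2) / (w\<^sup>2 * A\<^sup>2 * B\<^sup>2) =
        (w\<^sup>2 * A\<^sup>2 * B\<^sup>2 * (19 - 12 * \<gamma>) + 2 * \<gamma>^3 * w^3 * A\<^sup>2 * B) / (w\<^sup>2 * A\<^sup>2 * B\<^sup>2)" by simp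
    also have "\<dots> = 19 - 12 * \<gamma> + 2 * \<gamma> * x"
      using w0 A0 B0 by (simp add: x_def add_divide_distrib power2_eq_square power3_eq_cube)
    also have "(w\<^sup>2 - \<gamma>) * (A\<^sup>2 - \<gamma> * w\<^sup>2) * (B\<^sup>2 - \<gamma> * A\<^sup>2 * w\<^sup>2) / (w\<^sup>2 * A\<^sup>2 * B\<^sup>2) =
        ((w\<^sup>2 - \<gamma>) / w\<^sup>2) * ((A\<^sup>2 - \<gamma> * w\<^sup>2) / A\<^sup>2) * ((B\<^sup>2 - \<gamma> * A\<^sup>2 * w\<^sup>2) / B\<^sup>2)" by simp
    also have "(w\<^sup>2 - \<gamma>) / w\<^sup>2 = 1 - \<gamma> / w\<^sup>2" using w0 by (simp add: diff_divide_distrib)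
    also have "(A\<^sup>2 - \<gamma> * w\<^sup>2) / A\<^sup>2 = 1 - \<gamma> / w2\<^sup>2" using A0 by (simp add: w2_def diff_divide_distrib power_divide)
    also have "(B\<^sup>2 - \<gamma> * A\<^sup>2 * w\<^sup>2) / B\<^sup>2 = 1 - \<gamma> / w3\<^sup>2"
      using B0 by (simp add: w3_def diff_divide_distrib power_divide power_mult_distrib)
    finally show ?thesis .
  qed
  have ne: "w2 \<noteq> w"
  proof
    assume "w2 = w"
    then have "\<gamma> * (1 - w) = 0" using h1 w0 by (simp add: field_simps)
    then have "w = 1" using \<gamma> by simp
    then have "\<gamma> * (\<gamma>\<^sup>2 - 3 * \<gamma> + 3) = 0 \<or> \<gamma>\<^sup>2 - 3 * \<gamma> + 3 = 0"
      using \<Phi> by (simp add: algebra_simps power2_eq_square power3_eq_cube)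
    then have "\<gamma>\<^sup>2 - 3 * \<gamma> + 3 = 0" using \<gamma> by simp
    then show False using assms(2) by (simp add: \<gamma>_def power2_eq_square algebra_simps)
  qed
  have ne3: "w3 \<noteq> w" using h1 h3 ne by auto
  let ?g = "quad m 1 0 1"
  have g: "?g (y - 1) = ?h y - 1" if "y \<noteq> 0" for y
    using that by (simp add: quad_def \<gamma>_def field_simps)
  have d: "quad_deriv m 1 0 1 (y - 1) = 1 - \<gamma> / y\<^sup>2" if "y \<noteq> 0" for y
    unfolding quad_deriv_def g[OF that] using that by (simp add: \<gamma>_def field_simps power2_eq_square)
  have g1: "?g (w - 1) = w2 - 1" and g2: "?g (w2 - 1) = w3 - 1" and g3: "?g (w3 - 1) = w - 1"
    using g[OF w0] g[OF nz(1)] g[OF nz(2)] h1 h2 h3 by simp_all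
  have "quad_cycle m 1 0 1 3 ((1 - \<gamma> / w\<^sup>2) * (1 - \<gamma> / w2\<^sup>2) * (1 - \<gamma> / w3\<^sup>2))"
    unfolding quad_cycle_def
  proof (intro conjI exI[of _ "w - 1"])
    show "\<forall>i. 0 < i \<longrightarrow> i < 3 \<longrightarrow> (?g ^^ i) (w - 1) \<noteq> w - 1"
    proof (intro allI impI)
      fix i :: nat assume "0 < i" "i < 3"
      then have "i = 1 \<or> i = 2" by auto
      then show "(?g ^^ i) (w - 1) \<noteq> w - 1" using ne ne3 by (auto simp: g1 g2 numeral_2_eq_2)
    qed
    show "\<forall>i<3. 1 * (?g ^^ i) (w - 1) + of_int 1 \<noteq> 0"
    proof (intro allI impI)
      fix i :: nat assume "i < 3"
      then have "i = 0 \<or> i = 1 \<or> i = 2" by auto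
      then show "1 * (?g ^^ i) (w - 1) + of_int 1 \<noteq> 0" using w0 nz by (auto simp: g1 g2 numeral_2_eq_2)
    qed
  qed (use w0 nz in \<open>simp_all add: numeral_3_eq_3 g1 g2 g3 d lessThan_Suc\<close>)
  then show ?thesis using x mult by auto
qed

section \<open>A double pole summed over a lattice\<close>

text \<open>
  An even function has no linear term, so a zero at the centre of symmetry is at least double.
\<close>

lemma even_zero_divisible_by_square:
  assumes "K analytic_on {z0}" and "K z0 = 0" and "\<forall>\<^sub>F w in nhds 0. K (z0 + w) = K (z0 - w)"
  shows "\<exists>M. M analytic_on {z0} \<and> (\<forall>\<^sub>F z in nhds z0. K z = (z - z0)\<^sup>2 * M z)"
proof -
  obtain r where r: "r > 0" "K holomorphic_on ball z0 r"
    using assms(1) by (auto simp: analytic_at_ball)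
  have d0: "deriv K z0 = 0"
  proof -
    have dK: "(K has_field_derivative deriv K z0) (at z0)"
      using r by (meson centre_in_ball holomorphic_derivI open_ball)
    have 1: "((\<lambda>w. K (z0 + w)) has_field_derivative deriv K z0 * 1) (at 0)"
      by (rule DERIV_chain2[where g = "\<lambda>w. z0 + w"]) (use dK in \<open>auto intro!: derivative_eq_intros\<close>)
    have 2: "((\<lambda>w. K (z0 - w)) has_field_derivative deriv K z0 * (- 1)) (at 0)"
      by (rule DERIV_chain2[where g = "\<lambda>w. z0 - w"]) (use dK in \<open>auto intro!: derivative_eq_intros\<close>)
    have "deriv (\<lambda>w. K (z0 + w)) 0 = deriv (\<lambda>w. K (z0 - w)) 0"
      using assms(3) by (intro deriv_cong_ev) auto
    then have "deriv K z0 = - deriv K z0" using DERIV_imp_deriv[OF 1] DERIV_imp_deriv[OF 2] by simp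
    then show ?thesis by simp
  qed
  define g where "g = (\<lambda>z. if z = z0 then deriv K z0 else (K z - K z0) / (z - z0))"
  have g: "g holomorphic_on ball z0 r"
    unfolding g_def by (rule pole_lemma_open[OF r(2)]) simp
  define M where "M = (\<lambda>z. if z = z0 then deriv g z0 else (g z - g z0) / (z - z0))"
  have M: "M holomorphic_on ball z0 r"
    unfolding M_def by (rule pole_lemma_open[OF g]) simp
  have "K z = (z - z0)\<^sup>2 * M z" for z
    using assms(2) d0 by (cases "z = z0") (simp_all add: M_def g_def power2_eq_square)
  then show ?thesis using M r(1) by (intro exI[of _ M]) (auto simp: analytic_at_ball)
qed

text \<open>
  The sum over one period of the lattice in closed form: \<open>\<Sum> 1 / (z + n)\<^sup>2 = \<pi>\<^sup>2 / sin\<^sup>2 (\<pi> z)\<close>. In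
  this form the period, the double pole and the decay off the real axis are elementary.
\<close>

definition csc2 :: "complex \<Rightarrow> complex" where
  "csc2 z = (of_real pi / sin (of_real pi * z))\<^sup>2"

lemma sin_pi_zero_iff: "sin (of_real pi * z) = 0 \<longleftrightarrow> z \<in> \<int>" for z :: complex
proof -
  have "sin (of_real pi * z) = 0 \<longleftrightarrow> (\<exists>n::int. of_real pi * z = of_real (of_int n * pi))"
    by (rule sin_eq_0)
  also have "\<dots> \<longleftrightarrow> (\<exists>n::int. z = of_int n)"
    by (intro iff_exI) (auto simp: field_simps)
  finally show ?thesis by (auto simp: Ints_def)
qed

lemma csc2_plus_1: "csc2 (z + 1) = csc2 z"
  by (simp add: csc2_def distrib_left sin_add power2_eq_square)

lemma csc2_plus_int: "csc2 (z + of_int k) = csc2 z"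
proof -
  have "csc2 (z + of_nat j) = csc2 z" for z j
    by (induction j) (simp_all add: csc2_plus_1 add.assoc[symmetric] add.commute[of 1])
  from this[of z "nat k"] this[of "z + of_int k" "nat (- k)"] show ?thesis
    by (cases "k \<ge> 0") auto
qed

lemma csc2_minus: "csc2 (- z) = csc2 z"
  by (simp add: csc2_def)

lemma csc2_analytic: "z \<notin> \<int> \<Longrightarrow> csc2 analytic_on {z}"
  unfolding csc2_def[abs_def] by (auto intro!: analytic_intros simp: sin_pi_zero_iff)

lemma sin_ge_Im: "\<bar>Im z\<bar> \<le> cmod (sin z)"
proof -
  have "(Im z)\<^sup>2 \<le> (cmod (sin z))\<^sup>2"
  proof -
    have "\<bar>y\<bar> \<le> sinh \<bar>y\<bar>" for y :: real
    proof -
      have "(\<lambda>x. sinh x - x) 0 \<le> (\<lambda>x. sinh x - x) \<bar>y\<bar>"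
      proof (rule DERIV_nonneg_imp_nondecreasing[where f = "\<lambda>x. sinh x - x" and a = 0 and b = "\<bar>y\<bar>"])
        fix x :: real
        have "((\<lambda>x. sinh x - x) has_real_derivative cosh x - 1) (at x)"
          by (auto intro!: derivative_eq_intros)
        then show "\<exists>d. ((\<lambda>x. sinh x - x) has_real_derivative d) (at x) \<and> 0 \<le> d"
          using cosh_real_ge_1[of x] by (intro exI[of _ "cosh x - 1"]) simp
      qed simp
      then show ?thesis by simp
    qed
    then have "(Im z)\<^sup>2 \<le> (sinh (Im z))\<^sup>2"
      by (metis abs_le_square_iff abs_ge_zero abs_of_nonneg sinh_real_abs order_trans)
    also have "(sinh (Im z))\<^sup>2 = (exp (2 * Im z) + inverse (exp (2 * Im z)) - 2) / 4"
    proof -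
      define E where "E = exp (Im z)"
      have "E \<noteq> 0" "exp (2 * Im z) = E * E" by (simp_all add: E_def exp_double power2_eq_square)
      then show ?thesis
        by (simp add: sinh_def exp_minus E_def[symmetric] power2_eq_square field_simps)
    qed
    also have "\<dots> \<le> (cmod (sin z))\<^sup>2"
      unfolding norm_sin_squared using cos_le_one[of "2 * Re z"] by simp
    finally show ?thesis .
  qed
  then show ?thesis by (simp add: abs_le_square_iff[symmetric])
qed

text \<open>
  The quadratic bound is enough to sum over the second period; it replaces the exponential decay.
\<close>

lemma csc2_bound: "Im z \<noteq> 0 \<Longrightarrow> cmod (csc2 z) \<le> 1 / (Im z)\<^sup>2"
proof -
  assume "Im z \<noteq> 0"
  have "\<bar>pi * Im z\<bar> \<le> cmod (sin (of_real pi * z))" using sin_ge_Im[of "of_real pi * z"] by simp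
  then have "pi * \<bar>Im z\<bar> \<le> cmod (sin (of_real pi * z))" by (simp add: abs_mult)
  moreover have "pi * \<bar>Im z\<bar> > 0" using \<open>Im z \<noteq> 0\<close> by simp
  ultimately have "pi / cmod (sin (of_real pi * z)) \<le> pi / (pi * \<bar>Im z\<bar>)"
    by (intro divide_left_mono mult_pos_pos) auto
  then have "(pi / cmod (sin (of_real pi * z)))\<^sup>2 \<le> (1 / \<bar>Im z\<bar>)\<^sup>2"
    by (intro power_mono) auto
  then show ?thesis by (simp add: csc2_def norm_power norm_divide power_divide)
qed

lemma csc2_pole: "\<exists>H. H analytic_on {0} \<and> (\<forall>\<^sub>F z in at 0. csc2 z = 1 / z\<^sup>2 + H z)"
proof -
  define S where "S = (\<lambda>z::complex. sin (of_real pi * z) / of_real pi)"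
  have S: "S holomorphic_on UNIV" unfolding S_def by (intro holomorphic_intros) auto
  have dS: "deriv S 0 = 1"
    unfolding S_def by (rule DERIV_imp_deriv) (auto intro!: derivative_eq_intros)
  define s where "s = (\<lambda>z. if z = 0 then deriv S 0 else (S z - S 0) / (z - 0))"
  have s: "s holomorphic_on UNIV" unfolding s_def by (rule pole_lemma_open[OF S]) simp
  have s0: "s 0 = 1" by (simp add: s_def dS)
  have even: "s (- z) = s z" for z by (simp add: s_def S_def)
  define K where "K = (\<lambda>z. 1 / (s z)\<^sup>2 - 1)"
  have sa: "s analytic_on {0}" using s by (meson analytic_on_holomorphic open_UNIV subset_UNIV)
  have "K analytic_on {0}" unfolding K_def using s0 sa by (auto intro!: analytic_intros)
  moreover have "K 0 = 0" by (simp add: K_def s0)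
  ultimately obtain M where M: "M analytic_on {0}" "\<forall>\<^sub>F z in nhds 0. K z = (z - 0)\<^sup>2 * M z"
    using even_zero_divisible_by_square[of K 0] by (auto simp: K_def even)
  have "\<forall>\<^sub>F z in at 0. csc2 z = 1 / z\<^sup>2 + M z"
  proof -
    have "isCont s 0" using s holomorphic_on_imp_continuous_on continuous_on_eq_continuous_at[OF open_UNIV] by blast
    then have "(s \<longlongrightarrow> 1) (at 0)" using s0 by (simp add: isCont_def)
    then have "\<forall>\<^sub>F z in at 0. s z \<noteq> 0" by (rule tendsto_imp_eventually_ne) simp
    moreover have "\<forall>\<^sub>F z in at 0. K z = z\<^sup>2 * M z"
      using M(2) by (simp add: eventually_nhds_conv_at)
    moreover have "\<forall>\<^sub>F z in at 0. z \<noteq> (0::complex)" by (rule eventually_neq_at_within)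
    ultimately show ?thesis
    proof eventually_elim
      case (elim z)
      have "s z * z * of_real pi = sin (of_real pi * z)" using elim(3) by (simp add: s_def S_def)
      then have "csc2 z = (of_real pi / (s z * z * of_real pi))\<^sup>2" by (simp add: csc2_def)
      also have "\<dots> = (1 / (s z)\<^sup>2) / z\<^sup>2" by (simp add: field_simps power_mult_distrib)
      also have "1 / (s z)\<^sup>2 = 1 + z\<^sup>2 * M z" using elim(2) by (simp add: K_def algebra_simps)
      also have "(1 + z\<^sup>2 * M z) / z\<^sup>2 = 1 / z\<^sup>2 + M z" using elim(3) by (simp add: field_simps)
      finally show ?case .
    qed
  qed
  then show ?thesis using M(1) by blast
qed

definition lattice :: "complex \<Rightarrow> complex set" where
  "lattice \<tau> = {of_int m * 1 + of_int n * \<tau> | m n. True}"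

lemma lattice_iff: "z \<in> lattice \<tau> \<longleftrightarrow> (\<exists>m n. z = of_int m + of_int n * \<tau>)"
  by (auto simp: lattice_def)

lemma lattice_add: "x \<in> lattice \<tau> \<Longrightarrow> y \<in> lattice \<tau> \<Longrightarrow> x + y \<in> lattice \<tau>"
proof -
  assume "x \<in> lattice \<tau>" "y \<in> lattice \<tau>"
  then obtain m n m' n' where "x = of_int m + of_int n * \<tau>" "y = of_int m' + of_int n' * \<tau>"
    by (auto simp: lattice_iff)
  then have "x + y = of_int (m + m') + of_int (n + n') * \<tau>" by (simp add: algebra_simps)
  then show ?thesis unfolding lattice_iff by blast
qed

lemma lattice_minus: "x \<in> lattice \<tau> \<Longrightarrow> - x \<in> lattice \<tau>"
proof -
  assume "x \<in> lattice \<tau>"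
  then obtain m n where "x = of_int m + of_int n * \<tau>" by (auto simp: lattice_iff)
  then have "- x = of_int (- m) + of_int (- n) * \<tau>" by simp
  then show ?thesis unfolding lattice_iff by blast
qed

lemma lattice_diff: "x \<in> lattice \<tau> \<Longrightarrow> y \<in> lattice \<tau> \<Longrightarrow> x - y \<in> lattice \<tau>"
  using lattice_add[of x \<tau> "- y"] lattice_minus by simp

lemma lattice_int: "of_int m \<in> lattice \<tau>" and lattice_gen: "\<tau> \<in> lattice \<tau>"
  and lattice_0: "0 \<in> lattice \<tau>" and lattice_1: "1 \<in> lattice \<tau>"
  unfolding lattice_iff
  by (rule exI[of _ m], rule exI[of _ 0], simp, rule exI[of _ 0], rule exI[of _ 1], simp,
      rule exI[of _ 0], rule exI[of _ 0], simp, rule exI[of _ 1], rule exI[of _ 0], simp)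

lemma summable_inverse_square_int: "(\<lambda>n::int. c / (of_int n)\<^sup>2 :: real) summable_on UNIV"
proof -
  have "summable (\<lambda>n. norm (c / (of_nat n)\<^sup>2 :: real))"
    using summable_mult[OF inverse_power_summable[of 2, where 'a = real], of "\<bar>c\<bar>"]
    by (simp add: abs_mult divide_inverse power_inverse)
  then have nat: "(\<lambda>n::nat. c / (of_nat n)\<^sup>2 :: real) summable_on UNIV"
    by (metis norm_summable_imp_summable_on)
  have 1: "(\<lambda>n::int. c / (of_int n)\<^sup>2 :: real) summable_on range int"
    using nat by (subst summable_on_reindex) (auto simp: o_def)
  have 2: "(\<lambda>n::int. c / (of_int n)\<^sup>2 :: real) summable_on range (\<lambda>n. - int n)"
    using nat by (subst summable_on_reindex) (auto simp: o_def inj_def)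
  have "(UNIV :: int set) = range int \<union> range (\<lambda>n. - int n)"
    by (auto intro: int_cases2)
  then show ?thesis using 1 2 by (metis summable_on_union)
qed

context
  fixes \<tau> :: complex
  assumes \<tau>: "Im \<tau> \<noteq> 0"
begin

text \<open>
  The Weierstrass function up to an additive constant. Summing \<open>csc2\<close> over translates by \<open>\<tau>\<close> is
  absolutely convergent, so both periods are evident: 1 is a period of every term, and \<tau> shifts the index.
\<close>

definition wp :: "complex \<Rightarrow> complex" where
  "wp z = (\<Sum>\<^sub>\<infinity>n\<in>(UNIV::int set). csc2 (z + of_int n * \<tau>))"

text \<open>
  The finitely many terms that may have poles in the ball of radius \<open>R\<close>; all others are bounded by \<open>4 / (n Im \<tau>)\<^sup>2\<close> there.
\<close>

definition near :: "real \<Rightarrow> int set" where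
  "near R = {n. \<bar>of_int n * Im \<tau>\<bar> \<le> 2 * R}"

lemma finite_near: "finite (near R)"
proof (rule finite_subset)
  show "near R \<subseteq> {- \<lceil>2 * R / \<bar>Im \<tau>\<bar>\<rceil> .. \<lceil>2 * R / \<bar>Im \<tau>\<bar>\<rceil>}"
  proof
    fix n assume "n \<in> near R"
    then have "\<bar>real_of_int n\<bar> \<le> 2 * R / \<bar>Im \<tau>\<bar>" using \<tau> by (simp add: near_def abs_mult field_simps)
    then have "\<bar>real_of_int n\<bar> \<le> of_int \<lceil>2 * R / \<bar>Im \<tau>\<bar>\<rceil>" by linarith
    then have "\<bar>n\<bar> \<le> \<lceil>2 * R / \<bar>Im \<tau>\<bar>\<rceil>" by linarith
    then show "n \<in> {- \<lceil>2 * R / \<bar>Im \<tau>\<bar>\<rceil> .. \<lceil>2 * R / \<bar>Im \<tau>\<bar>\<rceil>}" by auto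
  qed
qed simp

lemma far_term:
  assumes "cmod z \<le> R" "n \<notin> near R"
  shows "Im (z + of_int n * \<tau>) \<noteq> 0" "cmod (csc2 (z + of_int n * \<tau>)) \<le> 4 / (Im \<tau>)\<^sup>2 / (of_int n)\<^sup>2"
proof -
  let ?y = "Im (z + of_int n * \<tau>)" and ?k = "of_int n * Im \<tau>"
  have R: "R \<ge> 0" using assms(1) norm_ge_zero order_trans by blast
  have "\<bar>Im z\<bar> \<le> R" using assms(1) abs_Im_le_cmod[of z] by linarith
  moreover have "\<not> \<bar>?k\<bar> \<le> 2 * R" using assms(2) by (simp add: near_def)
  moreover have "\<bar>k\<bar> / 2 \<le> \<bar>i + k\<bar>" if "\<bar>i\<bar> \<le> R" "\<not> \<bar>k\<bar> \<le> 2 * R" for i k :: real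
    using that by linarith
  ultimately have y: "\<bar>?k\<bar> / 2 \<le> \<bar>?y\<bar>" "0 < \<bar>?k\<bar>" using R by auto
  then show "?y \<noteq> 0" by auto
  then have "cmod (csc2 (z + of_int n * \<tau>)) \<le> 1 / ?y\<^sup>2" by (rule csc2_bound)
  also have "\<dots> \<le> 1 / (\<bar>?k\<bar> / 2)\<^sup>2"
  proof -
    have "(\<bar>?k\<bar> / 2)\<^sup>2 \<le> \<bar>?y\<bar>\<^sup>2" using y by (intro power_mono) auto
    then show ?thesis using y(2) \<open>?y \<noteq> 0\<close> by (intro divide_left_mono) auto
  qed
  also have "\<dots> = 4 / (Im \<tau>)\<^sup>2 / (of_int n)\<^sup>2" by (simp add: power_mult_distrib power_divide)
  finally show "cmod (csc2 (z + of_int n * \<tau>)) \<le> 4 / (Im \<tau>)\<^sup>2 / (of_int n)\<^sup>2" .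
qed

lemma wp_split:
  assumes "cmod z \<le> R"
  shows "wp z = (\<Sum>n\<in>near R. csc2 (z + of_int n * \<tau>)) + (\<Sum>\<^sub>\<infinity>n\<in>- near R. csc2 (z + of_int n * \<tau>))"
proof -
  have "(\<lambda>n::int. 4 / (Im \<tau>)\<^sup>2 / (of_int n)\<^sup>2) summable_on - near R"
    by (rule summable_on_subset_banach[OF summable_inverse_square_int]) simp
  then have "(\<lambda>n. norm (csc2 (z + of_int n * \<tau>))) summable_on - near R"
    using far_term(2)[OF assms] by (intro Infinite_Sum.abs_summable_on_comparison_test') auto
  then have "(\<lambda>n. csc2 (z + of_int n * \<tau>)) summable_on - near R" by (rule abs_summable_summable)
  then have "infsum (\<lambda>n. csc2 (z + of_int n * \<tau>)) (near R \<union> - near R) =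
      infsum (\<lambda>n. csc2 (z + of_int n * \<tau>)) (near R) + infsum (\<lambda>n. csc2 (z + of_int n * \<tau>)) (- near R)"
    by (intro infsum_Un_disjoint) (auto simp: finite_near)
  then show ?thesis by (simp add: wp_def finite_near)
qed

text \<open>
  The tail is a uniform limit of holomorphic functions by the Weierstrass test.
\<close>

lemma far_sum_holomorphic: "(\<lambda>z. \<Sum>\<^sub>\<infinity>n\<in>- near R. csc2 (z + of_int n * \<tau>)) holomorphic_on ball 0 R"
proof -
  let ?f = "\<lambda>X z. \<Sum>n\<in>X. csc2 (z + of_int n * \<tau>)"
  have lim: "uniform_limit (cball 0 R) ?f (\<lambda>z. \<Sum>\<^sub>\<infinity>n\<in>- near R. csc2 (z + of_int n * \<tau>)) (finite_subsets_at_top (- near R))"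
  proof (rule Weierstrass_m_test_general)
    show "(\<lambda>n::int. 4 / (Im \<tau>)\<^sup>2 / (of_int n)\<^sup>2) summable_on - near R"
      by (rule summable_on_subset_banach[OF summable_inverse_square_int]) simp
  qed (use far_term in auto)
  have an: "(\<lambda>z. csc2 (z + of_int n * \<tau>)) holomorphic_on cball 0 R" if "n \<in> - near R" for n
  proof -
    have "(csc2 \<circ> (\<lambda>z. z + of_int n * \<tau>)) analytic_on cball 0 R"
    proof (rule analytic_on_compose)
      show "csc2 analytic_on (\<lambda>z. z + of_int n * \<tau>) ` cball 0 R"
        unfolding analytic_on_analytic_at[of _ "(\<lambda>z. z + of_int n * \<tau>) ` cball 0 R"]
      proof
        fix w assume "w \<in> (\<lambda>z. z + of_int n * \<tau>) ` cball 0 R"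
        then have "Im w \<noteq> 0" using far_term(1)[of _ R n] that by auto
        then have "w \<notin> \<int>" by (auto elim!: Ints_cases)
        then show "csc2 analytic_on {w}" by (rule csc2_analytic)
      qed
    qed (intro analytic_intros)
    then show ?thesis by (simp add: o_def analytic_imp_holomorphic)
  qed
  have "\<forall>\<^sub>F X in finite_subsets_at_top (- near R). continuous_on (cball 0 R) (?f X) \<and> ?f X holomorphic_on ball 0 R"
  proof (rule eventually_finite_subsets_at_top_weakI)
    fix X assume "finite X" "X \<subseteq> - near R"
    then have "?f X holomorphic_on cball 0 R" by (intro holomorphic_on_sum an) auto
    then show "continuous_on (cball 0 R) (?f X) \<and> ?f X holomorphic_on ball 0 R"
      using holomorphic_on_imp_continuous_on holomorphic_on_subset ball_subset_cball by blast
  qed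
  from holomorphic_uniform_limit[OF this lim] show ?thesis by (simp add: finite_subsets_at_top_neq_bot)
qed

lemma csc2_shift_analytic: "z + w \<notin> \<int> \<Longrightarrow> (\<lambda>z. csc2 (z + w)) analytic_on {z}"
  using analytic_on_compose[OF analytic_on_add[OF analytic_on_ident analytic_on_const], of csc2 w "{z}"]
    csc2_analytic[of "z + w"] by (simp add: o_def)

lemma not_lattice_term: "z \<notin> lattice \<tau> \<Longrightarrow> z + of_int n * \<tau> \<notin> \<int>"
proof
  assume "z \<notin> lattice \<tau>" "z + of_int n * \<tau> \<in> \<int>"
  then obtain m where "z + of_int n * \<tau> = of_int m" by (auto elim: Ints_cases)
  then have "z = of_int m + of_int (- n) * \<tau>" by (simp add: algebra_simps)
  then show False using \<open>z \<notin> lattice \<tau>\<close> unfolding lattice_iff by blast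
qed

lemma wp_near_decomposition:
  obtains T where "T analytic_on {z0}"
    "\<forall>\<^sub>F z in nhds z0. wp z = (\<Sum>n\<in>near (cmod z0 + 1). csc2 (z + of_int n * \<tau>)) + T z"
proof -
  let ?R = "cmod z0 + 1"
  let ?T = "\<lambda>z. \<Sum>\<^sub>\<infinity>n\<in>- near ?R. csc2 (z + of_int n * \<tau>)"
  have z0: "z0 \<in> ball 0 ?R" by simp
  then have "?T analytic_on {z0}"
    using far_sum_holomorphic[of ?R] by (auto simp: analytic_at intro!: exI[of _ "ball 0 ?R"])
  moreover have "\<forall>\<^sub>F z in nhds z0. z \<in> ball 0 ?R"
    using z0 by (intro eventually_nhds_in_open) auto
  then have "\<forall>\<^sub>F z in nhds z0. wp z = (\<Sum>n\<in>near ?R. csc2 (z + of_int n * \<tau>)) + ?T z"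
    by eventually_elim (intro wp_split, simp)
  ultimately show ?thesis by (rule that)
qed

lemma wp_analytic:
  assumes "z0 \<notin> lattice \<tau>"
  shows "wp analytic_on {z0}"
proof -
  obtain T where T: "T analytic_on {z0}"
    "\<forall>\<^sub>F z in nhds z0. wp z = (\<Sum>n\<in>near (cmod z0 + 1). csc2 (z + of_int n * \<tau>)) + T z"
    by (rule wp_near_decomposition)
  have "(\<lambda>z. (\<Sum>n\<in>near (cmod z0 + 1). csc2 (z + of_int n * \<tau>)) + T z) analytic_on {z0}"
    using T(1) by (intro analytic_intros csc2_shift_analytic not_lattice_term assms)
  then show ?thesis using T(2) by (subst analytic_at_cong) auto
qed

text \<open>
  Only the term with index \<open>- k\<close> is singular at \<open>m + k \<tau>\<close>, and it has the principal part of \<open>csc2\<close> at an integer.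
\<close>

lemma wp_pole:
  assumes "z0 \<in> lattice \<tau>"
  shows "\<exists>H. H analytic_on {z0} \<and> (\<forall>\<^sub>F z in at z0. wp z = 1 / (z - z0)\<^sup>2 + H z)"
proof -
  obtain m k where z0: "z0 = of_int m + of_int k * \<tau>" using assms by (auto simp: lattice_iff)
  obtain T where T: "T analytic_on {z0}"
    "\<forall>\<^sub>F z in nhds z0. wp z = (\<Sum>n\<in>near (cmod z0 + 1). csc2 (z + of_int n * \<tau>)) + T z"
    by (rule wp_near_decomposition)
  obtain H where H: "H analytic_on {0}" "\<forall>\<^sub>F z in at 0. csc2 z = 1 / z\<^sup>2 + H z"
    using csc2_pole by blast
  have "\<bar>Im z0\<bar> \<le> cmod z0" by (rule abs_Im_le_cmod)
  then have k: "- k \<in> near (cmod z0 + 1)" using z0 norm_ge_zero[of z0] by (simp add: near_def)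
  define N where "N = near (cmod z0 + 1) - {- k}"
  define F where "F = (\<lambda>z. H (z - z0) + (\<Sum>n\<in>N. csc2 (z + of_int n * \<tau>)) + T z)"
  have "z0 + of_int n * \<tau> \<notin> \<int>" if "n \<in> N" for n
  proof
    assume "z0 + of_int n * \<tau> \<in> \<int>"
    then obtain j where "z0 + of_int n * \<tau> = of_int j" by (rule Ints_cases)
    then have "Im (z0 + of_int n * \<tau>) = 0" by (simp only: complex_Im_of_int)
    then have "of_int (k + n) * Im \<tau> = 0" using z0 by (simp add: algebra_simps)
    then have "k + n = 0" using \<tau> by (metis mult_eq_0_iff of_int_eq_0_iff)
    then show False using that by (simp add: N_def add_eq_0_iff2)
  qed
  moreover have "(\<lambda>z. H (z - z0)) analytic_on {z0}"
    using analytic_on_compose[OF analytic_on_diff[OF analytic_on_ident analytic_on_const], of H z0 "{z0}"] H(1)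
    by (simp add: o_def)
  ultimately have F: "F analytic_on {z0}" unfolding F_def using T(1)
    by (intro analytic_intros csc2_shift_analytic) auto
  have "filterlim (\<lambda>z. z - z0) (at 0) (at z0)"
    by (intro filterlim_atI tendsto_eq_intros) (auto simp: eventually_at_filter)
  from eventually_compose_filterlim[OF H(2) this]
  have "\<forall>\<^sub>F z in at z0. csc2 (z - z0) = 1 / (z - z0)\<^sup>2 + H (z - z0)" .
  moreover have "\<forall>\<^sub>F z in at z0. wp z = (\<Sum>n\<in>near (cmod z0 + 1). csc2 (z + of_int n * \<tau>)) + T z"
    using T(2) by (simp add: eventually_nhds_conv_at)
  ultimately have "\<forall>\<^sub>F z in at z0. wp z = 1 / (z - z0)\<^sup>2 + F z"
  proof eventually_elim
    case (elim z)
    have "csc2 (z + of_int (- k) * \<tau>) = csc2 (z - z0 + of_int m)" by (simp add: z0)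
    then have "csc2 (z + of_int (- k) * \<tau>) = csc2 (z - z0)" by (simp only: csc2_plus_int)
    moreover have "(\<Sum>n\<in>near (cmod z0 + 1). csc2 (z + of_int n * \<tau>)) =
        csc2 (z + of_int (- k) * \<tau>) + (\<Sum>n\<in>N. csc2 (z + of_int n * \<tau>))"
      unfolding N_def using k finite_near by (rule sum.remove[rotated])
    ultimately show ?case using elim by (simp add: F_def)
  qed
  then show ?thesis using F by blast
qed

lemma wp_minus: "wp (- z) = wp z"
proof -
  have "wp (- z) = (\<Sum>\<^sub>\<infinity>n\<in>(UNIV::int set). csc2 (- z + of_int (- n) * \<tau>))"
    unfolding wp_def by (rule infsum_reindex_bij_betw[symmetric]) (rule bij_uminus)
  also have "\<dots> = wp z" unfolding wp_def
    using csc2_minus[of "z + of_int _ * \<tau>"] by (intro infsum_cong) (metis (no_types, lifting) minus_add_distrib mult_minus_left of_int_minus)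
  finally show ?thesis .
qed

lemma wp_periodic:
  assumes "w \<in> lattice \<tau>"
  shows "wp (z + w) = wp z"
proof -
  obtain m k where w: "w = of_int m + of_int k * \<tau>" using assms by (auto simp: lattice_iff)
  have "wp (z + w) = (\<Sum>\<^sub>\<infinity>n\<in>(UNIV::int set). csc2 (z + of_int (n + k) * \<tau>))"
    unfolding wp_def
  proof (rule infsum_cong)
    fix n :: int
    have "z + w + of_int n * \<tau> = (z + of_int (n + k) * \<tau>) + of_int m" by (simp add: w algebra_simps)
    then show "csc2 (z + w + of_int n * \<tau>) = csc2 (z + of_int (n + k) * \<tau>)" by (simp only: csc2_plus_int)
  qed
  also have "\<dots> = wp z"
    unfolding wp_def by (rule infsum_reindex_bij_betw) (rule bij_betwI[of _ _ _ "\<lambda>n. n - k"], auto)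
  finally show ?thesis .
qed

end

section \<open>Elliptic functions\<close>

definition removable :: "(complex \<Rightarrow> complex) \<Rightarrow> complex \<Rightarrow> bool" where
  "removable h z0 \<longleftrightarrow> (\<exists>g. g analytic_on {z0} \<and> (\<forall>\<^sub>F z in at z0. h z = g z))"

lemma removable_analytic: "h analytic_on {z0} \<Longrightarrow> removable h z0"
  unfolding removable_def by (intro exI[of _ h]) simp

lemma removable_value:
  assumes "h analytic_on {z0}" "\<forall>\<^sub>F z in at z0. h z = c"
  shows "h z0 = c"
proof -
  have "isCont h z0" using assms(1) by (rule analytic_at_imp_isCont)
  then have "(h \<longlongrightarrow> h z0) (at z0)" by (simp add: isCont_def)
  moreover have "(h \<longlongrightarrow> c) (at z0)" using assms(2) by (rule tendsto_eventually)
  ultimately show ?thesis by (rule tendsto_unique[rotated]) simp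
qed

lemma analytic_shift: "h analytic_on {z0 + w} \<Longrightarrow> (\<lambda>z. h (z + w)) analytic_on {z0}"
  using analytic_on_compose[OF analytic_on_add[OF analytic_on_ident analytic_on_const], of h w "{z0}"]
  by (simp add: o_def)

lemma analytic_scale: "h analytic_on {a * z0} \<Longrightarrow> (\<lambda>z. h (a * z)) analytic_on {z0}"
  using analytic_on_compose[OF analytic_on_mult[OF analytic_on_const analytic_on_ident], of h a "{z0}"]
  by (simp add: o_def)

lemma filterlim_shift_at: "filterlim (\<lambda>z. z + w) (at (z0 + w)) (at z0)" for z0 :: complex
  by (intro filterlim_atI tendsto_eq_intros) (auto simp: eventually_at_filter)

lemma filterlim_scale_at: "a \<noteq> 0 \<Longrightarrow> filterlim (\<lambda>z. a * z) (at (a * z0)) (at z0)" for z0 :: complex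
  by (intro filterlim_atI tendsto_eq_intros) (auto simp: eventually_at_filter)

lemma removable_shift:
  assumes "removable h (z0 + w)"
  shows "removable (\<lambda>z. h (z + w)) z0"
proof -
  obtain g where g: "g analytic_on {z0 + w}" "\<forall>\<^sub>F z in at (z0 + w). h z = g z"
    using assms unfolding removable_def by blast
  have "\<forall>\<^sub>F z in at z0. h (z + w) = g (z + w)"
    using eventually_compose_filterlim[OF g(2) filterlim_shift_at] .
  then show ?thesis unfolding removable_def using analytic_shift[OF g(1)] by blast
qed

context
  fixes \<tau> :: complex
  assumes \<tau>: "Im \<tau> \<noteq> 0"
begin

lemma lattice_coordinates:
  assumes "of_int m + of_int n * \<tau> = of_int m' + of_int n' * \<tau>"
  shows "m = m'" "n = n'"
proof -
  have "Im (of_int m + of_int n * \<tau>) = Im (of_int m' + of_int n' * \<tau>)" using assms by simp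
  then show "n = n'" using \<tau> by simp
  then show "m = m'" using assms by simp
qed

lemma half_not_lattice:
  assumes "odd m \<or> odd n"
  shows "(of_int m + of_int n * \<tau>) / 2 \<notin> lattice \<tau>"
proof
  assume "(of_int m + of_int n * \<tau>) / 2 \<in> lattice \<tau>"
  then obtain m' n' where "(of_int m + of_int n * \<tau>) / 2 = of_int m' + of_int n' * \<tau>"
    by (auto simp: lattice_iff)
  then have "of_int m + of_int n * \<tau> = of_int (2 * m') + of_int (2 * n') * \<tau>"
    by (simp add: field_simps)
  then have "m = 2 * m'" "n = 2 * n'" by (rule lattice_coordinates)+
  then show False using assms by auto
qed

lemma fundamental_domain:
  obtains s t w where "s \<in> {0..1}" "t \<in> {0..1}" "w \<in> lattice \<tau>" "z = of_real s + of_real t * \<tau> + w"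
proof -
  define y where "y = Im z / Im \<tau>"
  define x where "x = Re z - y * Re \<tau>"
  have z: "z = of_real x + of_real y * \<tau>" using \<tau> by (simp add: complex_eq_iff x_def y_def)
  have "z = of_real (frac x) + of_real (frac y) * \<tau> + (of_int \<lfloor>x\<rfloor> + of_int \<lfloor>y\<rfloor> * \<tau>)"
    unfolding z frac_def by (simp add: algebra_simps)
  moreover have "of_int \<lfloor>x\<rfloor> + of_int \<lfloor>y\<rfloor> * \<tau> \<in> lattice \<tau>" unfolding lattice_iff by blast
  ultimately show ?thesis
    using that[of "frac x" "frac y"] frac_lt_1[of x] frac_lt_1[of y] by (simp add: less_imp_le)
qed

text \<open>
  The function takes all its values on a compact parallelogram, so its holomorphic extension
  is a bounded entire function, and Liouville's theorem applies.
\<close>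

lemma elliptic_constant:
  assumes per: "\<And>z w. w \<in> lattice \<tau> \<Longrightarrow> h (z + w) = h z" and rem: "\<And>z0. removable h z0"
  shows "\<exists>c. \<forall>z0. \<forall>\<^sub>F z in at z0. h z = c"
proof -
  define H where "H = (\<lambda>z0. Lim (at z0) h)"
  have loc: "\<exists>g r. r > 0 \<and> g holomorphic_on ball z0 r \<and> (\<forall>z\<in>ball z0 r. H z = g z) \<and>
      (\<forall>z\<in>ball z0 r - {z0}. h z = g z)" for z0
  proof -
    obtain g where g: "g analytic_on {z0}" "\<forall>\<^sub>F z in at z0. h z = g z"
      using rem[of z0] unfolding removable_def by blast
    obtain r1 where r1: "r1 > 0" "g holomorphic_on ball z0 r1" using g(1) by (auto simp: analytic_at_ball)
    obtain r2 where r2: "r2 > 0" "\<And>z. z \<noteq> z0 \<Longrightarrow> dist z z0 < r2 \<Longrightarrow> h z = g z"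
      using g(2) by (auto simp: eventually_at)
    define r where "r = min r1 r2"
    have hg: "h z = g z" if "z \<in> ball z0 r - {z0}" for z
      using r2(2)[of z] that by (auto simp: r_def dist_commute)
    have gh: "g holomorphic_on ball z0 r" using r1(2) by (rule holomorphic_on_subset) (auto simp: r_def)
    have "H z = g z" if z: "z \<in> ball z0 r" for z
    proof -
      have "isCont g z" using gh z
        by (meson continuous_on_eq_continuous_at holomorphic_on_imp_continuous_on open_ball)
      then have "(g \<longlongrightarrow> g z) (at z)" by (simp add: isCont_def)
      moreover have "\<forall>\<^sub>F w in at z. w \<in> ball z0 r - {z0}"
      proof (cases "z = z0")
        case True
        then show ?thesis using z by (auto simp: eventually_at dist_commute intro!: exI[of _ r] r1 r2)
      next
        case False
        then show ?thesis using z by (intro eventually_at_in_open') auto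
      qed
      then have "\<forall>\<^sub>F w in at z. g w = h w" by eventually_elim (use hg in auto)
      ultimately have "(h \<longlongrightarrow> g z) (at z)" by (rule Lim_transform_eventually)
      then show ?thesis unfolding H_def by (intro tendsto_Lim) auto
    qed
    then show ?thesis using gh hg r1 r2 by (intro exI[of _ g] exI[of _ r]) (auto simp: r_def)
  qed
  have hol: "H holomorphic_on UNIV"
  proof -
    have "H analytic_on {z0}" for z0
      using loc[of z0] holomorphic_cong[of "ball z0 _" "ball z0 _" H] unfolding analytic_at_ball by metis
    then show ?thesis by (metis UNIV_I analytic_imp_holomorphic analytic_on_analytic_at)
  qed
  have lim: "(h \<longlongrightarrow> H z0) (at z0)" for z0
  proof -
    obtain g r where g: "r > 0" "g holomorphic_on ball z0 r" "\<forall>z\<in>ball z0 r. H z = g z"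
      "\<forall>z\<in>ball z0 r - {z0}. h z = g z" using loc[of z0] by blast
    have "isCont H z0" using hol by (metis UNIV_I continuous_on_eq_continuous_at holomorphic_on_imp_continuous_on open_UNIV)
    then have "(H \<longlongrightarrow> H z0) (at z0)" by (simp add: isCont_def)
    moreover have "\<forall>\<^sub>F z in at z0. H z = h z"
      using g by (auto simp: eventually_at dist_commute intro!: exI[of _ r])
    ultimately show ?thesis by (rule Lim_transform_eventually)
  qed
  have Hper: "H (z + w) = H z" if w: "w \<in> lattice \<tau>" for z w
  proof -
    have "((\<lambda>x. h (x + w)) \<longlongrightarrow> H (z + w)) (at z)"
      using filterlim_compose[OF lim[of "z + w"] filterlim_shift_at] .
    then have "(h \<longlongrightarrow> H (z + w)) (at z)" using per[OF w] by simp
    then show ?thesis using lim[of z] by (intro tendsto_unique[of "at z"]) auto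
  qed
  define K where "K = (\<lambda>(s, t). of_real s + of_real t * \<tau>) ` ({0..1::real} \<times> {0..1::real})"
  have "compact K" unfolding K_def case_prod_unfold
    by (intro compact_continuous_image compact_Times continuous_intros) auto
  then have "bounded (H ` K)"
    using hol holomorphic_on_imp_continuous_on continuous_on_subset
    by (intro compact_imp_bounded compact_continuous_image) blast+
  moreover have "range H \<subseteq> H ` K"
  proof
    fix y assume "y \<in> range H"
    then obtain z where "y = H z" by blast
    moreover obtain s t w where "s \<in> {0..1}" "t \<in> {0..1}" "w \<in> lattice \<tau>" "z = of_real s + of_real t * \<tau> + w"
      by (rule fundamental_domain)
    ultimately show "y \<in> H ` K" by (auto simp: Hper K_def intro!: imageI)
  qed
  ultimately have "bounded (range H)" by (rule bounded_subset)
  then obtain c where c: "\<And>z. H z = c"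
    using Liouville_theorem[OF hol] unfolding constant_on_def by auto
  have "\<forall>\<^sub>F z in at z0. h z = c" for z0
  proof -
    obtain g r where g: "r > 0" "\<forall>z\<in>ball z0 r. H z = g z" "\<forall>z\<in>ball z0 r - {z0}. h z = g z"
      using loc[of z0] by blast
    then have "h z = c" if "z \<noteq> z0" "dist z z0 < r" for z
      using c[of z] that by (simp add: dist_commute)
    then show ?thesis using g(1) by (auto simp: eventually_at)
  qed
  then show ?thesis by blast
qed

lemmas G_analytic = wp_analytic[OF \<tau>] and G_pole = wp_pole[OF \<tau>]
  and G_minus = wp_minus[OF \<tau>] and G_periodic = wp_periodic[OF \<tau>]

lemma G_pole_limit:
  assumes "z0 \<in> lattice \<tau>"
  shows "((\<lambda>z. (z - z0)\<^sup>2 * (wp \<tau> z - e)) \<longlongrightarrow> 1) (at z0)"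
proof -
  obtain H where H: "H analytic_on {z0}" "\<forall>\<^sub>F z in at z0. wp \<tau> z = 1 / (z - z0)\<^sup>2 + H z"
    using G_pole[OF assms] by blast
  have "isCont H z0" using H(1) by (rule analytic_at_imp_isCont)
  then have "(H \<longlongrightarrow> H z0) (at z0)" by (simp add: isCont_def)
  then have "((\<lambda>z. 1 + (z - z0)\<^sup>2 * (H z - e)) \<longlongrightarrow> 1 + (z0 - z0)\<^sup>2 * (H z0 - e)) (at z0)"
    by (intro tendsto_intros)
  then have "((\<lambda>z. 1 + (z - z0)\<^sup>2 * (H z - e)) \<longlongrightarrow> 1) (at z0)" by simp
  moreover have "\<forall>\<^sub>F z in at z0. 1 + (z - z0)\<^sup>2 * (H z - e) = (z - z0)\<^sup>2 * (wp \<tau> z - e)"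
    using H(2) eventually_neq_at_within[of z0 z0]
    by eventually_elim (simp add: field_simps)
  ultimately show ?thesis by (rule Lim_transform_eventually)
qed

lemma G_pole_neq:
  assumes "z0 \<in> lattice \<tau>" shows "\<forall>\<^sub>F z in at z0. wp \<tau> z \<noteq> e"
proof -
  have "\<forall>\<^sub>F z in at z0. (z - z0)\<^sup>2 * (wp \<tau> z - e) \<noteq> 0"
    using G_pole_limit[OF assms] by (rule tendsto_imp_eventually_ne) simp
  then show ?thesis by eventually_elim auto
qed

lemma G_not_analytic:
  assumes "z0 \<in> lattice \<tau>" shows "\<not> wp \<tau> analytic_on {z0}"
proof
  assume "wp \<tau> analytic_on {z0}"
  then have "isCont (wp \<tau>) z0" by (rule analytic_at_imp_isCont)
  then have "((wp \<tau>) \<longlongrightarrow> wp \<tau> z0) (at z0)" by (simp add: isCont_def)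
  then have "((\<lambda>z. (z - z0)\<^sup>2 * (wp \<tau> z - 0)) \<longlongrightarrow> (z0 - z0)\<^sup>2 * (wp \<tau> z0 - 0)) (at z0)"
    by (intro tendsto_intros)
  then show False using tendsto_unique[OF _ G_pole_limit[OF assms, of 0]] by fastforce
qed

lemma G_analytic_iff: "wp \<tau> analytic_on {z} \<longleftrightarrow> z \<notin> lattice \<tau>"
  using G_analytic G_not_analytic by blast

lemma open_not_lattice: "open (- lattice \<tau>)"
  unfolding open_contains_ball
proof
  fix z assume "z \<in> - lattice \<tau>"
  then obtain r where r: "r > 0" "wp \<tau> holomorphic_on ball z r"
    using G_analytic_iff by (auto simp: analytic_at_ball)
  then have "wp \<tau> analytic_on {w}" if "w \<in> ball z r" for w
    using that by (auto simp: analytic_at)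
  then have "ball z r \<subseteq> - lattice \<tau>" using G_analytic_iff by auto
  then show "\<exists>e>0. ball z e \<subseteq> - lattice \<tau>" using r by blast
qed

lemma G_pole_ball:
  assumes "z0 \<in> lattice \<tau>"
  obtains H r where "r > 0" "H holomorphic_on ball z0 r"
    "\<And>z. z \<in> ball z0 r \<Longrightarrow> z \<noteq> z0 \<Longrightarrow> wp \<tau> z = 1 / (z - z0)\<^sup>2 + H z \<and> z \<notin> lattice \<tau>"
proof -
  obtain H where H: "H analytic_on {z0}" "\<forall>\<^sub>F z in at z0. wp \<tau> z = 1 / (z - z0)\<^sup>2 + H z"
    using G_pole[OF assms] by blast
  obtain r1 where r1: "r1 > 0" "H holomorphic_on ball z0 r1" using H(1) by (auto simp: analytic_at_ball)
  obtain r2 where r2: "r2 > 0" "\<And>z. z \<noteq> z0 \<Longrightarrow> dist z z0 < r2 \<Longrightarrow> wp \<tau> z = 1 / (z - z0)\<^sup>2 + H z"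
    using H(2) by (auto simp: eventually_at)
  define r where "r = min r1 r2"
  have hol: "H holomorphic_on ball z0 r" using r1(2) by (rule holomorphic_on_subset) (auto simp: r_def)
  have eq: "wp \<tau> z = 1 / (z - z0)\<^sup>2 + H z" if "z \<in> ball z0 r" "z \<noteq> z0" for z
    using r2(2)[of z] that by (auto simp: r_def dist_commute)
  have "wp \<tau> holomorphic_on ball z0 r - {z0}"
  proof -
    have "(\<lambda>z. 1 / (z - z0)\<^sup>2 + H z) holomorphic_on ball z0 r - {z0}"
      using hol by (intro holomorphic_intros) (auto intro: holomorphic_on_subset)
    then show ?thesis using eq by (subst holomorphic_cong[OF refl]) auto
  qed
  then have "wp \<tau> analytic_on ball z0 r - {z0}" by (simp add: analytic_on_open open_delete)
  then have "z \<notin> lattice \<tau>" if "z \<in> ball z0 r" "z \<noteq> z0" for z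
    using G_analytic_iff[of z] analytic_on_analytic_at[of "wp \<tau>" "ball z0 r - {z0}"] that by blast
  then show ?thesis using that[of r H] r1 r2 hol eq by (simp add: r_def)
qed

text \<open>
  The first factor has double poles where the second has double zeros and conversely, so the
  product is elliptic without poles and hence constant. The zero is double because \<open>\<wp>\<close> is even about a half
  period.
\<close>

lemma half_period_product:
  assumes h: "2 * \<omega> \<in> lattice \<tau>" "\<omega> \<notin> lattice \<tau>"
  shows "\<exists>c. c \<noteq> 0 \<and> (\<forall>z. z \<notin> lattice \<tau> \<longrightarrow> z + \<omega> \<notin> lattice \<tau> \<longrightarrow>
    (wp \<tau> (z + \<omega>) - wp \<tau> \<omega>) * (wp \<tau> z - wp \<tau> \<omega>) = c)"
proof -
  define Q where "Q = (\<lambda>z. (wp \<tau> (z + \<omega>) - wp \<tau> \<omega>) * (wp \<tau> z - wp \<tau> \<omega>))"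
  have per: "Q (z + w) = Q z" if "w \<in> lattice \<tau>" for z w
  proof -
    have "z + w + \<omega> = z + \<omega> + w" by simp
    then show ?thesis unfolding Q_def using G_periodic[OF that] by (simp only:)
  qed
  have Qs: "Q (z + \<omega>) = Q z" for z
  proof -
    have "z + \<omega> + \<omega> = z + 2 * \<omega>" by simp
    then have "wp \<tau> (z + \<omega> + \<omega>) = wp \<tau> z" using G_periodic[OF h(1), of z] by (simp only:)
    then show ?thesis unfolding Q_def by (simp only: mult.commute)
  qed
  have notin: "z + \<omega> \<notin> lattice \<tau>" if "z \<in> lattice \<tau>" for z
    using lattice_diff[of "z + \<omega>" \<tau> z] that h(2) by auto
  have an: "Q analytic_on {z0}" if "z0 \<notin> lattice \<tau>" "z0 + \<omega> \<notin> lattice \<tau>" for z0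
    unfolding Q_def using that by (intro analytic_intros analytic_shift G_analytic)
  have rem0: "removable Q z0" if z0: "z0 \<in> lattice \<tau>" for z0
  proof -
    obtain H where H: "H analytic_on {z0}" "\<forall>\<^sub>F z in at z0. wp \<tau> z = 1 / (z - z0)\<^sup>2 + H z"
      using G_pole[OF z0] by blast
    define K where "K = (\<lambda>z. wp \<tau> (z + \<omega>) - wp \<tau> \<omega>)"
    have K: "K analytic_on {z0}" unfolding K_def
      using notin[OF z0] by (intro analytic_intros analytic_shift G_analytic)
    have K0: "K z0 = 0" using G_periodic[OF z0, of \<omega>] by (simp add: K_def add.commute)
    have "K (z0 + w) = K (z0 - w)" for w
    proof -
      have "wp \<tau> (z0 - w + \<omega>) = wp \<tau> (- (z0 - w + \<omega>))" by (rule G_minus[symmetric])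
      also have "\<dots> = wp \<tau> (- (z0 - w + \<omega>) + (z0 + z0 + 2 * \<omega>))"
        by (rule G_periodic[OF lattice_add[OF lattice_add[OF z0 z0] h(1)], symmetric])
      also have "- (z0 - w + \<omega>) + (z0 + z0 + 2 * \<omega>) = z0 + w + \<omega>" by simp
      finally show ?thesis by (simp add: K_def algebra_simps)
    qed
    then obtain M where M: "M analytic_on {z0}" "\<forall>\<^sub>F z in nhds z0. K z = (z - z0)\<^sup>2 * M z"
      using even_zero_divisible_by_square[OF K K0] by auto
    have "\<forall>\<^sub>F z in at z0. Q z = M z + K z * (H z - wp \<tau> \<omega>)"
      using H(2) M(2)[unfolded eventually_nhds_conv_at, THEN conjunct1] eventually_neq_at_within[of z0 z0]
    proof eventually_elim
      case (elim z)
      have "Q z = K z * (1 / (z - z0)\<^sup>2 + H z - wp \<tau> \<omega>)" using elim by (simp add: Q_def K_def)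
      also have "\<dots> = K z / (z - z0)\<^sup>2 + K z * (H z - wp \<tau> \<omega>)" by (simp add: algebra_simps)
      also have "K z / (z - z0)\<^sup>2 = M z" using elim by simp
      finally show ?case .
    qed
    moreover have "(\<lambda>z. M z + K z * (H z - wp \<tau> \<omega>)) analytic_on {z0}"
      using M(1) K H(1) by (intro analytic_intros)
    ultimately show ?thesis unfolding removable_def by blast
  qed
  have "removable Q z0" for z0
  proof -
    consider "z0 \<in> lattice \<tau>" | "z0 + \<omega> \<in> lattice \<tau>" | "z0 \<notin> lattice \<tau>" "z0 + \<omega> \<notin> lattice \<tau>" by blast
    then show ?thesis
    proof cases
      case 2
      then show ?thesis using removable_shift[OF rem0[of "z0 + \<omega>"]] Qs by simp
    qed (use rem0 an removable_analytic in blast)+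
  qed
  then obtain c where c: "\<And>z0. \<forall>\<^sub>F z in at z0. Q z = c" using elliptic_constant[of Q] per by blast
  have val: "Q z = c" if "z \<notin> lattice \<tau>" "z + \<omega> \<notin> lattice \<tau>" for z
    using removable_value[OF an[OF that] c] .
  have "c \<noteq> 0"
  proof
    assume c0: "c = 0"
    have z: "0 \<in> lattice \<tau>" by (rule lattice_0)
    have "\<forall>\<^sub>F z in at 0. wp \<tau> (z + \<omega>) = wp \<tau> \<omega>"
      using c[of 0] G_pole_neq[OF z, of "wp \<tau> \<omega>"] by eventually_elim (simp add: Q_def c0)
    then obtain d where d: "d > 0" "\<And>z. z \<noteq> 0 \<Longrightarrow> dist z 0 < d \<Longrightarrow> wp \<tau> (z + \<omega>) = wp \<tau> \<omega>"
      by (auto simp: eventually_at)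
    define U where "U = ball \<omega> d \<inter> - lattice \<tau>"
    have U: "wp \<tau> w - wp \<tau> \<omega> = 0" if "w \<in> U" for w
      using d(2)[of "w - \<omega>"] that by (cases "w = \<omega>") (auto simp: U_def dist_norm norm_minus_commute)
    have "open U" "\<omega> \<in> U" unfolding U_def using open_not_lattice h(2) d(1) by auto
    then have lp: "\<omega> islimpt U" by (metis interior_open interior_limit_point)
    have "countable (lattice \<tau>)"
    proof -
      have "lattice \<tau> = (\<lambda>(m, n). of_int m + of_int n * \<tau>) ` (UNIV :: (int \<times> int) set)"
        by (auto simp: lattice_def image_def)
      then show ?thesis by simp
    qed
    then have conn: "connected (- lattice \<tau>)"
      using connected_open_diff_countable[of "UNIV :: complex set" "lattice \<tau>"]
      by (simp add: Compl_eq_Diff_UNIV convex_connected)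
    have hol: "(\<lambda>w. wp \<tau> w - wp \<tau> \<omega>) holomorphic_on - lattice \<tau>"
    proof -
      have "wp \<tau> analytic_on - lattice \<tau>"
        using G_analytic_iff analytic_on_analytic_at[of "wp \<tau>" "- lattice \<tau>"] by blast
      then show ?thesis by (intro holomorphic_intros analytic_imp_holomorphic)
    qed
    have eq: "wp \<tau> w - wp \<tau> \<omega> = 0" if "w \<in> - lattice \<tau>" for w
      by (rule analytic_continuation[OF hol open_not_lattice conn _ _ lp U that])
        (use h(2) in \<open>auto simp: U_def\<close>)
    have "\<forall>\<^sub>F w in at 0. w \<in> - lattice \<tau>"
    proof -
      obtain H r where "r > 0" "\<And>w. w \<in> ball 0 r \<Longrightarrow> w \<noteq> 0 \<Longrightarrow> wp \<tau> w = 1 / (w - 0)\<^sup>2 + H w \<and> w \<notin> lattice \<tau>"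
        using G_pole_ball[OF z] by metis
      then show ?thesis unfolding eventually_at by (intro exI[of _ r]) (simp add: dist_commute)
    qed
    then have "\<forall>\<^sub>F w in at 0. wp \<tau> w = wp \<tau> \<omega>" by eventually_elim (use eq in auto)
    then have "\<forall>\<^sub>F w in at (0::complex). False" using G_pole_neq[OF z, of "wp \<tau> \<omega>"] by eventually_elim simp
    then show False by (simp add: trivial_limit_def[symmetric] eventually_False)
  qed
  then show ?thesis using val unfolding Q_def by blast
qed

end

section \<open>Complex multiplication by an integer of norm two\<close>

context
  fixes a :: complex and t :: int
  assumes a_im: "Im a \<noteq> 0" and a_sq: "a\<^sup>2 = of_int t * a - 2"
begin

definition \<eta> :: complex where "\<eta> = (of_int t - a) / 2"

lemma a_eta: "a * \<eta> = 1"
  using a_sq by (simp add: \<eta>_def field_simps power2_eq_square)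

lemma a_nonzero: "a \<noteq> 0" using a_im by auto

lemma two_eta: "2 * \<eta> \<in> lattice a"
proof -
  have "2 * \<eta> = of_int t - a" by (simp add: \<eta>_def)
  then show ?thesis using lattice_diff[OF lattice_int[of t] lattice_gen] by metis
qed

lemma a_lattice: "w \<in> lattice a \<Longrightarrow> a * w \<in> lattice a"
proof -
  assume "w \<in> lattice a"
  then obtain m n where "w = of_int m + of_int n * a" by (auto simp: lattice_iff)
  then have "a * w = of_int m * a + of_int n * a\<^sup>2" by (simp add: algebra_simps power2_eq_square)
  also have "\<dots> = of_int (- 2 * n) + of_int (m + n * t) * a" unfolding a_sq by (simp add: algebra_simps)
  finally show ?thesis unfolding lattice_iff by blast
qed

lemma eta_notin: "\<eta> \<notin> lattice a"
  using half_not_lattice[OF a_im, of t "- 1"] by (simp add: \<eta>_def)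

text \<open>
  The kernel of multiplication by \<open>a\<close> on the torus has order two, the norm of \<open>a\<close>, and is generated
  by \<open>\<eta> = 1 / a\<close>.
\<close>

lemma a_preimage_lattice: "a * z \<in> lattice a \<longleftrightarrow> z \<in> lattice a \<or> z + \<eta> \<in> lattice a"
proof
  assume "a * z \<in> lattice a"
  then obtain m n where "a * z = of_int m + of_int n * a" by (auto simp: lattice_iff)
  then have "\<eta> * (a * z) = \<eta> * (of_int m + of_int n * a)" by simp
  moreover have "\<eta> * (a * z) = (a * \<eta>) * z"
    and "\<eta> * (of_int m + of_int n * a) = of_int m * \<eta> + of_int n * (a * \<eta>)"
    by (simp_all add: algebra_simps)
  ultimately have z: "z = of_int m * \<eta> + of_int n" by (simp add: a_eta)
  have mult: "of_int k * (2 * \<eta>) \<in> lattice a" for k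
  proof -
    have e: "2 * \<eta> = of_int t - a" by (simp add: \<eta>_def)
    have "of_int k * (2 * \<eta>) = of_int (k * t) + of_int (- k) * a" unfolding e by (simp add: algebra_simps)
    then show ?thesis unfolding lattice_iff by blast
  qed
  show "z \<in> lattice a \<or> z + \<eta> \<in> lattice a"
  proof (cases "even m")
    case True
    then obtain k where "m = 2 * k" by blast
    then have "z = of_int k * (2 * \<eta>) + of_int n" by (simp add: z)
    then show ?thesis using lattice_add[OF mult lattice_int] by metis
  next
    case False
    then obtain k where "m = 2 * k + 1" by (rule oddE)
    then have "z + \<eta> = of_int (k + 1) * (2 * \<eta>) + of_int n" by (simp add: z algebra_simps)
    then show ?thesis using lattice_add[OF mult lattice_int] by metis
  qed
next
  assume *: "z \<in> lattice a \<or> z + \<eta> \<in> lattice a"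
  have "a * (z + \<eta>) = a * z + 1" using a_eta by (simp add: distrib_left)
  then have "a * (z + \<eta>) \<in> lattice a \<Longrightarrow> a * z \<in> lattice a"
    using lattice_diff[of "a * z + 1" a 1] lattice_1 by auto
  then show "a * z \<in> lattice a" using * a_lattice by blast
qed

lemmas G_an = wp_analytic[OF a_im] and G_per = wp_periodic[OF a_im] and G_neg = wp_minus[OF a_im]

text \<open>
  Both sides have the same principal parts, double poles at the kernel of \<open>a\<close>; hence they differ by a
  constant. This is the relation that pushes multiplication by \<open>a\<close> down to a rational map.
\<close>

lemma endomorphism_sum:
  "\<exists>c. \<forall>z. z \<notin> lattice a \<longrightarrow> z + \<eta> \<notin> lattice a \<longrightarrow> a\<^sup>2 * wp a (a * z) = wp a z + wp a (z + \<eta>) + c"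
proof -
  define D where "D = (\<lambda>z. a\<^sup>2 * wp a (a * z) - wp a z - wp a (z + \<eta>))"
  have per: "D (z + w) = D z" if "w \<in> lattice a" for z w
  proof -
    have "wp a (a * (z + w)) = wp a (a * z)" using G_per[OF a_lattice[OF that], of "a * z"] by (simp only: distrib_left)
    moreover have "wp a (z + w + \<eta>) = wp a (z + \<eta>)" using G_per[OF that, of "z + \<eta>"] by (simp only: add.assoc add.commute[of w])
    ultimately show ?thesis unfolding D_def using G_per[OF that, of z] by (simp only:)
  qed
  have an: "D analytic_on {z0}" if "z0 \<notin> lattice a" "z0 + \<eta> \<notin> lattice a" for z0
    unfolding D_def using that a_preimage_lattice[of z0]
    by (intro analytic_intros analytic_shift analytic_scale G_an) auto
  have notin: "z + \<eta> \<notin> lattice a" if "z \<in> lattice a" for z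
    using lattice_diff[of "z + \<eta>" a z] that eta_notin by auto
  have rem: "removable D z0" for z0
  proof -
    have near: "\<exists>h. h analytic_on {z0} \<and> (\<forall>\<^sub>F z in at z0. a\<^sup>2 * wp a (a * z) = 1 / (z - z0)\<^sup>2 + h z)"
      if az: "a * z0 \<in> lattice a"
    proof -
      obtain H where H: "H analytic_on {a * z0}" "\<forall>\<^sub>F z in at (a * z0). wp a z = 1 / (z - a * z0)\<^sup>2 + H z"
        using wp_pole[OF a_im az] by blast
      have "\<forall>\<^sub>F z in at z0. wp a (a * z) = 1 / (a * z - a * z0)\<^sup>2 + H (a * z)"
        using eventually_compose_filterlim[OF H(2) filterlim_scale_at[OF a_nonzero]] .
      then have "\<forall>\<^sub>F z in at z0. a\<^sup>2 * wp a (a * z) = 1 / (z - z0)\<^sup>2 + a\<^sup>2 * H (a * z)"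
      proof eventually_elim
        case (elim z)
        have "(a * z - a * z0)\<^sup>2 = a\<^sup>2 * (z - z0)\<^sup>2" by (simp add: power_mult_distrib right_diff_distrib[symmetric])
        then show ?case using elim a_nonzero by (simp add: distrib_left)
      qed
      moreover have "(\<lambda>z. a\<^sup>2 * H (a * z)) analytic_on {z0}"
        using H(1) by (intro analytic_intros analytic_scale)
      ultimately show ?thesis by blast
    qed
    consider "z0 \<in> lattice a" | "z0 + \<eta> \<in> lattice a" | "z0 \<notin> lattice a" "z0 + \<eta> \<notin> lattice a" by blast
    then show ?thesis
    proof cases
      case 1
      obtain h where h: "h analytic_on {z0}" "\<forall>\<^sub>F z in at z0. a\<^sup>2 * wp a (a * z) = 1 / (z - z0)\<^sup>2 + h z"
        using near a_lattice[OF 1] by blast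
      obtain H where H: "H analytic_on {z0}" "\<forall>\<^sub>F z in at z0. wp a z = 1 / (z - z0)\<^sup>2 + H z"
        using wp_pole[OF a_im 1] by blast
      have "\<forall>\<^sub>F z in at z0. D z = h z - H z - wp a (z + \<eta>)"
        using h(2) H(2) by eventually_elim (simp add: D_def)
      moreover have "(\<lambda>z. h z - H z - wp a (z + \<eta>)) analytic_on {z0}"
        using h(1) H(1) notin[OF 1] by (intro analytic_intros analytic_shift G_an)
      ultimately show ?thesis unfolding removable_def by blast
    next
      case 2
      obtain h where h: "h analytic_on {z0}" "\<forall>\<^sub>F z in at z0. a\<^sup>2 * wp a (a * z) = 1 / (z - z0)\<^sup>2 + h z"
        using near a_preimage_lattice 2 by blast
      obtain H where H: "H analytic_on {z0 + \<eta>}" "\<forall>\<^sub>F z in at (z0 + \<eta>). wp a z = 1 / (z - (z0 + \<eta>))\<^sup>2 + H z"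
        using wp_pole[OF a_im 2] by blast
      have "\<forall>\<^sub>F z in at z0. wp a (z + \<eta>) = 1 / (z + \<eta> - (z0 + \<eta>))\<^sup>2 + H (z + \<eta>)"
        using eventually_compose_filterlim[OF H(2) filterlim_shift_at] .
      with h(2) have "\<forall>\<^sub>F z in at z0. D z = h z - wp a z - H (z + \<eta>)"
        by eventually_elim (simp add: D_def)
      moreover have "(\<lambda>z. h z - wp a z - H (z + \<eta>)) analytic_on {z0}"
        using h(1) H(1) notin[of z0] 2 by (intro analytic_intros analytic_shift G_an) auto
      ultimately show ?thesis unfolding removable_def by blast
    next
      case 3
      then show ?thesis using an removable_analytic by blast
    qed
  qed
  obtain c where c: "\<And>z0. \<forall>\<^sub>F z in at z0. D z = c" using elliptic_constant[OF a_im, of D] per rem by blast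
  have "a\<^sup>2 * wp a (a * z) = wp a z + wp a (z + \<eta>) + c" if "z \<notin> lattice a" "z + \<eta> \<notin> lattice a" for z
    using removable_value[OF an[OF that] c] by (simp add: D_def algebra_simps)
  then show ?thesis by blast
qed

definition shifted_wp :: "complex \<Rightarrow> complex" where "shifted_wp z = wp a z - wp a \<eta>"

lemma shifted_wp_eta: "shifted_wp \<eta> = 0" by (simp add: shifted_wp_def)
lemma shifted_wp_per: "w \<in> lattice a \<Longrightarrow> shifted_wp (z + w) = shifted_wp z" by (simp add: shifted_wp_def G_per)
lemma shifted_wp_neg: "shifted_wp (- z) = shifted_wp z" by (simp add: shifted_wp_def G_neg)

lemma shifted_wp_congruent: "z - w \<in> lattice a \<Longrightarrow> shifted_wp z = shifted_wp w"
  using shifted_wp_per[of "z - w" w] by simp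

lemma shifted_wp_relation:
  "\<exists>c k. c \<noteq> 0 \<and> (\<forall>z. z \<notin> lattice a \<longrightarrow> z + \<eta> \<notin> lattice a \<longrightarrow>
     shifted_wp (z + \<eta>) * shifted_wp z = c \<and> a\<^sup>2 * shifted_wp (a * z) = shifted_wp z + shifted_wp (z + \<eta>) + k)"
proof -
  obtain c where c: "c \<noteq> 0" "\<forall>z. z \<notin> lattice a \<longrightarrow> z + \<eta> \<notin> lattice a \<longrightarrow>
      (wp a (z + \<eta>) - wp a \<eta>) * (wp a z - wp a \<eta>) = c"
    using half_period_product[OF a_im two_eta eta_notin] by blast
  obtain d where d: "\<forall>z. z \<notin> lattice a \<longrightarrow> z + \<eta> \<notin> lattice a \<longrightarrow>
      a\<^sup>2 * wp a (a * z) = wp a z + wp a (z + \<eta>) + d"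
    using endomorphism_sum by blast
  have "shifted_wp (z + \<eta>) * shifted_wp z = c"
    "a\<^sup>2 * shifted_wp (a * z) = shifted_wp z + shifted_wp (z + \<eta>) + (2 * wp a \<eta> + d - a\<^sup>2 * wp a \<eta>)"
    if "z \<notin> lattice a" "z + \<eta> \<notin> lattice a" for z
    using c(2)[rule_format, OF that] d[rule_format, OF that] by (simp_all add: shifted_wp_def algebra_simps)
  then show ?thesis using c(1) by blast
qed

lemma half_notin: "odd m \<or> odd n \<Longrightarrow> (of_int m + of_int n * a) / 2 \<notin> lattice a"
  by (rule half_not_lattice[OF a_im])

text \<open>
  The four points with \<open>2 z = \<eta>\<close> are critical for \<open>\<wp> (z) + \<wp> (z + \<eta>)\<close>, as \<open>z + \<eta> = - z\<close> modulo the
  lattice.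
\<close>

lemma critical_point:
  assumes "2 * z - \<eta> \<in> lattice a"
  shows "z \<notin> lattice a" "z + \<eta> \<notin> lattice a" "shifted_wp (z + \<eta>) = shifted_wp z"
proof -
  have e: "2 * z - (2 * z - \<eta>) = \<eta>" by simp
  show 1: "z \<notin> lattice a"
  proof
    assume "z \<in> lattice a"
    then have "2 * z \<in> lattice a" using lattice_add[of z a z] by simp
    then show False using lattice_diff[OF _ assms, of "2 * z"] eta_notin unfolding e by blast
  qed
  show "z + \<eta> \<notin> lattice a"
  proof
    assume "z + \<eta> \<in> lattice a"
    then have "2 * z + 2 * \<eta> \<in> lattice a" using lattice_add[of "z + \<eta>" a "z + \<eta>"] by (simp add: algebra_simps)
    then have "2 * z \<in> lattice a" using lattice_diff[OF _ two_eta, of "2 * z + 2 * \<eta>"] by simp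
    then show False using lattice_diff[OF _ assms, of "2 * z"] eta_notin unfolding e by blast
  qed
  have "(z + \<eta>) - (- z) = (2 * z - \<eta>) + 2 * \<eta>" by simp
  then have "shifted_wp (z + \<eta>) = shifted_wp (- z)" using lattice_add[OF assms two_eta] by (intro shifted_wp_congruent) metis
  then show "shifted_wp (z + \<eta>) = shifted_wp z" by (simp only: shifted_wp_neg)
qed

lemma eta_half: "a * (\<eta> / 2) = 1 / 2" "2 * (\<eta> / 2) - \<eta> \<in> lattice a"
  using a_eta lattice_0 by simp_all

text \<open>
  For even trace \<open>a\<close> maps \<open>\<eta> / 2\<close> to the half period \<open>1 / 2\<close> and \<open>\<eta> / 2 + 1 / 2\<close> to \<open>(1 + a) / 2\<close>, which differ
  by \<open>\<eta>\<close>. The values at the latter two therefore have product \<open>c\<close>, and this determines \<open>k\<close>.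
\<close>

theorem even_trace_relation:
  assumes even: "even t"
  shows "\<exists>c k. c \<noteq> 0 \<and> k\<^sup>2 = (4 + a^4) * c \<and> (\<forall>z. z \<notin> lattice a \<longrightarrow> z + \<eta> \<notin> lattice a \<longrightarrow>
     shifted_wp (z + \<eta>) * shifted_wp z = c \<and> a\<^sup>2 * shifted_wp (a * z) = shifted_wp z + shifted_wp (z + \<eta>) + k)"
proof -
  obtain c k where c0: "c \<noteq> 0" and ck: "\<forall>z. z \<notin> lattice a \<longrightarrow> z + \<eta> \<notin> lattice a \<longrightarrow>
     shifted_wp (z + \<eta>) * shifted_wp z = c \<and> a\<^sup>2 * shifted_wp (a * z) = shifted_wp z + shifted_wp (z + \<eta>) + k"
    using shifted_wp_relation by blast
  have c: "c \<noteq> 0" "\<And>z. z \<notin> lattice a \<Longrightarrow> z + \<eta> \<notin> lattice a \<Longrightarrow> shifted_wp (z + \<eta>) * shifted_wp z = c"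
    and k: "\<And>z. z \<notin> lattice a \<Longrightarrow> z + \<eta> \<notin> lattice a \<Longrightarrow> a\<^sup>2 * shifted_wp (a * z) = shifted_wp z + shifted_wp (z + \<eta>) + k"
    using c0 ck by simp_all
  obtain s where s: "t = 2 * s" using even by blast
  define z1 z2 where "z1 = \<eta> / 2" and "z2 = \<eta> / 2 + 1 / 2"
  define h1 h2 :: complex where "h1 = 1 / 2" and "h2 = (1 + a) / 2"
  have z1: "2 * z1 - \<eta> \<in> lattice a" "a * z1 = h1" using eta_half by (simp_all add: z1_def h1_def)
  have z2: "2 * z2 - \<eta> \<in> lattice a" "a * z2 = h2"
    using lattice_1 a_eta by (simp_all add: z2_def h2_def field_simps)
  note p1 = critical_point[OF z1(1)] and p2 = critical_point[OF z2(1)]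
  have sq: "shifted_wp z1 * shifted_wp z1 = c" "shifted_wp z2 * shifted_wp z2 = c" using c(2)[OF p1(1,2)] c(2)[OF p2(1,2)] unfolding p1(3) p2(3) by simp_all
  have v: "a\<^sup>2 * shifted_wp h1 = 2 * shifted_wp z1 + k" "a\<^sup>2 * shifted_wp h2 = 2 * shifted_wp z2 + k"
    using k[OF p1(1,2)] k[OF p2(1,2)] p1(3) p2(3) z1 z2 by simp_all
  have h1: "h1 \<notin> lattice a" "2 * h1 \<in> lattice a" using half_notin[of 1 0] lattice_1 by (simp_all add: h1_def)
  have h2: "h2 \<notin> lattice a" using half_notin[of 1 1] by (simp add: h2_def)
  have h1e: "h1 + \<eta> = (of_int (1 + t) + of_int (- 1) * a) / 2" by (simp add: h1_def \<eta>_def field_simps)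
  have h1e_notin: "h1 + \<eta> \<notin> lattice a" unfolding h1e by (rule half_notin) simp
  have "h1 + \<eta> - h2 = of_int s + of_int (- 1) * a" unfolding h1e by (simp add: h2_def s field_simps)
  then have "h1 + \<eta> - h2 \<in> lattice a" unfolding lattice_iff by blast
  then have "shifted_wp (h1 + \<eta>) = shifted_wp h2" by (rule shifted_wp_congruent)
  then have prod: "shifted_wp h2 * shifted_wp h1 = c" using c(2)[OF h1(1) h1e_notin] by simp
  obtain d where d: "d \<noteq> 0" and d2: "\<forall>z. z \<notin> lattice a \<longrightarrow> z + h1 \<notin> lattice a \<longrightarrow> (wp a (z + h1) - wp a h1) * (wp a z - wp a h1) = d"
    using half_period_product[OF a_im h1(2,1)] by blast
  have e: "h2 + h1 = (of_int 2 + of_int 1 * a) / 2" by (simp add: h1_def h2_def field_simps)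
  have "h2 + h1 \<notin> lattice a" unfolding e by (rule half_notin) simp
  then have "wp a h2 \<noteq> wp a h1" using d d2[rule_format, OF h2] by auto
  then have neq: "shifted_wp h1 \<noteq> shifted_wp h2" by (simp add: shifted_wp_def)
  have "shifted_wp z1 \<noteq> shifted_wp z2"
  proof
    assume "shifted_wp z1 = shifted_wp z2"
    then have "a\<^sup>2 * shifted_wp h1 = a\<^sup>2 * shifted_wp h2" unfolding v by simp
    then show False using neq a_nonzero by simp
  qed
  moreover have "(shifted_wp z1 - shifted_wp z2) * (shifted_wp z1 + shifted_wp z2) = 0" using sq by (simp add: algebra_simps)
  ultimately have "shifted_wp z2 = - shifted_wp z1" by (simp add: add_eq_0_iff)
  then have "(a\<^sup>2 * shifted_wp h1) * (a\<^sup>2 * shifted_wp h2) = (k + 2 * shifted_wp z1) * (k - 2 * shifted_wp z1)" unfolding v by (simp add: algebra_simps)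
  also have "\<dots> = k\<^sup>2 - 4 * (shifted_wp z1 * shifted_wp z1)" by (simp add: algebra_simps power2_eq_square)
  finally have "a^4 * (shifted_wp h2 * shifted_wp h1) = k\<^sup>2 - 4 * c" unfolding sq by (simp add: mult_ac power2_eq_square power4_eq_xxxx)
  then have kc: "k\<^sup>2 = (4 + a^4) * c" unfolding prod by (simp add: algebra_simps)
  then show ?thesis using c0 ck by blast
qed

text \<open>
  For odd trace \<open>a\<close> maps one of the critical points to \<open>\<eta>\<close>, a zero of the shifted function, and this
  determines \<open>k\<close>. The last identity describes the translation by \<open>1 / 2\<close>, which gives a second Lattes map on the
  same torus.
\<close>

theorem odd_trace_relation:
  assumes odd: "odd t"
  shows "\<exists>c k. c \<noteq> 0 \<and> k\<^sup>2 = 4 * c \<and> a\<^sup>2 * shifted_wp (1 / 2) = 2 * k \<and> (shifted_wp (1 / 2))\<^sup>2 \<noteq> c \<and>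
    (\<forall>z. z \<notin> lattice a \<longrightarrow> z + \<eta> \<notin> lattice a \<longrightarrow>
      shifted_wp (z + \<eta>) * shifted_wp z = c \<and> a\<^sup>2 * shifted_wp (a * z) = shifted_wp z + shifted_wp (z + \<eta>) + k) \<and>
    (\<forall>z. z \<notin> lattice a \<longrightarrow> z + 1 / 2 \<notin> lattice a \<longrightarrow>
      (shifted_wp (z + 1 / 2) - shifted_wp (1 / 2)) * (shifted_wp z - shifted_wp (1 / 2)) = (shifted_wp (1 / 2))\<^sup>2 - c)"
proof -
  obtain c k where c0: "c \<noteq> 0" and ck: "\<forall>z. z \<notin> lattice a \<longrightarrow> z + \<eta> \<notin> lattice a \<longrightarrow>
     shifted_wp (z + \<eta>) * shifted_wp z = c \<and> a\<^sup>2 * shifted_wp (a * z) = shifted_wp z + shifted_wp (z + \<eta>) + k"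
    using shifted_wp_relation by blast
  have c: "c \<noteq> 0" "\<And>z. z \<notin> lattice a \<Longrightarrow> z + \<eta> \<notin> lattice a \<Longrightarrow> shifted_wp (z + \<eta>) * shifted_wp z = c"
    and k: "\<And>z. z \<notin> lattice a \<Longrightarrow> z + \<eta> \<notin> lattice a \<Longrightarrow> a\<^sup>2 * shifted_wp (a * z) = shifted_wp z + shifted_wp (z + \<eta>) + k"
    using c0 ck by simp_all
  obtain s where s: "t = 2 * s + 1" using odd by (rule oddE)
  define z1 z3 where "z1 = \<eta> / 2" and "z3 = \<eta> * \<eta>"
  define h1 :: complex where "h1 = 1 / 2"
  have z1: "2 * z1 - \<eta> \<in> lattice a" "a * z1 = h1" using eta_half by (simp_all add: z1_def h1_def)
  have az3: "a * z3 = \<eta>" using a_eta by (simp add: z3_def mult.assoc[symmetric])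
  have z3: "2 * z3 - \<eta> \<in> lattice a"
  proof -
    have "2 * z3 - \<eta> = \<eta> * (of_int t - a) - \<eta>" by (simp add: z3_def \<eta>_def)
    also have "\<dots> = of_int s * (2 * \<eta>) - 1" using a_eta by (simp add: s algebra_simps)
    also have "2 * \<eta> = of_int t - a" by (simp add: \<eta>_def)
    also have "of_int s * (of_int t - a) - 1 = of_int (s * t - 1) + of_int (- s) * a" by (simp add: algebra_simps)
    finally show ?thesis unfolding lattice_iff by blast
  qed
  note p1 = critical_point[OF z1(1)] and p3 = critical_point[OF z3]
  have sq: "shifted_wp z1 * shifted_wp z1 = c" "shifted_wp z3 * shifted_wp z3 = c" using c(2)[OF p1(1,2)] c(2)[OF p3(1,2)] unfolding p1(3) p3(3) by simp_all
  have v: "a\<^sup>2 * shifted_wp h1 = 2 * shifted_wp z1 + k" "2 * shifted_wp z3 + k = 0"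
    using k[OF p1(1,2)] k[OF p3(1,2)] p1(3) p3(3) z1 az3 shifted_wp_eta by simp_all
  have k3: "k = - 2 * shifted_wp z3" using v(2) by (simp add: add_eq_0_iff)
  then have kc: "k\<^sup>2 = 4 * c" using sq by (simp add: power2_eq_square)
  have h1: "h1 \<notin> lattice a" "2 * h1 \<in> lattice a" using half_notin[of 1 0] lattice_1 by (simp_all add: h1_def)
  have e: "h1 + \<eta> = (of_int (1 + t) + of_int (- 1) * a) / 2" by (simp add: h1_def \<eta>_def field_simps)
  have h1e: "h1 + \<eta> \<notin> lattice a" unfolding e by (rule half_notin) simp
  have prod: "shifted_wp (h1 + \<eta>) * shifted_wp h1 = c" by (rule c(2)[OF h1(1) h1e])
  then have "shifted_wp h1 \<noteq> 0" using c(1) by auto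
  then have "a\<^sup>2 * shifted_wp h1 \<noteq> 0" using a_nonzero by simp
  then have "shifted_wp z1 \<noteq> shifted_wp z3" unfolding v(1) k3 by auto
  moreover have "(shifted_wp z1 - shifted_wp z3) * (shifted_wp z1 + shifted_wp z3) = 0" using sq by (simp add: algebra_simps)
  ultimately have "shifted_wp z1 = - shifted_wp z3" by (simp add: add_eq_0_iff2)
  then have ek: "a\<^sup>2 * shifted_wp h1 = 2 * k" using v k3 by simp
  obtain d where d: "d \<noteq> 0" and d2: "\<forall>z. z \<notin> lattice a \<longrightarrow> z + h1 \<notin> lattice a \<longrightarrow> (wp a (z + h1) - wp a h1) * (wp a z - wp a h1) = d"
    using half_period_product[OF a_im h1(2,1)] by blast
  have d': "(shifted_wp (z + h1) - shifted_wp h1) * (shifted_wp z - shifted_wp h1) = d" if "z \<notin> lattice a" "z + h1 \<notin> lattice a" for z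
    using d2[rule_format, OF that] by (simp add: shifted_wp_def)
  have "(shifted_wp (\<eta> + h1) - shifted_wp h1) * (shifted_wp \<eta> - shifted_wp h1) = d" using h1e eta_notin by (intro d') (simp_all add: add.commute)
  then have "(shifted_wp h1)\<^sup>2 - shifted_wp (h1 + \<eta>) * shifted_wp h1 = d" by (simp add: shifted_wp_eta add.commute[of \<eta>] algebra_simps power2_eq_square)
  then have "d = (shifted_wp h1)\<^sup>2 - c" unfolding prod by simp
  then have "(shifted_wp h1)\<^sup>2 \<noteq> c" "\<forall>z. z \<notin> lattice a \<longrightarrow> z + h1 \<notin> lattice a \<longrightarrow>
      (shifted_wp (z + h1) - shifted_wp h1) * (shifted_wp z - shifted_wp h1) = (shifted_wp h1)\<^sup>2 - c"
    using d d' by simp_all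
  then show ?thesis using c0 kc ek ck unfolding h1_def by blast
qed

end

section \<open>Maps uniformized by a torus\<close>

text \<open>
  Holomorphy by local homogeneous coordinates, without choosing a chart.
\<close>

lemma sphere_holomorphic_ptI:
  assumes "\<And>z. \<exists>U A B. open U \<and> z \<in> U \<and> A holomorphic_on U \<and> B holomorphic_on U \<and>
    (\<forall>w\<in>U. (A w \<noteq> 0 \<or> B w \<noteq> 0) \<and> g w = pt (A w) (B w))"
  shows "sphere_holomorphic g"
  unfolding sphere_holomorphic_def
proof
  fix z
  obtain U A B where *: "open U \<and> z \<in> U \<and> A holomorphic_on U \<and> B holomorphic_on U \<and>
    (\<forall>w\<in>U. (A w \<noteq> 0 \<or> B w \<noteq> 0) \<and> g w = pt (A w) (B w))"
    using assms[of z] by blast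
  then have U: "open U" "z \<in> U" "A holomorphic_on U" "B holomorphic_on U"
    "\<And>w. w \<in> U \<Longrightarrow> A w \<noteq> 0 \<or> B w \<noteq> 0" "\<And>w. w \<in> U \<Longrightarrow> g w = pt (A w) (B w)"
    by simp_all
  have nz: "open {w \<in> U. F w \<noteq> 0}" if "F holomorphic_on U" for F
  proof -
    have "open (U \<inter> F -` (- {0}))"
      using that U(1) by (intro continuous_open_preimage open_Compl) (auto simp: holomorphic_on_imp_continuous_on)
    moreover have "U \<inter> F -` (- {0}) = {w \<in> U. F w \<noteq> 0}" by auto
    ultimately show ?thesis by simp
  qed
  show "\<exists>U. open U \<and> z \<in> U \<and> ((\<forall>w\<in>U. g w \<noteq> Infty) \<and> (\<lambda>w. coord (g w)) holomorphic_on U \<or>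
      (\<forall>w\<in>U. g w \<noteq> Fin 0) \<and> (\<lambda>w. coord (rinv (g w))) holomorphic_on U)"
  proof (cases "B z = 0")
    case False
    define V where "V = {w \<in> U. B w \<noteq> 0}"
    have "(\<lambda>w. A w / B w) holomorphic_on V"
      using U(3,4) by (intro holomorphic_intros) (auto simp: V_def intro: holomorphic_on_subset)
    then have "(\<lambda>w. coord (g w)) holomorphic_on V"
      by (rule holomorphic_transform) (auto simp: V_def U(6) pt_def)
    then show ?thesis using nz[OF U(4)] False U(2) U(6)
      by (intro exI[of _ V]) (auto simp: V_def pt_def)
  next
    case True
    define V where "V = {w \<in> U. A w \<noteq> 0}"
    have "(\<lambda>w. B w / A w) holomorphic_on V"
      using U(3,4) by (intro holomorphic_intros) (auto simp: V_def intro: holomorphic_on_subset)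
    then have "(\<lambda>w. coord (rinv (g w))) holomorphic_on V"
      by (rule holomorphic_transform) (auto simp: V_def U(6) pt_def)
    then show ?thesis using nz[OF U(3)] True U(2,5) U(6)
      by (intro exI[of _ V]) (auto simp: V_def pt_def)
  qed
qed

lemma sphere_holomorphic_ptD:
  assumes "sphere_holomorphic g"
  shows "\<exists>U A B. open U \<and> z \<in> U \<and> A holomorphic_on U \<and> B holomorphic_on U \<and>
    (\<forall>w\<in>U. (A w \<noteq> 0 \<or> B w \<noteq> 0) \<and> g w = pt (A w) (B w))"
proof -
  obtain U where U: "open U" "z \<in> U" and c: "(\<forall>w\<in>U. g w \<noteq> Infty) \<and> (\<lambda>w. coord (g w)) holomorphic_on U \<or>
      (\<forall>w\<in>U. g w \<noteq> Fin 0) \<and> (\<lambda>w. coord (rinv (g w))) holomorphic_on U"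
    using assms unfolding sphere_holomorphic_def by blast
  from c show ?thesis
  proof
    assume h: "(\<forall>w\<in>U. g w \<noteq> Infty) \<and> (\<lambda>w. coord (g w)) holomorphic_on U"
    have "g w = pt (coord (g w)) 1" if "w \<in> U" for w
      using h that by (cases "g w") (auto simp: pt_def)
    then show ?thesis using U h by (intro exI[of _ U] exI[of _ "\<lambda>w. coord (g w)"] exI[of _ "\<lambda>_. 1"]) auto
  next
    assume h: "(\<forall>w\<in>U. g w \<noteq> Fin 0) \<and> (\<lambda>w. coord (rinv (g w))) holomorphic_on U"
    have "g w = pt 1 (coord (rinv (g w)))" if "w \<in> U" for w
      using h that by (cases "g w") (auto simp: pt_def divide_inverse)
    then show ?thesis using U h by (intro exI[of _ U] exI[of _ "\<lambda>_. 1"] exI[of _ "\<lambda>w. coord (rinv (g w))"]) auto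
  qed
qed

text \<open>
  A semiconjugacy from an affine map of the torus, with all maps lifted to the plane; this avoids
  quotients until the very end.
\<close>

definition uniformized :: "(rsphere \<Rightarrow> rsphere) \<Rightarrow> bool" where
  "uniformized f \<longleftrightarrow> (\<exists>\<tau> a b g. Im \<tau> \<noteq> 0 \<and> (\<forall>w\<in>lattice \<tau>. a * w \<in> lattice \<tau>) \<and> sphere_holomorphic g \<and>
     (\<forall>z. \<forall>w\<in>lattice \<tau>. g (z + w) = g z) \<and> (\<exists>x y. g x \<noteq> g y) \<and> (\<forall>z. f (g z) = g (a * z + b)))"

lemma sphere_holomorphic_compose:
  assumes g: "sphere_holomorphic g"
    and S: "\<And>u v. u \<noteq> 0 \<or> v \<noteq> 0 \<Longrightarrow> (p u v \<noteq> 0 \<or> q u v \<noteq> 0) \<and> S (pt u v) = pt (p u v) (q u v)"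
    and hol: "\<And>U A B. A holomorphic_on U \<Longrightarrow> B holomorphic_on U \<Longrightarrow>
      (\<lambda>w. p (A w) (B w)) holomorphic_on U \<and> (\<lambda>w. q (A w) (B w)) holomorphic_on U"
  shows "sphere_holomorphic (\<lambda>z. S (g z))"
proof (rule sphere_holomorphic_ptI)
  fix z
  obtain U A B where U: "open U" "z \<in> U" "A holomorphic_on U" "B holomorphic_on U"
    "\<forall>w\<in>U. (A w \<noteq> 0 \<or> B w \<noteq> 0) \<and> g w = pt (A w) (B w)"
    using sphere_holomorphic_ptD[OF g, of z] by blast
  then show "\<exists>U A B. open U \<and> z \<in> U \<and> A holomorphic_on U \<and> B holomorphic_on U \<and>
    (\<forall>w\<in>U. (A w \<noteq> 0 \<or> B w \<noteq> 0) \<and> S (g w) = pt (A w) (B w))"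
    using hol[OF U(3,4)] S by (intro exI[of _ U] exI[of _ "\<lambda>w. p (A w) (B w)"] exI[of _ "\<lambda>w. q (A w) (B w)"]) auto
qed

lemma uniformized_conjugate:
  assumes "conjugate f f'" and "uniformized f"
  shows "uniformized f'"
proof -
  obtain \<phi> where \<phi>: "moebius \<phi>" "\<phi> \<circ> f = f' \<circ> \<phi>" using assms(1) unfolding conjugate_def by blast
  obtain a b c d where m: "a * d - b * c \<noteq> 0" "\<phi> = mob a b c d" using \<phi>(1) by (rule moebius_cases)
  obtain \<tau> k l g where g: "Im \<tau> \<noteq> 0" "\<forall>w\<in>lattice \<tau>. k * w \<in> lattice \<tau>" "sphere_holomorphic g"
     "\<forall>z. \<forall>w\<in>lattice \<tau>. g (z + w) = g z" "\<exists>x y. g x \<noteq> g y" "\<forall>z. f (g z) = g (k * z + l)"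
    using assms(2) unfolding uniformized_def by blast
  have "sphere_holomorphic (\<lambda>z. \<phi> (g z))"
  proof (rule sphere_holomorphic_compose[OF g(3), where p = "\<lambda>u v. a * u + b * v" and q = "\<lambda>u v. c * u + d * v"])
    show "(a * u + b * v \<noteq> 0 \<or> c * u + d * v \<noteq> 0) \<and> \<phi> (pt u v) = pt (a * u + b * v) (c * u + d * v)"
      if "u \<noteq> 0 \<or> v \<noteq> 0" for u v
      using linear_nonzero[OF m(1) that] mob_pt[OF m(1) that] m(2) by simp
  qed (auto intro!: holomorphic_intros)
  moreover have "f' (\<phi> (g z)) = \<phi> (g (k * z + l))" for z
    using fun_cong[OF \<phi>(2), of "g z"] g(6) by simp
  moreover have "\<exists>x y. \<phi> (g x) \<noteq> \<phi> (g y)" using g(5) mob_inverse(1)[OF m(1)] m(2) by metis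
  ultimately show ?thesis using g(1,2,4) unfolding uniformized_def
    by (intro exI[of _ \<tau>] exI[of _ k] exI[of _ l] exI[of _ "\<lambda>z. \<phi> (g z)"]) auto
qed

lemma torus_rel_equiv: "equiv UNIV (torus_rel (lattice \<tau>))"
proof (rule equivI)
  show "sym (torus_rel (lattice \<tau>))"
  proof (rule symI)
    fix x y assume "(x, y) \<in> torus_rel (lattice \<tau>)"
    then show "(y, x) \<in> torus_rel (lattice \<tau>)"
      using lattice_minus[of "x - y" \<tau>] by (simp add: torus_rel_def)
  qed
  show "trans (torus_rel (lattice \<tau>))"
  proof (rule transI)
    fix x y z assume "(x, y) \<in> torus_rel (lattice \<tau>)" "(y, z) \<in> torus_rel (lattice \<tau>)"
    then show "(x, z) \<in> torus_rel (lattice \<tau>)"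
      using lattice_add[of "x - y" \<tau> "y - z"] by (simp add: torus_rel_def)
  qed
qed (auto simp: refl_on_def torus_rel_def lattice_0)

lemma torus_proj_eq_iff: "torus_proj (lattice \<tau>) z = torus_proj (lattice \<tau>) w \<longleftrightarrow> z - w \<in> lattice \<tau>"
  unfolding torus_proj_def using eq_equiv_class_iff[OF torus_rel_equiv, of z w \<tau>] by (simp add: torus_rel_def)

lemma torus_proj_in: "torus_proj \<Lambda> z \<in> torus \<Lambda>"
  by (simp add: torus_proj_def torus_def quotientI)

lemma torus_cases: "X \<in> torus \<Lambda> \<Longrightarrow> \<exists>z. X = torus_proj \<Lambda> z"
  by (auto simp: torus_proj_def torus_def elim: quotientE)

text \<open>
  Periodicity lets the plane maps descend to the quotient, and local lifts are given by the plane maps themselves.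
\<close>

theorem uniformized_lattes_map:
  assumes "rational_map 2 f" and "uniformized f"
  shows "lattes_map f"
proof -
  obtain \<tau> a b g where g: "Im \<tau> \<noteq> 0" "\<forall>w\<in>lattice \<tau>. a * w \<in> lattice \<tau>" "sphere_holomorphic g"
     "\<forall>z. \<forall>w\<in>lattice \<tau>. g (z + w) = g z" "\<exists>x y. g x \<noteq> g y" "\<forall>z. f (g z) = g (a * z + b)"
    using assms(2) unfolding uniformized_def by blast
  let ?L = "lattice \<tau>"
  define r where "r = (\<lambda>X. SOME z. X = torus_proj ?L z)"
  have r: "z - r (torus_proj ?L z) \<in> ?L" for z
  proof -
    have "torus_proj ?L z = torus_proj ?L (r (torus_proj ?L z))"
      unfolding r_def by (rule someI[of _ z]) simp
    then show ?thesis by (simp only: torus_proj_eq_iff)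
  qed
  define p where "p = (\<lambda>X. g (r X))"
  define M where "M = (\<lambda>X. torus_proj ?L (a * r X + b))"
  have p: "p (torus_proj ?L z) = g z" for z
    using g(4)[rule_format, OF r, of "r (torus_proj ?L z)" z] by (simp add: p_def)
  have M: "M (torus_proj ?L z) = torus_proj ?L (a * z + b)" for z
  proof -
    have "(a * r (torus_proj ?L z) + b) - (a * z + b) = - (a * (z - r (torus_proj ?L z)))"
      by (simp add: algebra_simps)
    also have "\<dots> \<in> ?L" using g(2) r by (intro lattice_minus) blast
    finally show ?thesis by (simp add: M_def torus_proj_eq_iff)
  qed
  have lat: "is_lattice ?L"
    unfolding is_lattice_def lattice_def using g(1)
    by (intro exI[of _ 1] exI[of _ \<tau>]) (auto simp: complex_is_Real_iff)
  have self: "torus_holomorphic_self ?L M"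
    unfolding torus_holomorphic_self_def
  proof (intro conjI allI)
    show "M ` torus ?L \<subseteq> torus ?L" by (auto simp: M_def torus_proj_in)
    show "\<exists>U h. open U \<and> z \<in> U \<and> h holomorphic_on U \<and> (\<forall>w\<in>U. M (torus_proj ?L w) = torus_proj ?L (h w))" for z
      by (rule exI[of _ UNIV], rule exI[of _ "\<lambda>z. a * z + b"]) (auto simp: M intro!: holomorphic_intros)
  qed
  have "torus_holomorphic_sphere ?L p"
    unfolding torus_holomorphic_sphere_def using g(3) by (simp add: p)
  moreover have "\<not> p constant_on torus ?L"
    using g(5) torus_proj_in unfolding constant_on_def by (metis p)
  moreover have "\<forall>X\<in>torus ?L. f (p X) = p (M X)"
  proof
    fix X assume "X \<in> torus ?L"
    then obtain z where "X = torus_proj ?L z" using torus_cases by blast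
    then show "f (p X) = p (M X)" using g(6) by (simp add: p M)
  qed
  ultimately show ?thesis
    unfolding lattes_map_def using assms(1) lat self by (intro conjI exI[of _ 2] exI[of _ ?L] exI[of _ M] exI[of _ p]) auto
qed

lemma nondeg_joukowski: "m \<noteq> 0 \<Longrightarrow> nondeg 1 \<kappa> 1 0 m 0" for m \<kappa> :: complex
  unfolding nondeg_def by (auto simp: qform_def)

context
  fixes a :: complex and t :: int
  assumes a_im: "Im a \<noteq> 0" and a_sq: "a\<^sup>2 = of_int t * a - 2"
begin

abbreviation "PP \<equiv> shifted_wp a t"

text \<open>
  The scaling by \<open>s\<close>, a square root of \<open>c\<close>, turns the translation by \<open>\<eta>\<close> into \<open>z \<mapsto> 1 / z\<close>.
\<close>

definition sphere_P :: "complex \<Rightarrow> complex \<Rightarrow> rsphere" where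
  "sphere_P s z = (if z \<in> lattice a then Infty else pt (PP z) s)"

lemma sphere_P_holomorphic:
  assumes "s \<noteq> 0"
  shows "sphere_holomorphic (sphere_P s)"
proof (rule sphere_holomorphic_ptI)
  fix z0
  show "\<exists>U A B. open U \<and> z0 \<in> U \<and> A holomorphic_on U \<and> B holomorphic_on U \<and>
    (\<forall>w\<in>U. (A w \<noteq> 0 \<or> B w \<noteq> 0) \<and> sphere_P s w = pt (A w) (B w))"
  proof (cases "z0 \<in> lattice a")
    case False
    have "wp a analytic_on - lattice a"
      using wp_analytic[OF a_im] analytic_on_analytic_at[of "wp a" "- lattice a"] by blast
    then have "PP holomorphic_on - lattice a"
      unfolding shifted_wp_def[OF a_im a_sq, abs_def] by (intro holomorphic_intros analytic_imp_holomorphic)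
    then show ?thesis using False open_not_lattice[OF a_im] assms
      by (intro exI[of _ "- lattice a"] exI[of _ PP] exI[of _ "\<lambda>_. s"]) (auto simp: sphere_P_def)
  next
    case True
    obtain H r where H: "r > 0" "H holomorphic_on ball z0 r"
      "\<And>z. z \<in> ball z0 r \<Longrightarrow> z \<noteq> z0 \<Longrightarrow> wp a z = 1 / (z - z0)\<^sup>2 + H z \<and> z \<notin> lattice a"
      using G_pole_ball[OF a_im True] by metis
    define e where "e = wp a (\<eta> a t)"
    define A where "A = (\<lambda>z. 1 + (z - z0)\<^sup>2 * (H z - e))"
    define B where "B = (\<lambda>z. (z - z0)\<^sup>2 * s)"
    have hol: "A holomorphic_on ball z0 r" "B holomorphic_on ball z0 r"
      unfolding A_def B_def using H(2) by (intro holomorphic_intros; simp)+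
    have ne: "A w \<noteq> 0 \<or> B w \<noteq> 0" for w using assms by (cases "w = z0") (auto simp: A_def B_def)
    have "sphere_P s w = pt (A w) (B w)" if "w \<in> ball z0 r" for w
    proof (cases "w = z0")
      case True
      then show ?thesis using \<open>z0 \<in> lattice a\<close> by (simp add: sphere_P_def A_def B_def pt_def)
    next
      case False
      then have w: "wp a w = 1 / (w - z0)\<^sup>2 + H w" "w \<notin> lattice a" using H(3) that by auto
      have "PP w = A w / (w - z0)\<^sup>2"
        using False by (simp add: shifted_wp_def[OF a_im a_sq] w(1) A_def e_def field_simps)
      then show ?thesis using False assms w(2) by (simp add: sphere_P_def pt_def B_def field_simps)
    qed
    then show ?thesis using H(1) hol ne by (intro exI[of _ "ball z0 r"] exI[of _ A] exI[of _ B]) auto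
  qed
qed

lemma sphere_P_periodic: "w \<in> lattice a \<Longrightarrow> sphere_P s (z + w) = sphere_P s z"
proof -
  assume w: "w \<in> lattice a"
  have "z + w \<in> lattice a \<longleftrightarrow> z \<in> lattice a"
    using lattice_add[of z a w] lattice_diff[of "z + w" a w] w by auto
  then show ?thesis using shifted_wp_per[OF a_im a_sq w] by (simp add: sphere_P_def)
qed

lemma sphere_P_nonconstant: "s \<noteq> 0 \<Longrightarrow> \<exists>x y. sphere_P s x \<noteq> sphere_P s y"
  using eta_notin[OF a_im a_sq] lattice_0[of a]
  by (intro exI[of _ 0] exI[of _ "\<eta> a t"]) (simp add: sphere_P_def pt_def)

lemma uniformizedI:
  assumes "s \<noteq> 0" "\<And>z. f (sphere_P s z) = sphere_P s (a * z + b)"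
  shows "uniformized f"
  unfolding uniformized_def
  using assms a_im a_lattice[OF a_im a_sq] sphere_P_holomorphic sphere_P_periodic sphere_P_nonconstant
  by (intro exI[of _ a] exI[of _ a] exI[of _ b] exI[of _ "sphere_P s"]) auto

lemma sphere_P_relation:
  assumes c: "c \<noteq> 0" and s: "s\<^sup>2 = c"
    and prod: "\<And>z. z \<notin> lattice a \<Longrightarrow> z + \<eta> a t \<notin> lattice a \<Longrightarrow> PP (z + \<eta> a t) * PP z = c"
    and rel: "\<And>z. z \<notin> lattice a \<Longrightarrow> z + \<eta> a t \<notin> lattice a \<Longrightarrow> a\<^sup>2 * PP (a * z) = PP z + PP (z + \<eta> a t) + k"
  shows "qmap 1 (k / s) 1 0 (a\<^sup>2) 0 (sphere_P s z) = sphere_P s (a * z)"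
proof -
  have a0: "a \<noteq> 0" and s0: "s \<noteq> 0" using a_im c s by auto
  have nd: "nondeg 1 (k / s) 1 0 (a\<^sup>2) 0" using a0 by (intro nondeg_joukowski) simp
  have pre: "a * z \<in> lattice a \<longleftrightarrow> z \<in> lattice a \<or> z + \<eta> a t \<in> lattice a"
    by (rule a_preimage_lattice[OF a_im a_sq])
  consider "z \<in> lattice a" | "z \<notin> lattice a" "z + \<eta> a t \<in> lattice a" | "z \<notin> lattice a" "z + \<eta> a t \<notin> lattice a" by blast
  then show ?thesis
  proof cases
    case 1
    then show ?thesis using pre qmap_pt[OF nd, of 1 0] by (simp add: sphere_P_def Infty_pt qform_def)
  next
    case 2
    have "z - - \<eta> a t \<in> lattice a" using 2 by simp
    then have "PP z = PP (- \<eta> a t)" by (rule shifted_wp_congruent[OF a_im a_sq])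
    then have "PP z = 0" by (simp only: shifted_wp_neg[OF a_im a_sq] shifted_wp_eta[OF a_im a_sq])
    then show ?thesis using 2 pre qmap_pt[OF nd, of 0 s] s0 by (simp add: sphere_P_def qform_def) (simp add: pt_def)
  next
    case 3
    note pr = prod[OF 3] and re = rel[OF 3]
    have Pz: "PP z \<noteq> 0" using pr c by auto
    have "qmap 1 (k / s) 1 0 (a\<^sup>2) 0 (pt (PP z) s) = pt (qform 1 (k / s) 1 (PP z) s) (qform 0 (a\<^sup>2) 0 (PP z) s)"
      using s0 by (intro qmap_pt[OF nd]) simp
    also have "\<dots> = pt (PP (a * z)) s"
    proof -
      have "qform 1 (k / s) 1 (PP z) s = PP z * (PP z + PP (z + \<eta> a t) + k)"
        using s0 pr s by (simp add: qform_def algebra_simps power2_eq_square)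
      also have "\<dots> = PP z * (a\<^sup>2 * PP (a * z))" using re by simp
      finally show ?thesis using s0 a0 Pz by (simp add: pt_def qform_def)
    qed
    finally show ?thesis using 3 pre by (simp add: sphere_P_def)
  qed
qed

theorem even_trace_semiconjugacy:
  assumes "even t" and "\<kappa>\<^sup>2 = 4 + a^4"
  obtains s where "s \<noteq> 0" "\<And>z. qmap 1 \<kappa> 1 0 (a\<^sup>2) 0 (sphere_P s z) = sphere_P s (a * z)"
proof -
  obtain c k where ck: "c \<noteq> 0 \<and> k\<^sup>2 = (4 + a^4) * c \<and> (\<forall>z. z \<notin> lattice a \<longrightarrow> z + \<eta> a t \<notin> lattice a \<longrightarrow>
     PP (z + \<eta> a t) * PP z = c \<and> a\<^sup>2 * PP (a * z) = PP z + PP (z + \<eta> a t) + k)"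
    using even_trace_relation[OF a_im a_sq assms(1)] by blast
  then have c: "c \<noteq> 0" and kc: "k\<^sup>2 = (4 + a^4) * c"
    and prod: "\<And>z. z \<notin> lattice a \<Longrightarrow> z + \<eta> a t \<notin> lattice a \<Longrightarrow> PP (z + \<eta> a t) * PP z = c"
    and rel: "\<And>z. z \<notin> lattice a \<Longrightarrow> z + \<eta> a t \<notin> lattice a \<Longrightarrow> a\<^sup>2 * PP (a * z) = PP z + PP (z + \<eta> a t) + k"
    by simp_all
  have "(k / csqrt c)\<^sup>2 = \<kappa>\<^sup>2" using kc assms(2) c by (simp add: power_divide)
  then have "k / csqrt c = \<kappa> \<or> k / (- csqrt c) = \<kappa>" by (auto simp: power2_eq_iff)
  then obtain s where s: "k / s = \<kappa>" "s\<^sup>2 = c" by (metis power2_csqrt power2_minus)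
  then have "qmap 1 \<kappa> 1 0 (a\<^sup>2) 0 (sphere_P s z) = sphere_P s (a * z)" for z
    using sphere_P_relation[OF c s(2) prod rel] by simp
  moreover have "s \<noteq> 0" using s c by auto
  ultimately show ?thesis using that by blast
qed

corollary even_trace_uniformized:
  assumes "even t" and "\<kappa>\<^sup>2 = 4 + a^4"
  shows "uniformized (qmap 1 \<kappa> 1 0 (a\<^sup>2) 0)"
proof -
  obtain s where "s \<noteq> 0" "\<And>z. qmap 1 \<kappa> 1 0 (a\<^sup>2) 0 (sphere_P s z) = sphere_P s (a * z)"
    using even_trace_semiconjugacy[OF assms] by blast
  then show ?thesis by (intro uniformizedI[of s _ 0]) auto
qed

text \<open>
  Over the Gaussian integers multiplication by \<open>i\<close> changes the sign of \<open>\<wp>\<close>, so squaring gives a further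
  quotient of the torus; the map \<open>(z + 1 / z) / a\<^sup>2\<close> is odd and descends.
\<close>

lemma squaring_quotient_uniformized:
  assumes "even t" and "a^4 = - 4"
  shows "uniformized (qmap 1 2 1 0 (- 4) 0)"
proof -
  obtain s where s: "s \<noteq> 0" and eq: "\<And>z. qmap 1 0 1 0 (a\<^sup>2) 0 (sphere_P s z) = sphere_P s (a * z)"
    using even_trace_semiconjugacy[OF assms(1), of 0] assms(2) by auto
  define S where "S = qmap 0 0 1 1 0 0"
  have ndS: "nondeg 0 0 1 1 0 0" by (simp add: nondeg_def qform_def)
  have S: "S (pt u v) = pt (u\<^sup>2) (v\<^sup>2)" if "u \<noteq> 0 \<or> v \<noteq> 0" for u v
    using qmap_pt[OF ndS that] by (simp add: S_def qform_def)
  have a0: "a \<noteq> 0" using a_im by auto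
  have nd1: "nondeg 1 0 1 0 (a\<^sup>2) 0" "nondeg 1 2 1 0 (- 4) 0"
    using a0 by (intro nondeg_joukowski; simp)+
  have comm: "qmap 1 2 1 0 (- 4) 0 (S x) = S (qmap 1 0 1 0 (a\<^sup>2) 0 x)" for x
  proof -
    obtain u v where x: "u \<noteq> 0 \<or> v \<noteq> 0" "x = pt u v" by (rule pt_cases)
    have 1: "qform 1 0 1 u v \<noteq> 0 \<or> qform 0 (a\<^sup>2) 0 u v \<noteq> 0" using nd1(1) x(1) unfolding nondeg_def by blast
    have 2: "u\<^sup>2 \<noteq> 0 \<or> v\<^sup>2 \<noteq> 0" using x(1) by simp
    have "(a * a * (u * v))\<^sup>2 = a^4 * (u\<^sup>2 * v\<^sup>2)" by (simp add: power2_eq_square power4_eq_xxxx mult_ac)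
    then show ?thesis
      using qmap_pt[OF nd1(1) x(1)] qmap_pt[OF nd1(2) 2] S[OF x(1)] S[OF 1] x(2) assms(2)
      by (simp add: qform_def power2_eq_square algebra_simps)
  qed
  \<comment> \<open>The quotient by the group of order four: it identifies \<open>z\<close> with \<open>i z\<close>.\<close>
  define g where "g = (\<lambda>z. S (sphere_P s z))"
  have hol: "sphere_holomorphic g"
    unfolding g_def using S
    by (intro sphere_holomorphic_compose[OF sphere_P_holomorphic[OF s], where p = "\<lambda>u v. u\<^sup>2" and q = "\<lambda>u v. v\<^sup>2"])
      (auto intro!: holomorphic_intros)
  have "g 0 \<noteq> g (\<eta> a t)"
    using eta_notin[OF a_im a_sq] lattice_0[of a] S[of 1 0] S[of 0 s] s shifted_wp_eta[OF a_im a_sq]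
    by (simp add: g_def sphere_P_def Infty_pt) (simp add: pt_def)
  moreover have "qmap 1 2 1 0 (- 4) 0 (g z) = g (a * z + 0)" for z by (simp add: g_def comm eq)
  moreover have "g (z + w) = g z" if "w \<in> lattice a" for z w
    using sphere_P_periodic[OF that] by (simp add: g_def)
  ultimately show ?thesis
    unfolding uniformized_def using a_im a_lattice[OF a_im a_sq] hol
    by (intro exI[of _ a] exI[of _ a] exI[of _ 0] exI[of _ g]) auto
qed

text \<open>
  The second map is the first one followed by the Moebius involution induced by \<open>z \<mapsto> z + 1 / 2\<close>; it
  comes from the affine map \<open>a z + 1 / 2\<close>.
\<close>

theorem odd_trace_uniformized:
  assumes "odd t"
  shows "uniformized (qmap 1 2 1 0 (a\<^sup>2) 0)"
    "uniformized (qmap (4 / a\<^sup>2) (8 / a\<^sup>2 - a\<^sup>2) (4 / a\<^sup>2) 1 (- 2) 1)"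
proof -
  let ?h = "1 / 2 :: complex"
  obtain c k where ck: "c \<noteq> 0 \<and> k\<^sup>2 = 4 * c \<and> a\<^sup>2 * PP ?h = 2 * k \<and> (PP ?h)\<^sup>2 \<noteq> c \<and>
    (\<forall>z. z \<notin> lattice a \<longrightarrow> z + \<eta> a t \<notin> lattice a \<longrightarrow>
      PP (z + \<eta> a t) * PP z = c \<and> a\<^sup>2 * PP (a * z) = PP z + PP (z + \<eta> a t) + k) \<and>
    (\<forall>z. z \<notin> lattice a \<longrightarrow> z + ?h \<notin> lattice a \<longrightarrow>
      (PP (z + ?h) - PP ?h) * (PP z - PP ?h) = (PP ?h)\<^sup>2 - c)"
    using odd_trace_relation[OF a_im a_sq assms] by blast
  then have c: "c \<noteq> 0" and kc: "k\<^sup>2 = 4 * c" and half: "a\<^sup>2 * PP ?h = 2 * k" and hc: "(PP ?h)\<^sup>2 \<noteq> c"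
    by simp_all
  have prod: "\<And>z. z \<notin> lattice a \<Longrightarrow> z + \<eta> a t \<notin> lattice a \<Longrightarrow> PP (z + \<eta> a t) * PP z = c"
    and rel: "\<And>z. z \<notin> lattice a \<Longrightarrow> z + \<eta> a t \<notin> lattice a \<Longrightarrow> a\<^sup>2 * PP (a * z) = PP z + PP (z + \<eta> a t) + k"
    and prod': "\<And>z. z \<notin> lattice a \<Longrightarrow> z + ?h \<notin> lattice a \<Longrightarrow> (PP (z + ?h) - PP ?h) * (PP z - PP ?h) = (PP ?h)\<^sup>2 - c"
    using ck by blast+
  define s where "s = k / 2"
  have s: "s\<^sup>2 = c" "k / s = 2" "s \<noteq> 0" using kc c by (auto simp: s_def power2_eq_square)
  have F: "qmap 1 2 1 0 (a\<^sup>2) 0 (sphere_P s z) = sphere_P s (a * z)" for z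
    using sphere_P_relation[OF c s(1) prod rel, of z] s(2) by simp
  then show "uniformized (qmap 1 2 1 0 (a\<^sup>2) 0)" using s(3) by (intro uniformizedI[of s _ 0]) auto
  have a0: "a \<noteq> 0" using a_im by auto
  define E where "E = 4 / a\<^sup>2"
  have PE: "PP ?h = E * s" using half a0 by (simp add: E_def s_def field_simps)
  have E1: "E * E \<noteq> 1" using hc unfolding PE s(1)[symmetric] by (auto simp: power2_eq_square)
  have det: "E * (- E) - (- 1) * 1 \<noteq> 0" using E1 by auto
  have T: "mob E (- 1) 1 (- E) (sphere_P s z) = sphere_P s (z + ?h)" for z
  proof -
    have h: "?h \<notin> lattice a" using half_not_lattice[OF a_im, of 1 0] by simp
    have two: "?h + ?h \<in> lattice a" using lattice_1 by simp
    have nd: "(E \<noteq> 0 \<or> 1 \<noteq> (0::complex))" by simp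
    consider "z \<in> lattice a" | "z \<notin> lattice a" "z + ?h \<in> lattice a" | "z \<notin> lattice a" "z + ?h \<notin> lattice a" by blast
    then show ?thesis
    proof cases
      case 1
      have "?h + z \<notin> lattice a" using lattice_diff[of "?h + z" a z] 1 h by auto
      moreover have "PP (?h + z) = PP ?h" by (rule shifted_wp_per[OF a_im a_sq 1])
      ultimately show ?thesis using 1 mob_pt[OF det, of 1 0] s(3)
        by (simp add: sphere_P_def add.commute Infty_pt PE) (simp add: pt_def)
    next
      case 2
      have "z - ?h \<in> lattice a" using lattice_diff[OF 2(2) two] by simp
      then have "PP z = E * s" using shifted_wp_congruent[OF a_im a_sq, of z ?h] PE by simp
      then show ?thesis using 2 mob_pt[OF det, of "E * s" s] s(3) E1
        by (simp add: sphere_P_def) (simp add: pt_def)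
    next
      case 3
      have pr: "(PP (z + ?h) - E * s) * (PP z - E * s) = (E * E - 1) * s\<^sup>2"
        using prod'[OF 3] unfolding PE s(1)[symmetric] by (simp add: algebra_simps power2_eq_square)
      have ne: "PP z - E * s \<noteq> 0" using pr E1 s(3) by auto
      have "PP (z + ?h) * (PP z - E * s) = s * (E * PP z - s)"
        using pr by (simp add: algebra_simps power2_eq_square)
      then have "pt (E * PP z + (- 1) * s) (1 * PP z + (- E) * s) = pt (PP (z + ?h)) s"
        using ne s(3) by (subst pt_eq_iff) (auto simp: mult.commute)
      then show ?thesis using 3 mob_pt[OF det, of "PP z" s] s(3) by (simp add: sphere_P_def)
    qed
  qed
  have nd: "nondeg 1 2 1 0 (a\<^sup>2) 0" using a0 by (intro nondeg_joukowski) simp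
  have nd': "nondeg E (2 * E - a\<^sup>2) E 1 (- 2) 1"
    unfolding nondeg_def
  proof (intro allI impI)
    fix u v :: complex assume "u \<noteq> 0 \<or> v \<noteq> 0"
    then show "qform E (2 * E - a\<^sup>2) E u v \<noteq> 0 \<or> qform 1 (- 2) 1 u v \<noteq> 0"
    proof (rule contrapos_pp)
      assume "\<not> (qform E (2 * E - a\<^sup>2) E u v \<noteq> 0 \<or> qform 1 (- 2) 1 u v \<noteq> 0)"
      then have z: "qform E (2 * E - a\<^sup>2) E u v = 0" "(u - v)\<^sup>2 = 0"
        by (auto simp: qform_def power2_eq_square algebra_simps)
      then have uv: "u = v" by simp
      have "(4 * E - a\<^sup>2) * u\<^sup>2 = 0" using z(1) uv by (simp add: qform_def algebra_simps power2_eq_square)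
      moreover have "4 * E - a\<^sup>2 \<noteq> 0"
      proof
        assume "4 * E - a\<^sup>2 = 0"
        then have "a\<^sup>2 = 4 * E" by simp
        then have "E * (4 * E) = 4" using a0 by (simp add: E_def)
        then show False using E1 by simp
      qed
      ultimately show "\<not> (u \<noteq> 0 \<or> v \<noteq> 0)" using uv by simp
    qed
  qed
  have comp: "qmap E (2 * E - a\<^sup>2) E 1 (- 2) 1 x = mob E (- 1) 1 (- E) (qmap 1 2 1 0 (a\<^sup>2) 0 x)" for x
  proof -
    obtain u v where x: "u \<noteq> 0 \<or> v \<noteq> 0" "x = pt u v" by (rule pt_cases)
    have nz: "qform 1 2 1 u v \<noteq> 0 \<or> qform 0 (a\<^sup>2) 0 u v \<noteq> 0" using nd x(1) unfolding nondeg_def by blast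
    have aE: "a\<^sup>2 * E = 4" using a0 by (simp add: E_def)
    have "E * qform 1 2 1 u v + (- 1) * qform 0 (a\<^sup>2) 0 u v = qform E (2 * E - a\<^sup>2) E u v"
      by (simp add: qform_def algebra_simps)
    moreover have "1 * qform 1 2 1 u v + (- E) * qform 0 (a\<^sup>2) 0 u v = qform 1 (- 2) 1 u v"
    proof -
      have "E * qform 0 (a\<^sup>2) 0 u v = (a\<^sup>2 * E) * (u * v)" by (simp add: qform_def)
      then show ?thesis unfolding aE by (simp add: qform_def algebra_simps)
    qed
    ultimately show ?thesis
      using qmap_pt[OF nd' x(1)] qmap_pt[OF nd x(1)] mob_pt[OF det nz] x(2) by simp
  qed
  have "qmap E (2 * E - a\<^sup>2) E 1 (- 2) 1 (sphere_P s z) = sphere_P s (a * z + ?h)" for z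
    unfolding comp F T ..
  then have "uniformized (qmap E (2 * E - a\<^sup>2) E 1 (- 2) 1)" using s(3) by (intro uniformizedI[of s _ ?h]) auto
  then show "uniformized (qmap (4 / a\<^sup>2) (8 / a\<^sup>2 - a\<^sup>2) (4 / a\<^sup>2) 1 (- 2) 1)" by (simp add: E_def)
qed

end

section \<open>Conjugacies between models\<close>

lemma quadratic_swap:
  assumes "p * q \<noteq> 1"
  shows "conjugate (quadratic p q 0 1) (quadratic q p 0 1)"
proof -
  have "q * p \<noteq> 1" using assms by (simp add: mult.commute)
  then show ?thesis unfolding quadratic_def
    by (intro conjugate_qmap(2)[OF nondeg_quadratic[OF assms] nondeg_quadratic, of q p 0 0 1 1])
      (simp_all add: qform_def algebra_simps power2_eq_square)
qed

text \<open>
  Besides \<open>0\<close> and \<open>\<infinity>\<close> the map fixes \<open>(1 - p) / (1 - q)\<close>, with the multiplier \<open>r\<close> of the fixed point formula; the Moebius map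
  used here keeps \<open>0\<close> and moves that point to \<open>\<infinity>\<close>.
\<close>

lemma quadratic_third_fixed_point:
  assumes "p * q \<noteq> 1" "p \<noteq> 1" "q \<noteq> 1"
  defines "r \<equiv> (2 - p - q) / (1 - p * q)"
  shows "p * r \<noteq> 1" "conjugate (quadratic p q 0 1) (quadratic p r 0 1)"
proof -
  have e: "1 - p * q \<noteq> 0" using assms by simp
  then have r: "r * (1 - p * q) = 2 - p - q" by (simp add: r_def)
  have "(1 - p * r) * (1 - p * q) = (1 - p)\<^sup>2"
    using r by algebra
  then show pr: "p * r \<noteq> 1" using assms(2) by auto
  show "conjugate (quadratic p q 0 1) (quadratic p r 0 1)"
    unfolding quadratic_def
  proof (rule conjugate_qmap(2)[OF nondeg_quadratic[OF assms(1)] nondeg_quadratic[OF pr], of "1 - p * q" "1 - p" 0 "- (1 - q)"])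
    show "(1 - p * q) * (1 - p) - 0 * - (1 - q) \<noteq> 0" using e assms by simp
    fix u v
    show "((1 - p * q) * qform (of_int 0) p 1 u v + 0 * qform (of_int 1) q 0 u v) *
      qform (of_int 1) r 0 ((1 - p * q) * u + 0 * v) (- (1 - q) * u + (1 - p) * v) =
      (- (1 - q) * qform (of_int 0) p 1 u v + (1 - p) * qform (of_int 1) q 0 u v) *
      qform (of_int 0) p 1 ((1 - p * q) * u + 0 * v) (- (1 - q) * u + (1 - p) * v)"
      using r unfolding qform_def of_int_0 of_int_1 by algebra
  qed
qed

text \<open>
  Up to a Moebius map, a quadratic map is determined by one fixed point and the involution that
  exchanges the two preimages of each point. Putting the fixed point at \<open>\<infinity>\<close>, its other preimage at \<open>0\<close> and the
  critical points at \<open>\<plusminus> 1\<close> gives \<open>(z + 1 / z + \<kappa>) / q\<close>; the sign of \<open>\<kappa>\<close> depends on the order of the critical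
  points.
\<close>

lemma quadratic_joukowski:
  assumes "p * q \<noteq> 1" "q \<noteq> 0" "\<kappa>\<^sup>2 * (1 - p * q) = (q * (p + 1) - 2)\<^sup>2"
  shows "conjugate (quadratic p q 0 1) (qmap 1 \<kappa> 1 0 q 0)"
proof -
  have "(\<kappa> * csqrt (1 - p * q))\<^sup>2 = (q * (p + 1) - 2)\<^sup>2"
    using assms(3) by (simp add: power_mult_distrib)
  then have "\<kappa> * csqrt (1 - p * q) = q * (p + 1) - 2 \<or> \<kappa> * (- csqrt (1 - p * q)) = q * (p + 1) - 2"
    by (auto simp: power2_eq_iff)
  then obtain s where s: "s\<^sup>2 = 1 - p * q" "\<kappa> * s = q * (p + 1) - 2"
    by (metis power2_csqrt power2_minus)
  have s0: "s \<noteq> 0" using s(1) assms(1) by auto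
  show ?thesis
    unfolding quadratic_def
  proof (rule conjugate_qmap(2)[OF nondeg_quadratic[OF assms(1)] nondeg_joukowski[OF assms(2)], of q s 1 0])
    show "q * s - 1 * 0 \<noteq> 0" using s0 assms by simp
    fix u v
    show "(q * qform (of_int 0) p 1 u v + 1 * qform (of_int 1) q 0 u v) *
      qform 0 q 0 (q * u + 1 * v) (0 * u + s * v) =
      (0 * qform (of_int 0) p 1 u v + s * qform (of_int 1) q 0 u v) *
      qform 1 \<kappa> 1 (q * u + 1 * v) (0 * u + s * v)"
      using s unfolding qform_def of_int_0 of_int_1 by algebra
  qed
qed

lemma square_power_map:
  assumes "rational_map 2 f" "conjugate f (quadratic p 0 0 1)" "p = 0 \<or> p = 2"
  shows "power_map f"
proof -
  have sq: "rat_fun (monom 1 2) 1 = qmap 0 0 1 1 0 0"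
    by (simp add: qmap_def monom_altdef numeral_2_eq_2 one_pCons)
  have nd: "nondeg (of_int 0) 0 1 (of_int 1) 0 0" "nondeg (of_int 0) 2 1 (of_int 1) 0 0"
    using nondeg_quadratic[of 0 0] nondeg_quadratic[of 2 0] by simp_all
  have "conjugate (quadratic 2 0 0 1) (qmap (of_int 0) 0 1 (of_int 1) 0 0)"
    unfolding quadratic_def
    by (rule conjugate_qmap(2)[OF nd(2,1), of 1 1 1 0]) (simp_all add: qform_def power2_eq_square algebra_simps)
  then have "conjugate f (qmap 0 0 1 1 0 0)"
    using assms conjugate_trans by (auto simp: quadratic_def)
  then show ?thesis unfolding power_map_def using assms(1) sq by (intro exI[of _ 2]) simp
qed

lemma inverse_square_power_map:
  assumes "rational_map 2 f" "conjugate f (quadratic (- 2) (- 2) 0 1)"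
  shows "power_map f"
proof -
  have inv: "rat_fun 1 (monom 1 2) = qmap 1 0 0 0 0 1"
    by (simp add: qmap_def monom_altdef numeral_2_eq_2 one_pCons)
  have nd: "nondeg 1 0 0 0 0 1" by (simp add: nondeg_def qform_def)
  have 1: "conjugate (quadratic (- 2) (- 2) 0 1) (qmap 1 0 1 0 (- 2) 0)"
    by (rule quadratic_joukowski) simp_all
  have "conjugate (qmap 1 0 1 0 (- 2) 0) (qmap 1 0 0 0 0 1)"
    by (intro conjugate_qmap(2)[OF nondeg_joukowski nd, of "- 2" 1 1 "- 1" 1])
      (simp_all add: qform_def power2_eq_square algebra_simps)
  then have "conjugate f (qmap 1 0 0 0 0 1)"
    using assms(2) 1 conjugate_trans by blast
  then show ?thesis unfolding power_map_def using assms(1) inv by (intro exI[of _ 2]) simp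
qed

lemma chebyshev_poly_2: "chebyshev_poly 2 = [:- 2, 0, 1:]"
proof -
  have "\<forall>z::complex. z \<noteq> 0 \<longrightarrow> poly [:- 2, 0, 1:] (z + inverse z) = z ^ 2 + inverse z ^ 2"
    by (auto simp: field_simps power2_eq_square)
  then show ?thesis
    using poly_chebyshev_poly chebyshev_poly_ex1[of 2] by blast
qed

lemma quadratic_chebyshev_map:
  assumes "rational_map 2 f" "conjugate f (quadratic p 0 0 1)" "p = 4 \<or> p = - 2"
  shows "chebyshev_map f"
proof -
  have T: "rat_fun (chebyshev_poly 2) 1 = qmap (- 2) 0 1 1 0 0"
    by (simp add: chebyshev_poly_2 qmap_def one_pCons)
  have nd: "nondeg (of_int 0) p 1 (of_int 1) 0 0" "nondeg (- 2) 0 1 1 0 0"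
    using nondeg_quadratic[of p 0] by simp (auto simp: nondeg_def qform_def)
  have "conjugate (quadratic p 0 0 1) (qmap (- 2) 0 1 1 0 0)"
    unfolding quadratic_def
    by (rule conjugate_qmap(2)[OF nd, of 1 1 "p / 2" 0])
      (use assms(3) in \<open>auto simp: qform_def power2_eq_square algebra_simps\<close>)
  then have "conjugate f (qmap (- 2) 0 1 1 0 0)" using assms(2) conjugate_trans by blast
  then show ?thesis unfolding chebyshev_map_def using assms(1) T by (intro exI[of _ 2]) simp
qed

lemma joukowski_lattes_map:
  assumes "rational_map 2 f" "conjugate f (quadratic p q 0 1)"
    and "p * q \<noteq> 1" "q \<noteq> 0" "\<kappa>\<^sup>2 * (1 - p * q) = (q * (p + 1) - 2)\<^sup>2"
    and "uniformized (qmap 1 \<kappa> 1 0 q 0)"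
  shows "lattes_map f"
proof -
  have "conjugate f (qmap 1 \<kappa> 1 0 q 0)"
    using quadratic_joukowski[OF assms(3-5)] assms(2) conjugate_trans by blast
  then show ?thesis
    using uniformized_lattes_map[OF assms(1)] uniformized_conjugate[OF conjugate_sym] assms(6) by blast
qed

text \<open>
  For \<open>a\<^sup>2 = a - 2\<close> the map induced by \<open>a z + 1 / 2\<close> has a fixed point with multiplier \<open>a\<close>; moving that point
  to \<open>\<infinity>\<close> gives the map below.
\<close>

lemma trace_one_joukowski_uniformized:
  assumes im: "Im a \<noteq> 0" and sq: "a\<^sup>2 = a - 2"
  shows "uniformized (qmap 1 0 1 0 a 0)"
proof -
  have sq': "a\<^sup>2 = of_int 1 * a - 2" using sq by simp
  let ?f = "qmap (4 / a\<^sup>2) (8 / a\<^sup>2 - a\<^sup>2) (4 / a\<^sup>2) 1 (- 2) 1"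
  have u: "uniformized ?f"
    using odd_trace_uniformized(2)[OF im sq'] by simp
  have a0: "a \<noteq> 0" using im by auto
  define E where "E = 4 / a\<^sup>2"
  have E: "E * a\<^sup>2 = 4" using a0 by (simp add: E_def)
  have lin: "of_int m + of_int n * a \<noteq> 0" if "n \<noteq> 0" for m n :: int
  proof
    assume "of_int m + of_int n * a = 0"
    then have "Im (of_int m + of_int n * a) = 0" by simp
    then show False using im that by simp
  qed
  have "4 * E - a\<^sup>2 \<noteq> 0"
  proof
    assume "4 * E - a\<^sup>2 = 0"
    then have "16 - a\<^sup>2 * a\<^sup>2 = 0" using E by algebra
    then have "14 + 3 * a = 0" using sq by algebra
    then show False using lin[of 3 14] by simp
  qed
  then have nd: "nondeg E (2 * E - a\<^sup>2) E 1 (- 2) 1"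
    unfolding nondeg_def
  proof (intro allI impI)
    fix u v :: complex assume h: "4 * E - a\<^sup>2 \<noteq> 0" "u \<noteq> 0 \<or> v \<noteq> 0"
    show "qform E (2 * E - a\<^sup>2) E u v \<noteq> 0 \<or> qform 1 (- 2) 1 u v \<noteq> 0"
    proof (rule ccontr)
      assume "\<not> ?thesis"
      then have z: "qform E (2 * E - a\<^sup>2) E u v = 0" "(u - v)\<^sup>2 = 0"
        by (auto simp: qform_def power2_eq_square algebra_simps)
      then have uv: "u = v" by simp
      have "(4 * E - a\<^sup>2) * u\<^sup>2 = 0" using z(1) uv by (simp add: qform_def algebra_simps power2_eq_square)
      then show False using h uv by simp
    qed
  qed
  have "conjugate (qmap E (2 * E - a\<^sup>2) E 1 (- 2) 1) (qmap 1 0 1 0 a 0)"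
  proof (rule conjugate_qmap(2)[OF nd nondeg_joukowski[OF a0], of "(2 - a) * 2" "(2 + a) * (1 - a)" "(2 - a) * a" "2 + a"])
    have "(2 - a) * 2 * ((2 + a) * (1 - a)) - (2 - a) * a * (2 + a) = (2 - a) * (2 + a) * (2 - 3 * a)"
      by (simp add: algebra_simps)
    moreover have "2 - a \<noteq> 0" "2 + a \<noteq> 0" "2 - 3 * a \<noteq> 0"
      using lin[of "-1" 2] lin[of 1 2] lin[of "-3" 2] by simp_all
    ultimately show "(2 - a) * 2 * ((2 + a) * (1 - a)) - (2 - a) * a * (2 + a) \<noteq> 0" by simp
    fix u v
    show "((2 - a) * 2 * qform E (2 * E - a\<^sup>2) E u v + (2 - a) * a * qform 1 (- 2) 1 u v) *
      qform 0 a 0 ((2 - a) * 2 * u + (2 - a) * a * v) ((2 + a) * u + (2 + a) * (1 - a) * v) =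
      ((2 + a) * qform E (2 * E - a\<^sup>2) E u v + (2 + a) * (1 - a) * qform 1 (- 2) 1 u v) *
      qform 1 0 1 ((2 - a) * 2 * u + (2 - a) * a * v) ((2 + a) * u + (2 + a) * (1 - a) * v)"
    proof -
      have "- (a + 1) * a\<^sup>2 = 4" using sq by algebra
      then have E': "E = - (a + 1)" using E a0 by (metis mult_right_cancel power_not_zero)
      show ?thesis unfolding E' qform_def using sq by algebra
    qed
  qed
  moreover have "qmap E (2 * E - a\<^sup>2) E 1 (- 2) 1 = ?f" by (simp add: E_def)
  ultimately show ?thesis using u uniformized_conjugate by metis
qed

section \<open>The ring of integers of an imaginary quadratic field\<close>

text \<open>
  If all powers of a rational have a common denominator, its own denominator is 1.
\<close>

lemma Rats_bounded_denominator:
  fixes r :: real and N :: int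
  assumes "r \<in> \<rat>" "N \<noteq> 0" and "\<And>j. of_int N * r ^ j \<in> \<int>"
  shows "r \<in> \<int>"
proof -
  obtain u v :: int where uv: "v > 0" "coprime u v" "r = of_int u / of_int v"
    using assms(1) by (rule Rats_cases') auto
  have "v ^ j dvd N" for j
  proof -
    obtain k where k: "of_int N * r ^ j = of_int k" using assms(3)[of j] by (auto elim: Ints_cases)
    then have "real_of_int (N * u ^ j) = of_int (k * v ^ j)"
      using uv(1) unfolding uv(3) by (simp add: power_divide field_simps)
    then have "N * u ^ j = k * v ^ j" by (simp only: of_int_eq_iff)
    then have "v ^ j dvd u ^ j * N" by (simp add: mult.commute)
    moreover have "coprime (v ^ j) (u ^ j)" using uv(2) by (simp add: coprime_commute)
    ultimately show ?thesis using coprime_dvd_mult_right_iff by blast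
  qed
  then have "v ^ nat \<bar>N\<bar> \<le> \<bar>N\<bar>" using assms(2) by (meson abs_ge_self dvd_imp_le_int order_trans)
  moreover have "\<bar>N\<bar> < 2 ^ nat \<bar>N\<bar>"
    using of_nat_less_two_power[of "nat \<bar>N\<bar>", where 'a = int] by simp
  moreover have "(2::int) ^ nat \<bar>N\<bar> \<le> v ^ nat \<bar>N\<bar>" if "v \<ge> 2" using that by (intro power_mono) auto
  ultimately have "v = 1" using uv(1) by linarith
  then show ?thesis using uv(3) by simp
qed

lemma squarefree_dvd_square:
  fixes D m :: nat
  assumes "squarefree D" "D dvd m\<^sup>2"
  shows "D dvd m"
proof -
  have D: "D \<noteq> 0" using assms(1) by (metis not_squarefree_0)
  define g where "g = gcd D m"
  have g: "g \<noteq> 0" using D by (simp add: g_def)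
  have "g dvd D" "g dvd m" by (simp_all add: g_def)
  obtain D' where d1: "D = g * D'" using \<open>g dvd D\<close> by (rule dvdE)
  obtain m' where d2: "m = g * m'" using \<open>g dvd m\<close> by (rule dvdE)
  note d = d1 d2
  have "coprime D' m'" using gcd_coprime[of D m D' m'] g d1 d2 unfolding g_def by (metis mult.commute)
  then have c: "coprime D' (m'\<^sup>2)" by simp
  have "g * D' dvd g * (g * m'\<^sup>2)" using assms(2) unfolding d by (simp add: power2_eq_square mult_ac)
  then have "D' dvd g * m'\<^sup>2" using g by simp
  then have "D' dvd g" using c by (simp add: coprime_dvd_mult_left_iff)
  then have "D'\<^sup>2 dvd D" unfolding d power2_eq_square by (rule mult_dvd_mono) simp
  then have "D' dvd 1" using assms(1) squarefreeD by blast
  then show ?thesis using d by simp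
qed

lemma algebraic_int_of_square: "algebraic_int (x\<^sup>2) \<Longrightarrow> algebraic_int x"
  by (rule algebraic_int_root[of "x\<^sup>2" "monom 1 2"]) (auto simp: poly_monom degree_monom_eq)

lemma field_iff:
  assumes "D > 0"
  shows "x \<in> imag_quadratic_field D \<longleftrightarrow> Re x \<in> \<rat> \<and> Im x * sqrt (real D) \<in> \<rat>"
proof
  assume "x \<in> imag_quadratic_field D"
  then obtain a b where "x = of_rat a + of_rat b * (\<i> * of_real (sqrt (real D)))"
    unfolding imag_quadratic_field_def by blast
  moreover have e: "(of_rat q :: complex) = of_real (of_rat q)" for q by (cases q) (simp add: of_rat_rat)
  ultimately have "Re x = of_rat a" "Im x = of_rat b * sqrt (real D)" by (simp_all add: e)
  then show "Re x \<in> \<rat> \<and> Im x * sqrt (real D) \<in> \<rat>" by (simp add: mult.assoc)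
next
  assume "Re x \<in> \<rat> \<and> Im x * sqrt (real D) \<in> \<rat>"
  then obtain a b where ab: "Re x = of_rat a" "Im x * sqrt (real D) = of_rat b" by (auto elim!: Rats_cases)
  have e: "(of_rat q :: complex) = of_real (of_rat q)" for q by (cases q) (simp add: of_rat_rat)
  have "of_rat (b / of_nat D) * sqrt (real D) = Im x"
  proof -
    have "of_rat (b / of_nat D) * sqrt (real D) = Im x * (sqrt (real D) * sqrt (real D)) / real D"
      by (simp add: of_rat_divide ab(2)[symmetric] mult.assoc)
    then show ?thesis using assms by simp
  qed
  then have "x = of_rat a + of_rat (b / of_nat D) * (\<i> * of_real (sqrt (real D)))"
    using ab(1) by (simp add: e complex_eq_iff)
  then show "x \<in> imag_quadratic_field D" unfolding imag_quadratic_field_def by blast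
qed

context
  fixes D :: nat
  assumes D0: "D > 0"
begin

lemma K_int: "of_int n \<in> imag_quadratic_field D" by (simp add: field_iff[OF D0])
lemma K_numeral: "numeral n \<in> imag_quadratic_field D" "1 \<in> imag_quadratic_field D" "0 \<in> imag_quadratic_field D" by (simp_all add: field_iff[OF D0])
lemma K_add: "x \<in> imag_quadratic_field D \<Longrightarrow> y \<in> imag_quadratic_field D \<Longrightarrow> x + y \<in> imag_quadratic_field D" by (simp add: field_iff[OF D0] distrib_right)
lemma K_minus: "x \<in> imag_quadratic_field D \<Longrightarrow> - x \<in> imag_quadratic_field D" by (simp add: field_iff[OF D0])
lemma K_diff: "x \<in> imag_quadratic_field D \<Longrightarrow> y \<in> imag_quadratic_field D \<Longrightarrow> x - y \<in> imag_quadratic_field D" by (simp add: field_iff[OF D0] left_diff_distrib)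
lemma K_cnj: "x \<in> imag_quadratic_field D \<Longrightarrow> cnj x \<in> imag_quadratic_field D" by (simp add: field_iff[OF D0])

lemma K_Im_mult: "x \<in> imag_quadratic_field D \<Longrightarrow> y \<in> imag_quadratic_field D \<Longrightarrow> Im x * Im y \<in> \<rat>"
proof -
  assume "x \<in> imag_quadratic_field D" "y \<in> imag_quadratic_field D"
  then have "(Im x * sqrt D) * (Im y * sqrt D) / real D \<in> \<rat>" by (auto simp: field_iff[OF D0])
  moreover have "(Im x * sqrt D) * (Im y * sqrt D) = Im x * Im y * (sqrt (real D) * sqrt (real D))" by (simp only: mult_ac)
  ultimately show ?thesis using D0 by simp
qed

lemma K_mult: "x \<in> imag_quadratic_field D \<Longrightarrow> y \<in> imag_quadratic_field D \<Longrightarrow> x * y \<in> imag_quadratic_field D"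
proof -
  assume x: "x \<in> imag_quadratic_field D" and y: "y \<in> imag_quadratic_field D"
  have "Im (x * y) * sqrt D = Re x * (Im y * sqrt D) + Im x * sqrt D * Re y" by (simp add: algebra_simps)
  then show ?thesis using x y K_Im_mult[OF x y] by (simp add: field_iff[OF D0])
qed

lemma K_inverse: "x \<in> imag_quadratic_field D \<Longrightarrow> inverse x \<in> imag_quadratic_field D"
proof -
  assume x: "x \<in> imag_quadratic_field D"
  have n: "(Re x)\<^sup>2 + (Im x)\<^sup>2 \<in> \<rat>"
    using x K_Im_mult[OF x x] by (simp add: field_iff[OF D0] power2_eq_square)
  have "Im (inverse x) * sqrt D = - (Im x * sqrt D) / ((Re x)\<^sup>2 + (Im x)\<^sup>2)" by simp
  then show ?thesis using x n by (simp add: field_iff[OF D0])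
qed

lemma K_divide: "x \<in> imag_quadratic_field D \<Longrightarrow> y \<in> imag_quadratic_field D \<Longrightarrow> x / y \<in> imag_quadratic_field D"
  by (simp add: divide_inverse K_mult K_inverse)

lemma K_power2: "x \<in> imag_quadratic_field D \<Longrightarrow> x\<^sup>2 \<in> imag_quadratic_field D" by (simp add: power2_eq_square K_mult)

lemma K_norm_rational: "x \<in> imag_quadratic_field D \<Longrightarrow> (cmod x)\<^sup>2 \<in> \<rat>"
  using K_Im_mult[of x x] unfolding cmod_power2 by (simp add: field_iff[OF D0] power2_eq_square)

text \<open>
  The powers of \<open>x\<close> span a finitely generated module, so they have a common denominator, and so have
  the powers of the norm.
\<close>

lemma algebraic_int_norm:
  assumes x: "x \<in> imag_quadratic_field D" and ai: "algebraic_int x"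
  shows "(cmod x)\<^sup>2 \<in> \<int>"
proof -
  define M where "M = (\<lambda>N::int. {z::complex. of_int N * Re z \<in> \<int> \<and> of_int N * (Im z * sqrt D) \<in> \<int>})"
  obtain p where p: "lead_coeff p = 1" "\<forall>i. coeff p i \<in> \<int>" "poly p x = 0"
    using ai by (auto elim: algebraic_int.cases)
  have K_pow: "x ^ j \<in> imag_quadratic_field D" for j by (induction j) (simp_all add: K_numeral K_mult x)
  have single: "\<exists>N>0. x ^ j \<in> M N" for j
  proof -
    have "Re (x ^ j) \<in> \<rat>" "Im (x ^ j) * sqrt D \<in> \<rat>" using K_pow by (auto simp: field_iff[OF D0])
    then obtain u v u' v' :: int where "v > 0" "Re (x ^ j) = of_int u / of_int v"
      "v' > 0" "Im (x ^ j) * sqrt D = of_int u' / of_int v'"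
      by (metis Rats_cases')
    then have "of_int (v * v') * Re (x ^ j) = of_int (v' * u)"
      "of_int (v * v') * (Im (x ^ j) * sqrt D) = of_int (v * u')" by simp_all
    then show ?thesis using \<open>v > 0\<close> \<open>v' > 0\<close> unfolding M_def
      by (intro exI[of _ "v * v'"]) (simp only: mem_Collect_eq Ints_of_int zero_less_mult_iff, simp)
  qed
  have mono: "M N \<subseteq> M (k * N)" for N k
    by (auto simp: M_def mult.assoc)
  have many: "\<exists>N>0. \<forall>j<d. x ^ j \<in> M N" for d
  proof (induction d)
    case 0
    then show ?case by (intro exI[of _ 1]) simp
  next
    case (Suc d)
    obtain N N' where "N > 0" "\<forall>j<d. x ^ j \<in> M N" "N' > 0" "x ^ d \<in> M N'" using Suc single by metis
    then have "\<forall>j<Suc d. x ^ j \<in> M (N * N')"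
      using mono[of N N'] mono[of N' N] by (auto simp: less_Suc_eq mult.commute)
    then show ?case using \<open>N > 0\<close> \<open>N' > 0\<close> by (intro exI[of _ "N * N'"]) simp
  qed
  define d where "d = degree p"
  obtain N where N: "N > 0" "\<forall>j<d. x ^ j \<in> M N" using many by blast
  have Msum: "sum f A \<in> M N" if "\<And>i. i \<in> A \<Longrightarrow> f i \<in> M N" for f and A :: "nat set"
    using that by (induction A rule: infinite_finite_induct) (auto simp: M_def distrib_left distrib_right)
  have Mint: "c * z \<in> M N" if c: "c \<in> \<int>" and z: "z \<in> M N" for c z
  proof -
    obtain k where "c = of_int k" using c by (rule Ints_cases)
    moreover have "of_int N * (of_int k * r) \<in> \<int>" if "of_int N * r \<in> \<int>" for r :: real
      using Ints_mult[OF Ints_of_int[of k] that] by (simp add: mult_ac)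
    ultimately show ?thesis using z by (auto simp: M_def mult.assoc)
  qed
  have all: "x ^ j \<in> M N" for j
  proof (induction j rule: less_induct)
    case (less j)
    show ?case
    proof (cases "j < d")
      case False
      have "(\<Sum>i\<le>d. coeff p i * x ^ i) = 0" using p(3) by (simp add: poly_altdef d_def)
      then have "(\<Sum>i<d. coeff p i * x ^ i) + x ^ d = 0"
        using p(1) by (simp add: lessThan_Suc_atMost[symmetric] d_def)
      then have "x ^ d = (\<Sum>i<d. - coeff p i * x ^ i)" by (simp add: sum_negf add_eq_0_iff)
      then have "x ^ (j - d) * x ^ d = (\<Sum>i<d. - coeff p i * x ^ (i + (j - d)))"
        by (simp add: sum_distrib_left power_add mult_ac)
      then have "x ^ j = (\<Sum>i<d. - coeff p i * x ^ (i + (j - d)))"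
        using False by (simp add: power_add[symmetric])
      also have "\<dots> \<in> M N"
        using p(2) less False by (intro Msum Mint) auto
      finally show ?thesis .
    qed (use N in blast)
  qed
  show ?thesis
  proof (rule Rats_bounded_denominator)
    show "(cmod x)\<^sup>2 \<in> \<rat>" by (rule K_norm_rational[OF x])
    show "N * N * int D \<noteq> 0" using N D0 by simp
    fix j
    obtain A B where AB: "of_int N * Re (x ^ j) = of_int A" "of_int N * (Im (x ^ j) * sqrt D) = of_int B"
      using all[of j] by (auto simp: M_def elim!: Ints_cases)
    have "of_int (N * N * int D) * ((cmod x)\<^sup>2) ^ j = real D * (of_int N * Re (x ^ j))\<^sup>2 +
        (of_int N * (Im (x ^ j) * sqrt D))\<^sup>2"
    proof -
      have "((cmod x)\<^sup>2) ^ j = (cmod (x ^ j))\<^sup>2" by (simp add: norm_power power_mult[symmetric] mult.commute)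
      also have "\<dots> = (Re (x ^ j))\<^sup>2 + (Im (x ^ j))\<^sup>2" by (rule cmod_power2)
      finally show ?thesis by (simp add: power_mult_distrib power2_eq_square algebra_simps)
    qed
    then show "of_int (N * N * int D) * ((cmod x)\<^sup>2) ^ j \<in> \<int>" unfolding AB by simp
  qed
qed

lemma algebraic_int_trace:
  assumes x: "x \<in> imag_quadratic_field D" and ai: "algebraic_int x"
  shows "2 * Re x \<in> \<int>"
proof -
  have "algebraic_int (x - 1)"
    by (rule algebraic_int_root[OF ai, of "[:1, 1:]"]) (auto simp: coeff_pCons split: nat.splits)
  then have "(cmod (x - 1))\<^sup>2 \<in> \<int>" using x by (intro algebraic_int_norm K_diff K_numeral)
  then have "(cmod x)\<^sup>2 - (cmod (x - 1))\<^sup>2 + 1 \<in> \<int>"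
    using algebraic_int_norm[OF x ai] by (intro Ints_add Ints_diff Ints_1)
  moreover have "(cmod x)\<^sup>2 - (cmod (x - 1))\<^sup>2 + 1 = 2 * Re x"
    unfolding cmod_power2 by (simp add: power2_eq_square algebra_simps)
  ultimately show ?thesis by simp
qed

fun integral_coords :: "int \<times> int \<Rightarrow> bool" where
  "integral_coords (t, y) \<longleftrightarrow> 4 dvd t * t + int D * (y * y)"

lemma surd_norm: "(cmod (surd (int D) (t, y)))\<^sup>2 = of_int (t * t + int D * (y * y)) / 4"
  unfolding cmod_power2 by (simp add: power2_eq_square field_simps)

text \<open>
  The imaginary coordinate times \<open>D\<close> is an integer whose square is divisible by \<open>D\<close>; as \<open>D\<close> is squarefree, the
  integer itself is.
\<close>

lemma surd_coords:
  assumes sf: "squarefree D" and x: "x \<in> imag_quadratic_field D" and tr: "2 * Re x \<in> \<int>" and no: "(cmod x)\<^sup>2 \<in> \<int>"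
  shows "\<exists>t y. x = surd (int D) (t, y) \<and> integral_coords (t, y)"
proof -
  obtain t where t: "2 * Re x = of_int t" using tr by (auto elim: Ints_cases)
  obtain n where n: "(cmod x)\<^sup>2 = of_int n" using no by (auto elim: Ints_cases)
  define w where "w = 2 * (Im x * sqrt D)"
  have wq: "w \<in> \<rat>" using x unfolding w_def by (auto simp: field_iff[OF D0])
  have w2: "w\<^sup>2 = of_int (int D * (4 * n - t * t))"
  proof -
    have "4 * (Im x)\<^sup>2 = 4 * (cmod x)\<^sup>2 - (2 * Re x)\<^sup>2" unfolding cmod_power2 by (simp add: power_mult_distrib)
    also have "\<dots> = of_int (4 * n - t * t)" unfolding n t by (simp add: power2_eq_square)
    finally have e: "4 * (Im x)\<^sup>2 = of_int (4 * n - t * t)" .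
    have "w\<^sup>2 = real D * (4 * (Im x)\<^sup>2)" by (simp add: w_def power_mult_distrib)
    then show ?thesis unfolding e by (simp only: of_int_mult of_int_of_nat_eq)
  qed
  have "w \<in> \<int>"
  proof -
    have "algebraic_int (of_int (int D * (4 * n - t * t)) :: real)" by (rule int_imp_algebraic_int) simp
    then have "algebraic_int w" unfolding w2[symmetric] by (rule algebraic_int_of_square)
    then show ?thesis using rational_algebraic_int_is_int wq by blast
  qed
  then obtain k where k: "w = of_int k" by (auto elim: Ints_cases)
  have "of_int (k * k) = (of_int (int D * (4 * n - t * t)) :: real)" using w2 by (simp add: k power2_eq_square)
  then have kk: "k * k = int D * (4 * n - t * t)" by (simp only: of_int_eq_iff)
  have "int D dvd k"
  proof -
    have "D dvd (nat \<bar>k\<bar>)\<^sup>2"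
    proof -
      have "int D dvd k\<^sup>2" using kk by (simp add: power2_eq_square)
      then have "int D dvd int ((nat \<bar>k\<bar>)\<^sup>2)" by simp
      then show ?thesis by (simp only: int_dvd_int_iff)
    qed
    then have "D dvd nat \<bar>k\<bar>"
      by (rule squarefree_dvd_square[OF sf])
    then have "int D dvd int (nat \<bar>k\<bar>)" by (simp only: int_dvd_int_iff)
    then show ?thesis by simp
  qed
  then obtain y where y: "k = int D * y" by blast
  have im: "2 * Im x = of_int y * sqrt D"
  proof -
    have "2 * Im x * (sqrt (real D) * sqrt (real D)) = w * sqrt D" by (simp add: w_def)
    then have "2 * Im x * real D = of_int y * sqrt D * real D" by (simp add: k y)
    then show ?thesis using D0 by simp
  qed
  have e: "x = surd (int D) (t, y)" using t im by (simp add: complex_eq_iff)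
  have "of_int (t * t + int D * (y * y)) / 4 = real_of_int n" using n surd_norm[of t y] e by simp
  then have "real_of_int (t * t + int D * (y * y)) = of_int (4 * n)" by simp
  then have "t * t + int D * (y * y) = 4 * n" by (simp only: of_int_eq_iff)
  then show ?thesis using e by auto
qed

lemma ring_of_integers_coords:
  assumes "squarefree D" "x \<in> imag_quadratic_integers D"
  shows "\<exists>t y. x = surd (int D) (t, y) \<and> integral_coords (t, y)"
  using assms algebraic_int_norm algebraic_int_trace
  by (intro surd_coords) (auto simp: imag_quadratic_integers_def)

text \<open>
  The trace and the norm of \<open>h\<close> are rational square roots of integers formed from those of \<open>h\<^sup>2\<close>.
\<close>

lemma square_root_coords:
  assumes "squarefree D" "h \<in> imag_quadratic_field D" "h\<^sup>2 = surd (int D) (t, y)" "integral_coords (t, y)"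
  shows "\<exists>t y. h = surd (int D) (t, y) \<and> integral_coords (t, y)"
proof -
  obtain n where n: "t * t + int D * (y * y) = 4 * n" using assms(4) by auto
  have "((cmod h)\<^sup>2)\<^sup>2 = of_int n"
  proof -
    have "((cmod h)\<^sup>2)\<^sup>2 = (cmod (h\<^sup>2))\<^sup>2" by (simp add: norm_power)
    also have "\<dots> = of_int (4 * n) / 4" unfolding assms(3) surd_norm n ..
    finally show ?thesis by simp
  qed
  then have "((cmod h)\<^sup>2)\<^sup>2 \<in> \<int>" by simp
  then have "algebraic_int ((cmod h)\<^sup>2)"
    by (rule algebraic_int_of_square[OF int_imp_algebraic_int])
  then have no: "(cmod h)\<^sup>2 \<in> \<int>" using rational_algebraic_int_is_int K_norm_rational[OF assms(2)] by blast
  then obtain k where k: "(cmod h)\<^sup>2 = of_int k" by (auto elim: Ints_cases)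
  have "(2 * Re h)\<^sup>2 = 2 * Re (h\<^sup>2) + 2 * (cmod h)\<^sup>2"
    unfolding cmod_power2 by (simp add: power2_eq_square)
  also have "\<dots> = of_int (t + 2 * k)" unfolding assms(3) k by simp
  finally have "(2 * Re h)\<^sup>2 \<in> \<int>" by simp
  then have "algebraic_int (2 * Re h)"
    by (rule algebraic_int_of_square[OF int_imp_algebraic_int])
  moreover have "2 * Re h \<in> \<rat>" using assms(2) by (simp add: field_iff[OF D0])
  ultimately have "2 * Re h \<in> \<int>" using rational_algebraic_int_is_int by blast
  then show ?thesis using surd_coords[OF assms(1,2) _ no] by blast
qed

end

section \<open>The table of cycles\<close>

text \<open>
  The discs were found numerically, as approximate solutions of the cycle equation for each map; the check
  of a certificate does not depend on how it was found.
\<close>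

definition cycle_table_1 :: "certificate list" where "cycle_table_1 = [
  (1, 4294967296, (2, 4), (0, -2), 0, 1, 3, (-2304617952, -2969368558, 256), None),
  (1, 4294967296, (2, 2), (0, -2), 0, 1, 5, (-1837234874, -964814401, 4096), None),
  (1, 4294967296, (0, 6), (0, -2), 0, 1, 3, (-6345515107, -11392122267, 4096), None),
  (1, 4294967296, (0, 4), (0, -2), 0, 1, 4, (-2443566678, 1330878687, 512), None),
  (1, 4294967296, (-2, -4), (-2, -4), 0, 1, 5, (816711413, -121682925, 256), None),
  (1, 4294967296, (-2, 8), (-2, 0), 0, 1, 3, (-2598579418, -2306557494, 256), None)]"

definition cycle_table_2 :: "certificate list" where "cycle_table_2 = [
  (1, 4294967296, (-2, 4), (-2, 0), 0, 1, 4, (-5483366114, 2775850160, 256), Some 26),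
  (1, 4294967296, (-4, -2), (-4, -2), 0, 1, 5, (3234555466, 1413273898, 4096), None),
  (1, 4294967296, (-2, 0), (-4, 2), 0, 1, 3, (-4850095885, 738932846, 256), None),
  (1, 4294967296, (-2, 0), (-4, 0), 0, 1, 4, (8436407581, 0, 256), None),
  (1, 4294967296, (-2, 0), (-6, 0), 0, 1, 5, (920192068, 0, 64), None),
  (2, 6074000999, (-2, -2), (0, 2), 0, 1, 5, (3804535770, 5613006647, 4096), None)]"

definition cycle_table_3 :: "certificate list" where "cycle_table_3 = [
  (2, 6074000999, (-2, 4), (-2, 0), 0, 1, 3, (7736454432, -11336269482, 512), None),
  (2, 6074000999, (-2, 2), (-2, -2), 0, 1, 4, (1220843044, -2843025156, 1024), Some 8),
  (3, 7439101573, (2, 4), (-1, -1), 0, 1, 4, (-1386855011, -2688236767, 4096), None),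
  (3, 7439101573, (2, 2), (1, -1), 0, 1, 4, (-4006261316, -7165966349, 512), None),
  (3, 7439101573, (2, 2), (-1, -1), 0, 1, 5, (-264018361, -3844926428, 1024), None),
  (3, 7439101573, (0, -2), (1, 1), 0, 1, 5, (-37369058, 7854441189, 1024), None)]"

definition cycle_table_4 :: "certificate list" where "cycle_table_4 = [
  (3, 7439101573, (0, 2), (0, -2), 0, 1, 3, (309963609, -5808627260, 256), Some 5),
  (3, 7439101573, (0, 2), (-1, -1), 0, 1, 4, (2486350907, 3384414444, 1024), None),
  (3, 7439101573, (-1, 3), (-1, -1), 0, 1, 4, (3412338407, -8705993214, 4096), None),
  (3, 7439101573, (-1, 1), (-7, -1), 0, 1, 4, (-5607847114, 882701795, 4096), None),
  (3, 7439101573, (-1, 1), (-3, -1), 0, 1, 4, (1711501782, -1559085172, 4096), None),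
  (3, 7439101573, (-4, -2), (-4, -2), 0, 1, 5, (-498710809, -130506230, 512), None)]"

definition cycle_table_5 :: "certificate list" where "cycle_table_5 = [
  (3, 7439101573, (-3, -1), (-3, -1), 0, 1, 5, (1619860481, -336216897, 512), None),
  (3, 7439101573, (-2, 0), (-3, 1), 0, 1, 3, (1694785509, 777554081, 128), None),
  (3, 7439101573, (-2, 0), (-4, 2), 0, 1, 3, (-4818005887, 1328716056, 512), Some 3),
  (7, 11363415354, (1, 1), (1, -1), 0, 1, 4, (-1448341420, -5006863328, 1024), None),
  (7, 11363415354, (0, 2), (-1, -1), 0, 1, 3, (712754632, -10007167184, 256), None),
  (7, 11363415354, (-1, 1), (-1, -1), 0, 1, 4, (3245136758, 5608949396, 4096), None)]"

definition cycle_table_6 :: "certificate list" where "cycle_table_6 = [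
  (7, 11363415354, (-2, 0), (-3, 1), 0, 1, 3, (1409536766, 900180863, 128), None),
  (7, 11363415354, (-2, 0), (-5, 1), 0, 1, 3, (-5232581309, 1008289030, 512), Some 1),
  (15, 16634336809, (-1, 1), (-1, -1), 0, 1, 3, (-486264177, -2088846335, 128), Some 2),
  (15, 16634336809, (-2, 0), (-3, 1), 0, 1, 3, (2763540418, 1281031517, 256), Some 1),
  (1, 4294967296, (2, 0), (-6, 0), 0, 1, 4, (811507731, 0, 64), None),
  (1, 4294967296, (2, 0), (-4, 0), 0, 1, 4, (-6392965066, 225650232, 512), None)]"

definition cycle_table_7 :: "certificate list" where "cycle_table_7 = [
  (1, 4294967296, (2, 0), (-2, 0), 0, 1, 4, (1936222116, 1451369656, 64), None),
  (1, 4294967296, (2, 0), (0, 0), 0, 1, 4, (1299229542, -2342212408, 64), None),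
  (1, 4294967296, (2, 0), (4, 0), 0, 1, 4, (-1728981385, 0, 64), None),
  (3, 7439101573, (2, 0), (-1, 1), 0, 1, 4, (-7873973460, 1279124182, 4096), None),
  (1, 4294967296, (6, 0), (0, 0), 0, 1, 4, (-5405219461, -2517311436, 512), None),
  (1, 4294967296, (2, 2), (0, 0), 0, 1, 4, (-3112019139, 2642284442, 64), None)]"

definition cycle_table_8 :: "certificate list" where "cycle_table_8 = [
  (3, 7439101573, (5, 1), (0, 0), 0, 1, 4, (-3706835278, -3534640143, 512), None)]"

definition cycle_table :: "certificate list" where
  "cycle_table = cycle_table_1 @ cycle_table_2 @ cycle_table_3 @ cycle_table_4 @ cycle_table_5 @ cycle_table_6 @ cycle_table_7 @ cycle_table_8"

text \<open>
  A 5-cycle of \<open>z + 1 / z\<close> on the imaginary axis.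
\<close>

definition double_fixed_point_cycle :: certificate where
  "double_fixed_point_cycle = (1, 4294967296, (0, 0), (2, 0), 1, 0, 5, (0, -3590426161, 64), None)"

lemma certified_table_1: "list_all certified cycle_table_1" by code_simp
lemma certified_table_2: "list_all certified cycle_table_2" by code_simp
lemma certified_table_3: "list_all certified cycle_table_3" by code_simp
lemma certified_table_4: "list_all certified cycle_table_4" by code_simp
lemma certified_table_5: "list_all certified cycle_table_5" by code_simp
lemma certified_table_6: "list_all certified cycle_table_6" by code_simp
lemma certified_table_7: "list_all certified cycle_table_7" by code_simp
lemma certified_table_8: "list_all certified cycle_table_8" by code_simp

lemma certified_double_fixed_point_cycle: "certified double_fixed_point_cycle" by code_simp

lemma certified_cycle_table: "list_all certified cycle_table"
  using certified_table_1 certified_table_2 certified_table_3 certified_table_4 certified_table_5 certified_table_6 certified_table_7 certified_table_8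
  unfolding cycle_table_def by simp

section \<open>Enumeration of fixed point multipliers\<close>

definition integral_cycles :: "nat \<Rightarrow> complex \<Rightarrow> complex \<Rightarrow> int \<Rightarrow> int \<Rightarrow> bool" where
  "integral_cycles D p q s t \<longleftrightarrow>
     (\<forall>n m. n \<le> 5 \<longrightarrow> quad_cycle p q s t n m \<longrightarrow> m \<in> imag_quadratic_integers D)"

lemma integral_cycles_cnj:
  assumes "D > 0" "integral_cycles D (cnj p) (cnj q) s t"
  shows "integral_cycles D p q s t"
proof -
  have cnj_in: "cnj m \<in> imag_quadratic_integers D \<Longrightarrow> m \<in> imag_quadratic_integers D" for m
    unfolding imag_quadratic_integers_def using K_cnj[OF assms(1), of "cnj m"] by simp
  show ?thesis
    unfolding integral_cycles_def
    using assms(2) quad_cycle_cnj[of p q s t] cnj_in unfolding integral_cycles_def by blast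
qed

lemma certified_not_integral:
  assumes "certified (E, r, p, q, s, t, n, X, k)" "E > 0" "1 \<le> n" "n \<le> 5"
    and "squarefree D" "k = None \<or> E = int D"
  shows "\<not> integral_cycles D (surd E p) (surd E q) s t"
proof
  assume int: "integral_cycles D (surd E p) (surd E q) s t"
  have D: "D > 0" using assms(5) by (metis not_squarefree_0 neq0_conv)
  obtain m where m: "quad_cycle (surd E p) (surd E q) s t n m"
    "case k of None \<Rightarrow> \<forall>j. 2 * Re m \<noteq> of_int j | Some _ \<Rightarrow> \<forall>j. 2 * Im m \<noteq> of_int j * sqrt (of_int E)"
    using certified_sound[OF assms(1-3)] by blast
  have "m \<in> imag_quadratic_integers D" using int m(1) assms(4) unfolding integral_cycles_def by blast
  then obtain x y where "m = surd (int D) (x, y)"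
    using ring_of_integers_coords[OF D assms(5)] by blast
  then have "2 * Re m = of_int x" "2 * Im m = of_int y * sqrt (real D)" by simp_all
  then show False using m(2) assms(6) by (auto split: option.splits)
qed

fun family_key :: "certificate \<Rightarrow> int \<times> (int \<times> int) \<times> (int \<times> int)" where
  "family_key (E, r, p, q, s, t, n, X, k) = (E, p, q)"

text \<open>
  A certificate based on the imaginary part is tied to its own field, hence the last clause.
\<close>

fun admissible :: "certificate \<Rightarrow> bool" where
  "admissible (E, r, (x, y), (x', y'), s, t, n, X, k) \<longleftrightarrow>
     E > 0 \<and> 1 \<le> n \<and> n \<le> 5 \<and> s = 0 \<and> t = 1 \<and> (k = None \<or> y \<noteq> 0 \<or> y' \<noteq> 0)"

lemma admissible_cycle_table: "list_all admissible cycle_table"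
  by code_simp

text \<open>
  The field matters only through the coordinates, so a certificate for rational parameters is valid in every
  field. Conjugate parameters match, too. Nested conditionals make the evaluation stop at the first mismatch.
\<close>

fun matches :: "int \<Rightarrow> int \<times> int \<Rightarrow> int \<times> int \<Rightarrow> int \<times> (int \<times> int) \<times> (int \<times> int) \<Rightarrow> bool" where
  "matches D (x, y) (x', y') (E, (u, v), (u', v')) =
     (if x = u then if x' = u' then if D = E \<or> v = 0 \<and> v' = 0 then y = v \<and> y' = v' \<or> y = - v \<and> y' = - v'
      else False else False else False)"

lemma matches_cases:
  assumes "matches D p q (E, p', q')"
  obtains "surd D p = surd E p'" "surd D q = surd E q'" "D = E \<or> snd p' = 0 \<and> snd q' = 0"
  | "surd D p = cnj (surd E p')" "surd D q = cnj (surd E q')" "D = E \<or> snd p' = 0 \<and> snd q' = 0"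
proof -
  obtain x y x' y' u v u' v' where e: "p = (x, y)" "q = (x', y')" "p' = (u, v)" "q' = (u', v')"
    by (metis prod.exhaust)
  show ?thesis using assms that unfolding e by (auto split: if_splits simp: complex_eq_iff)
qed

lemma matched_not_integral:
  assumes "squarefree D" "c \<in> set cycle_table" "matches (int D) p q (family_key c)"
  shows "\<not> integral_cycles D (surd (int D) p) (surd (int D) q) 0 1"
proof -
  have D: "D > 0" using assms(1) by (metis not_squarefree_0 neq0_conv)
  obtain E r x y x' y' s t n X k where c: "c = (E, r, (x, y), (x', y'), s, t, n, X, k)"
    by (metis prod.exhaust)
  have "certified c" "admissible c"
    using assms(2) certified_cycle_table admissible_cycle_table by (auto simp: list_all_iff)
  note c' = this[unfolded c]
  then have ad: "E > 0" "1 \<le> n" "n \<le> 5" "s = 0" "t = 1" "k = None \<or> y \<noteq> 0 \<or> y' \<noteq> 0" by auto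
  from assms(3) have "matches (int D) p q (E, (x, y), (x', y'))" by (simp add: c)
  then show ?thesis
  proof (cases rule: matches_cases)
    case 1
    then show ?thesis using certified_not_integral[OF c'(1) ad(1-3) assms(1)] ad(4-6) by auto
  next
    case 2
    have "\<not> integral_cycles D (surd E (x, y)) (surd E (x', y')) 0 1"
      using certified_not_integral[OF c'(1) ad(1-3) assms(1)] ad(4-6) 2(3) by auto
    then show ?thesis
      using integral_cycles_cnj[OF D, of "surd E (x, y)" "surd E (x', y')" 0 1] 2 by auto
  qed
qed

fun find_match :: "int \<Rightarrow> int \<times> int \<Rightarrow> int \<times> int \<Rightarrow> (int \<times> (int \<times> int) \<times> (int \<times> int)) list \<Rightarrow> bool" where
  "find_match D p q [] = False"
| "find_match D p q (k # ks) = (if matches D p q k then True else find_match D p q ks)"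

fun one_minus :: "int \<times> int \<Rightarrow> int \<times> int" where
  "one_minus (x, y) = (2 - x, - y)"

text \<open>
  Any ordered pair of the three fixed points may be placed at \<open>0\<close> and \<open>\<infinity>\<close>.
\<close>

fun some_pair_matches where
  "some_pair_matches ks D p q r =
     (if find_match D p q ks then True else if find_match D q p ks then True
      else if find_match D p r ks then True else if find_match D r p ks then True
      else if find_match D q r ks then True else find_match D r q ks)"

fun check_triple where
  "check_triple ks D a b (x, y) =
     (if 4 dvd x * x + D * (y * y) then some_pair_matches ks D (one_minus a) (one_minus b) (one_minus (x, y))
      else True)"

text \<open>
  Given \<open>1 - p = a\<close> and \<open>1 - q = b\<close>, the third number is \<open>a b / (a b - a - b)\<close>; clearing the denominator by its
  conjugate, of norm \<open>N\<close>, gives the coordinates \<open>u / N\<close> and \<open>v / N\<close>, and a nonintegral quotient needs no further check.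
\<close>

fun check_quotient where
  "check_quotient ks D a b u v N =
     (if N = 0 then True else if N dvd u then if N dvd v then check_triple ks D a b (u div N, v div N) else True else True)"

fun check_product where
  "check_product ks D a b x1 x2 w1 w2 =
     check_quotient ks D a b (2 * (x1 * w1 + D * (x2 * w2))) (2 * (x2 * w1 - x1 * w2)) (w1 * w1 + D * (w2 * w2))"

fun check_sum where
  "check_sum ks D a b x1 x2 = check_product ks D a b x1 x2 (x1 - 2 * (fst a + fst b)) (x2 - 2 * (snd a + snd b))"

fun check_pair where
  "check_pair ks D (x, y) (x', y') = check_sum ks D (x, y) (x', y') (x * x' - D * (y * y')) (x * y' + y * x')"

text \<open>
  The condition \<open>Re (1 / a) \<ge> 2 / m\<close>, in coordinates; it describes a disc tangent to the imaginary axis at \<open>0\<close>. The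
  value \<open>a = 1\<close>, that is, multiplier \<open>0\<close>, is left to the polynomial family.
\<close>

fun in_horodisc :: "int \<Rightarrow> int \<Rightarrow> int \<times> int \<Rightarrow> bool" where
  "in_horodisc D m (x, y) =
     (if x * x + D * (y * y) \<le> m * x then if 4 dvd x * x + D * (y * y) then \<not> (x = 2 \<and> y = 0) else False else False)"

text \<open>
  Of three unit fractions with sum \<open>1\<close>, the largest real part is at least \<open>1 / 3\<close>; all are at most \<open>1 / 2\<close>, so the second is at least \<open>1 / 4\<close>.
\<close>

fun check_second where
  "check_second ks D a [] = True"
| "check_second ks D a (b # bs) =
    (if in_horodisc D 8 b then if check_pair ks D a b then check_second ks D a bs else False else check_second ks D a bs)"

fun check_first where
  "check_first ks D bs [] = True"
| "check_first ks D bs (a # as) =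
    (if in_horodisc D 6 a then if check_second ks D a bs then check_first ks D bs as else False else check_first ks D bs as)"

fun check_discriminants where
  "check_discriminants ks bs [] = True"
| "check_discriminants ks bs (D # Ds) = (if check_first ks D bs bs then check_discriminants ks bs Ds else False)"

text \<open>
  The inverse square map and the five Lattes maps whose fixed point multipliers are neither \<open>0\<close> nor \<open>1\<close>, up to conjugation.
\<close>

definition exceptional :: "(int \<times> (int \<times> int) \<times> (int \<times> int)) list" where
  "exceptional = [(1, (-4, 0), (-4, 0)), (1, (-2, -2), (0, 4)), (1, (-2, 2), (-8, 0)),
     (2, (0, 2), (-4, 0)), (7, (-1, -1), (1, 1)), (7, (-1, 1), (-3, -1))]"

definition grid :: "(int \<times> int) list" where
  "grid = List.product [1, 2, 3, 4, 5, 6, 7, 8] [-4, -3, -2, -1, 0, 1, 2, 3, 4]"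

lemma enumeration:
  "check_discriminants (exceptional @ map family_key cycle_table) grid [1, 2, 3, 5, 6, 7, 10, 11, 13, 14, 15]"
  by code_simp

section \<open>Unit fractions in quadratic fields\<close>

lemma find_match_sound: "find_match D p q ks \<Longrightarrow> \<exists>k\<in>set ks. matches D p q k"
  by (induction D p q ks rule: find_match.induct) (auto split: if_splits simp del: matches.simps)

lemma check_second_sound: "check_second ks D a bs \<Longrightarrow> b \<in> set bs \<Longrightarrow> in_horodisc D 8 b \<Longrightarrow> check_pair ks D a b"
  by (induction bs) (auto split: if_splits simp del: in_horodisc.simps check_pair.simps)

lemma check_first_sound: "check_first ks D bs as \<Longrightarrow> a \<in> set as \<Longrightarrow> in_horodisc D 6 a \<Longrightarrow> check_second ks D a bs"
  by (induction as) (auto split: if_splits simp del: in_horodisc.simps check_second.simps)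

lemma check_discriminants_sound: "check_discriminants ks bs Ds \<Longrightarrow> D \<in> set Ds \<Longrightarrow> check_first ks D bs bs"
  by (induction Ds) (auto split: if_splits simp del: check_first.simps)

definition catalogue :: "(int \<times> (int \<times> int) \<times> (int \<times> int)) list" where
  "catalogue = exceptional @ map family_key cycle_table"

definition catalogued :: "nat \<Rightarrow> complex \<Rightarrow> complex \<Rightarrow> bool" where
  "catalogued D p q \<longleftrightarrow> (\<exists>k\<in>set catalogue. \<exists>P Q. matches (int D) P Q k \<and> p = surd (int D) P \<and> q = surd (int D) Q)"

definition some_pair_catalogued :: "nat \<Rightarrow> complex \<Rightarrow> complex \<Rightarrow> complex \<Rightarrow> bool" where
  "some_pair_catalogued D p q r \<longleftrightarrow> catalogued D p q \<or> catalogued D q p \<or> catalogued D p r \<or>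
     catalogued D r p \<or> catalogued D q r \<or> catalogued D r q"

lemma surd_one_minus: "surd E (one_minus a) = 1 - surd E a"
  by (cases a) (simp add: complex_eq_iff field_simps)

lemma surd_quotient_equations:
  fixes E :: int
  assumes "E > 0"
    and "surd E (x3, y3) * (surd E (x1, y1) * surd E (x2, y2) - surd E (x1, y1) - surd E (x2, y2)) =
      surd E (x1, y1) * surd E (x2, y2)"
  defines "u \<equiv> x1 * x2 - E * (y1 * y2)" and "v \<equiv> x1 * y2 + y1 * x2"
  shows "x3 * (u - 2 * (x1 + x2)) - E * (y3 * (v - 2 * (y1 + y2))) = 2 * u"
    and "x3 * (v - 2 * (y1 + y2)) + y3 * (u - 2 * (x1 + x2)) = 2 * v"
proof -
  define s where "s = sqrt (real_of_int E)"
  have s: "s * s = of_int E" "s \<noteq> 0" using assms(1) by (simp_all add: s_def)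
  have re: "Re (surd E (x3, y3) * (surd E (x1, y1) * surd E (x2, y2) - surd E (x1, y1) - surd E (x2, y2))) =
      Re (surd E (x1, y1) * surd E (x2, y2))"
    and im: "Im (surd E (x3, y3) * (surd E (x1, y1) * surd E (x2, y2) - surd E (x1, y1) - surd E (x2, y2))) =
      Im (surd E (x1, y1) * surd E (x2, y2))" using assms(2) by simp_all
  have "real_of_int (x3 * (u - 2 * (x1 + x2)) - E * (y3 * (v - 2 * (y1 + y2)))) = of_int (2 * u)"
    using re s(1) unfolding u_def v_def surd.simps s_def[symmetric]
    by (simp add: divide_simps) algebra
  then show "x3 * (u - 2 * (x1 + x2)) - E * (y3 * (v - 2 * (y1 + y2))) = 2 * u" by (simp only: of_int_eq_iff)
  have "s * real_of_int (x3 * (v - 2 * (y1 + y2)) + y3 * (u - 2 * (x1 + x2))) = s * of_int (2 * v)"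
    using im s(1) unfolding u_def v_def surd.simps s_def[symmetric]
    by (simp add: divide_simps) algebra
  then have "real_of_int (x3 * (v - 2 * (y1 + y2)) + y3 * (u - 2 * (x1 + x2))) = of_int (2 * v)" using s(2) by simp
  then show "x3 * (v - 2 * (y1 + y2)) + y3 * (u - 2 * (x1 + x2)) = 2 * v" by (simp only: of_int_eq_iff)
qed

text \<open>
  The integers \<open>u\<close> and \<open>v\<close> are four times the coordinates of the product, and \<open>N \<noteq> 0\<close> because the product is not zero.
\<close>

lemma check_pair_sound:
  fixes E :: int
  assumes chk: "check_pair ks E a b" and E: "E > 0"
    and c: "surd E c * (surd E a * surd E b - surd E a - surd E b) = surd E a * surd E b"
    and ab: "surd E a * surd E b \<noteq> 0"
    and int: "4 dvd fst c * fst c + E * (snd c * snd c)"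
  shows "some_pair_matches ks E (one_minus a) (one_minus b) (one_minus c)"
proof -
  obtain x1 y1 where a: "a = (x1, y1)" by (cases a)
  obtain x2 y2 where b: "b = (x2, y2)" by (cases b)
  obtain x3 y3 where c': "c = (x3, y3)" by (cases c)
  define u where "u = x1 * x2 - E * (y1 * y2)"
  define v where "v = x1 * y2 + y1 * x2"
  define w1 where "w1 = u - 2 * (x1 + x2)"
  define w2 where "w2 = v - 2 * (y1 + y2)"
  define N where "N = w1 * w1 + E * (w2 * w2)"
  have eq: "x3 * w1 - E * (y3 * w2) = 2 * u" "x3 * w2 + y3 * w1 = 2 * v"
    using surd_quotient_equations[OF E c[unfolded a b c']] unfolding u_def v_def w1_def w2_def by simp_all
  have N: "N \<noteq> 0"
  proof
    assume "N = 0"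
    then have "w1 = 0" "w2 = 0" unfolding N_def using E
      by (smt (verit) mult_nonneg_nonneg mult_pos_pos not_real_square_gt_zero zero_le_square mult_eq_0_iff zero_less_mult_iff)+
    then have uv: "u = 0" "v = 0" using eq by simp_all
    have "Re (surd E a * surd E b) = of_int u / 4" "Im (surd E a * surd E b) = of_int v * sqrt E / 4"
      using E by (simp_all add: a b u_def v_def field_simps real_sqrt_mult_self)
    then show False using ab uv by (simp add: complex_eq_iff)
  qed
  have U: "2 * (u * w1 + E * (v * w2)) = x3 * N" and V: "2 * (v * w1 - u * w2) = y3 * N"
    using eq unfolding N_def by algebra+
  have "check_quotient ks E a b (2 * (u * w1 + E * (v * w2))) (2 * (v * w1 - u * w2)) N"
    using chk unfolding N_def by (simp add: a b u_def v_def w1_def w2_def del: check_quotient.simps)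
  then have "check_quotient ks E a b (x3 * N) (y3 * N) N" unfolding U V .
  then have "check_triple ks E a b (x3, y3)" using N by (simp del: check_triple.simps)
  then show ?thesis using int by (simp add: c' del: some_pair_matches.simps)
qed

lemma some_pair_matches_catalogued:
  assumes "some_pair_matches catalogue E p q r"
    and E: "E = int D \<or> E = 1 \<and> snd p = 0 \<and> snd q = 0 \<and> snd r = 0"
  shows "some_pair_catalogued D (surd E p) (surd E q) (surd E r)"
proof -
  have "catalogued D (surd E p) (surd E q)" if m: "matches E p q k" "k \<in> set catalogue"
    "E = int D \<or> E = 1 \<and> snd p = 0 \<and> snd q = 0" for p q k
  proof (cases "E = int D")
    case True
    then show ?thesis using m unfolding catalogued_def by blast
  next
    case False
    obtain F x y x' y' where k: "k = (F, (x, y), (x', y'))" by (metis prod.exhaust)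
    obtain a where p: "p = (a, 0)" using m(3) False by (cases p) simp
    obtain b where q: "q = (b, 0)" using m(3) False by (cases q) simp
    note pq = p q
    have "matches (int D) p q k" using m(1) unfolding k pq by (auto split: if_splits)
    moreover have "surd E p = surd (int D) p" "surd E q = surd (int D) q" by (simp_all add: pq)
    ultimately show ?thesis using m(2) unfolding catalogued_def by metis
  qed
  moreover have "\<exists>k\<in>set catalogue. matches E p q k \<or> matches E q p k \<or> matches E p r k \<or> matches E r p k \<or>
      matches E q r k \<or> matches E r q k"
  proof -
    have "find_match E p q catalogue \<or> find_match E q p catalogue \<or> find_match E p r catalogue \<or>
        find_match E r p catalogue \<or> find_match E q r catalogue \<or> find_match E r q catalogue"
      using assms(1) by (auto split: if_splits)
    then show ?thesis using find_match_sound by blast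
  qed
  ultimately show ?thesis using E unfolding some_pair_catalogued_def by metis
qed

text \<open>
  The horodisc lies in the strip \<open>0 < x \<le> 8\<close>, and \<open>E y\<^sup>2 \<le> 16\<close> by completing the square.
\<close>

lemma in_horodiscI:
  fixes E :: int and m :: nat
  assumes E: "E > 0" and a: "surd E a \<noteq> 0" "surd E a \<noteq> 1" "4 dvd fst a * fst a + E * (snd a * snd a)"
    and re: "2 \<le> real m * Re (inverse (surd E a))" and m: "0 < m" "m \<le> 8"
  shows "in_horodisc E m a" "E * (snd a * snd a) \<le> 16" "a \<in> set grid"
proof -
  obtain x y where xy: "a = (x, y)" by (cases a)
  define N where "N = x * x + E * (y * y)"
  have "N > 0"
  proof -
    have "x \<noteq> 0 \<or> y \<noteq> 0" using a(1) by (auto simp: xy complex_eq_iff)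
    moreover have "0 \<le> x * x" "0 \<le> E * (y * y)" using E by simp_all
    moreover have "x * x > 0" if "x \<noteq> 0" using that by (auto simp: zero_less_mult_iff)
    moreover have "E * (y * y) > 0" if "y \<noteq> 0" using that E by (auto simp: zero_less_mult_iff)
    ultimately show ?thesis unfolding N_def by linarith
  qed
  then have Nr: "real_of_int N > 0" by simp
  have s: "sqrt (real_of_int E) * sqrt (real_of_int E) = of_int E" using E by simp
  have "(Re (surd E a))\<^sup>2 + (Im (surd E a))\<^sup>2 = of_int N / 4"
    using s by (simp add: xy N_def power2_eq_square field_simps)
  then have "Re (inverse (surd E a)) = Re (surd E a) / (of_int N / 4)" by (simp only: inverse_complex.sel)
  then have "Re (inverse (surd E a)) = 2 * of_int x / of_int N" by (simp add: xy)
  then have "2 \<le> real m * (2 * real_of_int x / of_int N)" using re by simp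
  then have "real_of_int N \<le> of_int (int m * x)" using Nr by (simp add: field_simps)
  then have le: "N \<le> int m * x" by (simp only: of_int_le_iff)
  have x0: "x > 0" using le \<open>N > 0\<close> m by (smt (verit) mult_nonneg_nonpos of_nat_0_le_iff)
  have mx: "int m * x \<le> 8 * x" using m x0 by simp
  have ne: "\<not> (x = 2 \<and> y = 0)" using a(2) by (auto simp: xy complex_eq_iff)
  show "in_horodisc E m a" using le a(3) ne by (simp add: xy N_def)
  have sq: "(x - 4) * (x - 4) \<ge> 0" by simp
  then have Ey: "E * (y * y) \<le> 16" using le mx unfolding N_def by (simp add: algebra_simps)
  then show "E * (snd a * snd a) \<le> 16" by (simp add: xy)
  have "y * y \<le> E * (y * y)" using E by (simp add: mult_le_cancel_right1)
  then have "y * y \<le> 16" using Ey by simp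
  then have "y\<^sup>2 \<le> 4\<^sup>2" by (simp add: power2_eq_square)
  then have y: "\<bar>y\<bar> \<le> 4" using abs_le_square_iff[of y 4] by simp
  have "x * x \<le> 8 * x" using le mx E unfolding N_def by (smt (verit) mult_nonneg_nonneg zero_le_square)
  then have "x \<le> 8" using x0 by simp
  then have "x \<in> {1, 2, 3, 4, 5, 6, 7, 8}" and "y \<in> {-4, -3, -2, -1, 0, 1, 2, 3, 4}" using x0 y by auto
  then show "a \<in> set grid" unfolding grid_def xy set_product list.set by (rule SigmaI)
qed

text \<open>
  The bound says that \<open>a\<close> is outside the unit disc around \<open>1\<close>, and \<open>a - 1\<close> is a nonzero integer of norm at least \<open>1\<close>.
\<close>

lemma integral_Re_inverse_le:
  fixes E :: int
  assumes "E > 0" "surd E a \<noteq> 1" "4 dvd fst a * fst a + E * (snd a * snd a)"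
  shows "Re (inverse (surd E a)) \<le> 1 / 2"
proof -
  obtain x y where xy: "a = (x, y)" by (cases a)
  define M where "M = (x - 2) * (x - 2) + E * (y * y)"
  have "x \<noteq> 2 \<or> y \<noteq> 0" using assms(2) by (auto simp: xy complex_eq_iff)
  moreover have "0 \<le> (x - 2) * (x - 2)" "0 \<le> E * (y * y)" using assms(1) by simp_all
  moreover have "(x - 2) * (x - 2) > 0" if "x \<noteq> 2" using that by (auto simp: zero_less_mult_iff)
  moreover have "E * (y * y) > 0" if "y \<noteq> 0" using that assms(1) by (auto simp: zero_less_mult_iff)
  ultimately have "M > 0" unfolding M_def by linarith
  moreover have "M = (x * x + E * (y * y)) + 4 * (1 - x)" unfolding M_def by (simp add: algebra_simps)
  then have "4 dvd M" using assms(3) by (simp add: xy)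
  ultimately have "4 \<le> M" by (rule zdvd_imp_le[rotated])
  then have "4 * x \<le> x * x + E * (y * y)" unfolding M_def by (simp add: algebra_simps)
  then have "real_of_int (4 * x) \<le> of_int (x * x + E * (y * y))" by (simp only: of_int_le_iff)
  moreover have "sqrt (real_of_int E) * sqrt (real_of_int E) = of_int E" using assms(1) by simp
  ultimately have "2 * Re (surd E a) \<le> (Re (surd E a))\<^sup>2 + (Im (surd E a))\<^sup>2"
    by (simp add: xy power2_eq_square field_simps)
  then show ?thesis
    unfolding inverse_complex.sel
    by (cases "(Re (surd E a))\<^sup>2 + (Im (surd E a))\<^sup>2 = 0") (simp_all add: divide_le_eq field_simps sum_power2_gt_zero_iff sum_power2_eq_zero_iff)
qed

lemma squarefree_le_16:
  assumes "squarefree D" "D \<le> (16::nat)"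
  shows "int D \<in> set [1, 2, 3, 5, 6, 7, 10, 11, 13, 14, 15]"
proof -
  have "D = 0 \<or> D = 1 \<or> D = 2 \<or> D = 3 \<or> D = 4 \<or> D = 5 \<or> D = 6 \<or> D = 7 \<or> D = 8 \<or> D = 9 \<or> D = 10 \<or>
      D = 11 \<or> D = 12 \<or> D = 13 \<or> D = 14 \<or> D = 15 \<or> D = 16" using assms(2) by arith
  moreover have "\<not> 4 dvd D" "\<not> 9 dvd D" "D \<noteq> 0"
    using assms(1) squarefreeD[of D 2] squarefreeD[of D 3] by (auto dest: intro: ccontr)
  ultimately show ?thesis by auto
qed

text \<open>
  If the first two numbers are rational, so is the third, and the check over the Gaussian field
  applies; otherwise \<open>D \<le> 16\<close>.
\<close>

lemma sorted_triple_catalogued: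
  assumes D: "squarefree D" and abc: "{surd (int D) a, surd (int D) b, surd (int D) c} \<inter> {0, 1} = {}"
    "integral_coords D a" "integral_coords D b" "integral_coords D c"
    and sum: "inverse (surd (int D) a) + inverse (surd (int D) b) + inverse (surd (int D) c) = 1"
    and le: "Re (inverse (surd (int D) b)) \<le> Re (inverse (surd (int D) a))"
      "Re (inverse (surd (int D) c)) \<le> Re (inverse (surd (int D) b))"
  shows "some_pair_catalogued D (1 - surd (int D) a) (1 - surd (int D) b) (1 - surd (int D) c)"
proof -
  have D0: "D > 0" using D by (metis not_squarefree_0 neq0_conv)
  \<comment> \<open>Rational numbers lie in every field, so the check for \<open>D = 1\<close> covers them.\<close>
  define E where "E = (if snd a = 0 \<and> snd b = 0 then 1 else int D)"
  have sumR: "Re (inverse (surd (int D) a)) + Re (inverse (surd (int D) b)) + Re (inverse (surd (int D) c)) = 1"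
    using arg_cong[OF sum, of Re] by simp
  have eq: "surd (int D) c * (surd (int D) a * surd (int D) b - surd (int D) a - surd (int D) b) = surd (int D) a * surd (int D) b"
    (is "?C * (?A * ?B - ?A - ?B) = _")
  proof -
    have "?A \<noteq> 0" "?B \<noteq> 0" "?C \<noteq> 0" using abc(1) by auto
    then have "?B * ?C + ?A * ?C + ?A * ?B = ?A * ?B * ?C" using sum by (simp add: field_simps)
    then show ?thesis by algebra
  qed
  have c_real: "snd c = 0" if y: "snd a = 0" "snd b = 0"
  proof -
    obtain x1 where a: "a = (x1, 0)" using y(1) by (cases a) simp
    obtain x2 where b: "b = (x2, 0)" using y(2) by (cases b) simp
    obtain x3 y3 where c: "c = (x3, y3)" by (cases c)
    have e: "x3 * (x1 * x2 - 2 * (x1 + x2)) = 2 * (x1 * x2)" "y3 * (x1 * x2 - 2 * (x1 + x2)) = 0"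
      using surd_quotient_equations[of "int D" x3 y3 x1 0 x2 0] eq D0 by (simp_all add: a b c)
    have "x1 \<noteq> 0" "x2 \<noteq> 0" using abc(1) by (auto simp: a b complex_eq_iff)
    then have "x3 * (x1 * x2 - 2 * (x1 + x2)) \<noteq> 0" unfolding e(1) by simp
    then have "y3 = 0" using e(2) by (simp only: mult_eq_0_iff) simp
    then show ?thesis by (simp add: c)
  qed
  have surdE: "surd E a = surd (int D) a" "surd E b = surd (int D) b" "surd E c = surd (int D) c"
    using c_real by (cases a; cases b; cases c; auto simp: E_def)+
  have E0: "E > 0" using D0 by (simp add: E_def)
  have intE: "4 dvd fst a * fst a + E * (snd a * snd a)" "4 dvd fst b * fst b + E * (snd b * snd b)"
    "4 dvd fst c * fst c + E * (snd c * snd c)"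
    using abc(2-4) c_real by (cases a; cases b; cases c; auto simp: E_def integral_coords.simps[OF D0])+
  have six: "6 \<le> (8::nat)" by simp
  have nz: "surd E a \<noteq> 0" "surd E a \<noteq> 1" "surd E b \<noteq> 0" "surd E b \<noteq> 1" using abc(1) unfolding surdE by auto
  have half: "Re (inverse (surd (int D) a)) \<le> 1 / 2"
    using integral_Re_inverse_le[OF E0 nz(2) intE(1)] unfolding surdE .
  have "2 \<le> real 6 * Re (inverse (surd E a))" "2 \<le> real 8 * Re (inverse (surd E b))"
    using sumR le half unfolding surdE of_nat_numeral by linarith+
  note a = in_horodiscI[OF E0 nz(1,2) intE(1) this(1) zero_less_numeral six, unfolded of_nat_numeral]
    and b = in_horodiscI[OF E0 nz(3,4) intE(2) this(2) zero_less_numeral order.refl, unfolded of_nat_numeral]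
  have "E \<in> set [1, 2, 3, 5, 6, 7, 10, 11, 13, 14, 15]"
  proof (cases "snd a = 0 \<and> snd b = 0")
    case True
    then show ?thesis by (simp add: E_def)
  next
    case False
    then obtain y where "y \<noteq> 0" "int D * (y * y) \<le> 16" using a(2) b(2) by (auto simp: E_def)
    moreover have "y * y \<ge> 1" using \<open>y \<noteq> 0\<close> by (smt (verit) zero_less_mult_iff)
    then have "int D * 1 \<le> int D * (y * y)" by (intro mult_left_mono) auto
    ultimately have "D \<le> 16" by linarith
    then show ?thesis unfolding E_def using squarefree_le_16[OF D] False by simp
  qed
  then have "check_first catalogue E grid grid"
    using check_discriminants_sound[OF enumeration[folded catalogue_def]] by blast
  then have "check_pair catalogue E a b"
    using check_second_sound[OF check_first_sound[OF _ a(3,1)] b(3,1)] by blast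
  moreover have "surd E c * (surd E a * surd E b - surd E a - surd E b) = surd E a * surd E b"
    unfolding surdE by (rule eq)
  moreover have "surd E a * surd E b \<noteq> 0" using nz by (simp del: surd.simps)
  ultimately have "some_pair_matches catalogue E (one_minus a) (one_minus b) (one_minus c)"
    using E0 intE(3) by (intro check_pair_sound)
  moreover have "E = int D \<or> E = 1 \<and> snd (one_minus a) = 0 \<and> snd (one_minus b) = 0 \<and> snd (one_minus c) = 0"
    using c_real by (cases a; cases b; cases c; auto simp: E_def)
  ultimately have "some_pair_catalogued D (surd E (one_minus a)) (surd E (one_minus b)) (surd E (one_minus c))"
    by (rule some_pair_matches_catalogued)
  then show ?thesis unfolding surd_one_minus surdE .
qed

lemma some_pair_catalogued_commute:
  "some_pair_catalogued D p q r = some_pair_catalogued D q p r"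
  "some_pair_catalogued D p q r = some_pair_catalogued D p r q"
  unfolding some_pair_catalogued_def by auto

theorem unit_fraction_sum_catalogued:
  assumes D: "squarefree D" and p: "p \<in> imag_quadratic_integers D" "p \<noteq> 0" "p \<noteq> 1"
    and q: "q \<in> imag_quadratic_integers D" "q \<noteq> 0" "q \<noteq> 1"
    and r: "r \<in> imag_quadratic_integers D" "r \<noteq> 0" "r \<noteq> 1"
    and sum: "inverse (1 - p) + inverse (1 - q) + inverse (1 - r) = 1"
  shows "some_pair_catalogued D p q r"
proof -
  have D0: "D > 0" using D by (metis not_squarefree_0 neq0_conv)
  have coords: "\<exists>a. 1 - x = surd (int D) a \<and> integral_coords D a" if x: "x \<in> imag_quadratic_integers D" for x
  proof -
    obtain u v where uv: "x = surd (int D) (u, v)" "integral_coords D (u, v)"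
      using ring_of_integers_coords[OF D0 D x] by blast
    have "(2 - u) * (2 - u) + int D * (- v * - v) = 4 * (1 - u) + (u * u + int D * (v * v))"
      by (simp add: algebra_simps)
    then have "integral_coords D (2 - u, - v)"
      using uv(2) unfolding integral_coords.simps[OF D0] by (metis dvd_add dvd_triv_left)
    moreover have "1 - x = surd (int D) (2 - u, - v)" by (simp add: uv(1) complex_eq_iff field_simps)
    ultimately show ?thesis by blast
  qed
  have main: "some_pair_catalogued D x y z"
    if xyz: "x \<in> imag_quadratic_integers D" "x \<noteq> 0" "x \<noteq> 1" "y \<in> imag_quadratic_integers D" "y \<noteq> 0" "y \<noteq> 1"
      "z \<in> imag_quadratic_integers D" "z \<noteq> 0" "z \<noteq> 1"
      "inverse (1 - x) + inverse (1 - y) + inverse (1 - z) = 1"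
      "Re (inverse (1 - y)) \<le> Re (inverse (1 - x))" "Re (inverse (1 - z)) \<le> Re (inverse (1 - y))" for x y z
  proof -
    obtain a b c where e: "1 - x = surd (int D) a" "integral_coords D a" "1 - y = surd (int D) b" "integral_coords D b"
      "1 - z = surd (int D) c" "integral_coords D c" using coords[OF xyz(1)] coords[OF xyz(4)] coords[OF xyz(7)] by blast
    have "{1 - x, 1 - y, 1 - z} \<inter> {0, 1} = {}" using xyz by auto
    then have "some_pair_catalogued D (1 - (1 - x)) (1 - (1 - y)) (1 - (1 - z))"
      using xyz(10-12) e(2,4,6) unfolding e(1,3,5) by (intro sorted_triple_catalogued[OF D])
    then show ?thesis by simp
  qed
  let ?R = "\<lambda>x. Re (inverse (1 - x))"
  have s: "inverse (1 - p) + inverse (1 - r) + inverse (1 - q) = 1" "inverse (1 - q) + inverse (1 - p) + inverse (1 - r) = 1"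
    "inverse (1 - q) + inverse (1 - r) + inverse (1 - p) = 1" "inverse (1 - r) + inverse (1 - p) + inverse (1 - q) = 1"
    "inverse (1 - r) + inverse (1 - q) + inverse (1 - p) = 1"
    using sum by (simp_all add: algebra_simps)
  consider "?R q \<le> ?R p \<and> ?R r \<le> ?R q" | "?R r \<le> ?R p \<and> ?R q \<le> ?R r" | "?R p \<le> ?R q \<and> ?R r \<le> ?R p" |
    "?R r \<le> ?R q \<and> ?R p \<le> ?R r" | "?R p \<le> ?R r \<and> ?R q \<le> ?R p" | "?R q \<le> ?R r \<and> ?R p \<le> ?R q" by argo
  then show ?thesis
  proof cases
    case 1 then show ?thesis using main[OF p q r sum] by blast
  next
    case 2 then show ?thesis using main[OF p r q s(1)] some_pair_catalogued_commute by metis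
  next
    case 3 then show ?thesis using main[OF q p r s(2)] some_pair_catalogued_commute by metis
  next
    case 4 then show ?thesis using main[OF q r p s(3)] some_pair_catalogued_commute by metis
  next
    case 5 then show ?thesis using main[OF r p q s(4)] some_pair_catalogued_commute by metis
  next
    case 6 then show ?thesis using main[OF r q p s(5)] some_pair_catalogued_commute by metis
  qed
qed

section \<open>Factorizations of 8 and 9 in quadratic fields\<close>

lemma integral_coords_parity:
  assumes "4 dvd t * t + int D * (y * y)"
  shows "even t \<longleftrightarrow> even (int D * y)"
proof -
  have "even (t * t + int D * (y * y))" using assms by (rule dvd_trans[rotated]) simp
  then show ?thesis by auto
qed

text \<open>
  Membership in the ring of integers in terms of coordinates, for which closure under the ring operations is a matter of
  parity.
\<close>

definition quadratic_integer :: "nat \<Rightarrow> complex \<Rightarrow> bool" where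
  "quadratic_integer D x \<longleftrightarrow> (\<exists>t y. x = surd (int D) (t, y) \<and> 4 dvd t * t + int D * (y * y))"

lemma quadratic_integer_of_int: "quadratic_integer D (of_int n)"
  unfolding quadratic_integer_def by (intro exI[of _ "2 * n"] exI[of _ 0]) (simp add: complex_eq_iff)

lemma quadratic_integer_minus:
  assumes "quadratic_integer D x"
  shows "quadratic_integer D (- x)"
proof -
  obtain t y where "x = surd (int D) (t, y)" "4 dvd t * t + int D * (y * y)"
    using assms unfolding quadratic_integer_def by blast
  then show ?thesis unfolding quadratic_integer_def
    by (intro exI[of _ "- t"] exI[of _ "- y"]) (simp add: complex_eq_iff)
qed

lemma quadratic_integer_add:
  assumes "quadratic_integer D x" "quadratic_integer D x'"
  shows "quadratic_integer D (x + x')"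
proof -
  obtain t y t' y' where x: "x = surd (int D) (t, y)" "4 dvd t * t + int D * (y * y)"
    and x': "x' = surd (int D) (t', y')" "4 dvd t' * t' + int D * (y' * y')"
    using assms unfolding quadratic_integer_def by blast
  have "even (t * t' + int D * (y * y'))"
    using integral_coords_parity[OF x(2)] integral_coords_parity[OF x'(2)] by auto
  then obtain k where "t * t' + int D * (y * y') = 2 * k" by (rule evenE)
  then have "4 dvd 2 * (t * t' + int D * (y * y'))" by simp
  then have "4 dvd (t * t + int D * (y * y)) + (t' * t' + int D * (y' * y')) + 2 * (t * t' + int D * (y * y'))"
    using dvd_add[OF dvd_add[OF x(2) x'(2)]] by blast
  also have "\<dots> = (t + t') * (t + t') + int D * ((y + y') * (y + y'))" by (simp add: algebra_simps)
  finally show ?thesis unfolding quadratic_integer_def x(1) x'(1)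
    by (intro exI[of _ "t + t'"] exI[of _ "y + y'"]) (simp add: complex_eq_iff field_simps)
qed

lemma quadratic_integer_diff:
  "quadratic_integer D x \<Longrightarrow> quadratic_integer D x' \<Longrightarrow> quadratic_integer D (x - x')"
  using quadratic_integer_add[of D x "- x'"] quadratic_integer_minus[of D x'] by simp

lemma quadratic_integer_mult:
  assumes "quadratic_integer D x" "quadratic_integer D x'"
  shows "quadratic_integer D (x * x')"
proof -
  obtain t y t' y' where x: "x = surd (int D) (t, y)" "4 dvd t * t + int D * (y * y)"
    and x': "x' = surd (int D) (t', y')" "4 dvd t' * t' + int D * (y' * y')"
    using assms unfolding quadratic_integer_def by blast
  have "even (t * t' - int D * (y * y'))" "even (t * y' + y * t')"
    using integral_coords_parity[OF x(2)] integral_coords_parity[OF x'(2)] by auto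
  then obtain u v where uv: "t * t' - int D * (y * y') = 2 * u" "t * y' + y * t' = 2 * v" by (elim evenE)
  have "4 * 4 dvd (t * t + int D * (y * y)) * (t' * t' + int D * (y' * y'))"
    using x(2) x'(2) by (rule mult_dvd_mono)
  also have "\<dots> = (t * t' - int D * (y * y')) * (t * t' - int D * (y * y')) + int D * ((t * y' + y * t') * (t * y' + y * t'))"
    by (simp add: algebra_simps)
  also have "\<dots> = 4 * (u * u + int D * (v * v))" unfolding uv by (simp add: algebra_simps)
  finally have int: "4 dvd u * u + int D * (v * v)" by (simp only: dvd_mult_cancel_left) simp
  have s: "sqrt (real D) * sqrt (real D) = real D" by simp
  have "x * x' = surd (int D) (u, v)"
  proof -
    have "Re (x * x') = of_int (t * t' - int D * (y * y')) / 4" "Im (x * x') = of_int (t * y' + y * t') * sqrt (real D) / 4"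
      unfolding x(1) x'(1) by (simp_all add: field_simps)
    then show ?thesis unfolding uv by (simp add: complex_eq_iff)
  qed
  then show ?thesis using int unfolding quadratic_integer_def by blast
qed

text \<open>
  With \<open>n\<close> the norm of \<open>u\<close>, the cofactor is \<open>v = N cnj u / n\<close>; this expresses the sum by the coordinates of the smaller
  factor, whose norm is at most \<open>N\<close>.
\<close>

lemma integer_factor_pair:
  assumes D: "D > 0" and u: "quadratic_integer D u" and v: "quadratic_integer D v"
    and uv: "u * v = of_int N" "N > 0" and le: "cmod u \<le> cmod v"
    and sum: "u + v = surd (int D) (S, T)"
  obtains n t y where "0 < n" "n \<le> N" "n dvd N * N" "t * t + int D * (y * y) = 4 * n"
    "n * S = (n + N) * t" "n * T = (n - N) * y"
proof -
  obtain t y where ty: "u = surd (int D) (t, y)" "4 dvd t * t + int D * (y * y)"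
    using u unfolding quadratic_integer_def by blast
  obtain t' y' where ty': "v = surd (int D) (t', y')" "4 dvd t' * t' + int D * (y' * y')"
    using v unfolding quadratic_integer_def by blast
  obtain n where n: "t * t + int D * (y * y) = 4 * n" using ty(2) by blast
  obtain n' where n': "t' * t' + int D * (y' * y') = 4 * n'" using ty'(2) by blast
  have nu: "(cmod u)\<^sup>2 = of_int n" and nv: "(cmod v)\<^sup>2 = of_int n'"
    unfolding ty(1) ty'(1) surd_norm[OF D] n n' by simp_all
  have "(cmod u)\<^sup>2 * (cmod v)\<^sup>2 = (of_int N)\<^sup>2"
    unfolding power_mult_distrib[symmetric] norm_mult[symmetric] uv(1) by simp
  then have "real_of_int (n * n') = of_int (N * N)" unfolding nu nv by (simp add: power2_eq_square)
  then have nn: "n * n' = N * N" by (simp only: of_int_eq_iff)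
  have "u \<noteq> 0" using uv by auto
  then have "real_of_int n > 0" unfolding nu[symmetric] by simp
  then have n0: "n > 0" by simp
  have "real_of_int n \<le> of_int n'" unfolding nu[symmetric] nv[symmetric] using le by (simp add: power_mono)
  then have "n * n \<le> n * n'" using n0 by simp
  then have "n * n \<le> N * N" unfolding nn .
  then have nN: "n \<le> N" using n0 uv(2) by (smt (verit) mult_strict_mono)
  have "of_int n * v = of_int N * cnj u"
  proof -
    have "u * cnj u = of_int n" using nu complex_norm_square[of u] by (metis of_real_of_int_eq)
    then have "u * (of_int N * cnj u) = of_int n * (u * v)" unfolding uv(1) by (simp add: mult_ac)
    then have "u * (of_int n * v) = u * (of_int N * cnj u)" by (metis mult.left_commute)
    then show ?thesis using \<open>u \<noteq> 0\<close> by simp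
  qed
  then have "of_int n * surd (int D) (S, T) = of_int n * u + of_int N * cnj u"
    unfolding sum[symmetric] by (simp add: distrib_left)
  then have "real_of_int (n * S) = of_int ((n + N) * t)" "real_of_int (n * T) * sqrt (real D) = of_int ((n - N) * y) * sqrt (real D)"
    using D unfolding ty(1) by (simp_all add: complex_eq_iff field_simps)
  then have "n * S = (n + N) * t" "n * T = (n - N) * y" using D by (simp_all only: mult_cancel_right of_int_eq_iff real_sqrt_eq_0_iff of_nat_eq_0_iff) auto
  then show ?thesis using that n0 nN n nn by (metis dvd_triv_left)
qed

lemma square_le_4: "k * k \<le> 4 \<Longrightarrow> k \<in> {-2, -1, 0, 1, 2}" for k :: int
  using abs_le_square_iff[of k 2] by (auto simp: power2_eq_square)

lemma square_le_36:
  fixes k :: int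
  assumes "k * k \<le> 36"
  shows "k \<in> {-6, -5, -4, -3, -2, -1, 0, 1, 2, 3, 4, 5, 6}"
proof -
  have "- 6 \<le> k" "k \<le> 6" using assms abs_le_square_iff[of k 6] by (auto simp: power2_eq_square)
  then show ?thesis unfolding insert_iff empty_iff by presburger
qed

lemma square_le_multiple: "E > 0 \<Longrightarrow> t * t + E * (y * y) \<le> (c::int) \<Longrightarrow> t * t \<le> c \<and> y * y \<le> c"
proof -
  assume E: "E > 0" and le: "t * t + E * (y * y) \<le> c"
  have "0 \<le> t * t" "0 \<le> (E - 1) * (y * y)" "0 \<le> y * y" "0 \<le> E * (y * y)" using E by simp_all
  moreover have "(E - 1) * (y * y) = E * (y * y) - y * y" by (simp add: algebra_simps)
  ultimately show ?thesis using le by linarith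
qed

text \<open>
  The two imaginary solutions are \<open>\<plusminus> i\<close> and \<open>(\<plusminus> 3 \<plusminus> \<surd>(-3)) / 2\<close>.
\<close>

lemma polynomial_equations:
  fixes E n t y S T x z :: int
  assumes E: "E > 0" "\<not> 4 dvd E" and n: "n \<in> {1, 2, 4, 8}" "t * t + E * (y * y) = 4 * n"
    and eq: "n * (2 * x) = (n + 8) * t" "n * (2 * z) = (n - 8) * y" and int: "4 dvd x * x + E * (z * z)"
  shows "z = 0 \<and> x \<in> {-6, -4, -2, 0, 2, 4, 6} \<or> E = 1 \<and> x = 0 \<and> z \<in> {-2, 2} \<or>
    E = 3 \<and> x \<in> {-3, 3} \<and> z \<in> {-1, 1}"
proof -
  consider "n = 1" | "n = 2" | "n = 4" | "n = 8" using n(1) by auto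
  then show ?thesis
  proof cases
    case 1
    have "2 * x = 9 * t" "2 * z = - 7 * y" using eq 1 by simp_all
    moreover from this have "even t" "even y" by presburger+
    then obtain t' y' where "t = 2 * t'" "y = 2 * y'" by (elim evenE)
    ultimately have e: "t = 2 * t'" "x = 9 * t'" "y = 2 * y'" "z = - 7 * y'" by simp_all
    have "x * x + E * (z * z) = 32 * (t' * t') + 49"
      using n(2) unfolding e 1 by (simp add: algebra_simps)
    then show ?thesis using int by presburger
  next
    case 2
    have "2 * x = 5 * t" "2 * z = - 3 * y" using eq 2 by simp_all
    moreover from this have "even t" "even y" by presburger+
    then obtain t' y' where "t = 2 * t'" "y = 2 * y'" by (elim evenE)
    ultimately have e: "t = 2 * t'" "x = 5 * t'" "y = 2 * y'" "z = - 3 * y'" by simp_all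
    have "x * x + E * (z * z) = 16 * (t' * t') + 18"
      using n(2) unfolding e 2 by (simp add: algebra_simps)
    then show ?thesis using int by presburger
  next
    case 3
    have "2 * x = 3 * t" "y = - 2 * z" using eq 3 by simp_all
    moreover from this have "even t" by presburger
    then obtain t' where "t = 2 * t'" by (elim evenE)
    ultimately have e: "t = 2 * t'" "x = 3 * t'" "y = - 2 * z" by simp_all
    have q: "t' * t' + E * (z * z) = 4" using n(2) unfolding e 3 by (simp add: algebra_simps)
    then have "t' \<in> {-2, -1, 0, 1, 2}" "z \<in> {-2, -1, 0, 1, 2}"
      using square_le_multiple[OF E(1), of t' z 4] square_le_4 by auto
    then show ?thesis using q E int unfolding e by auto
  next
    case 4
    have e: "x = t" "z = 0" using eq 4 by simp_all
    have "x * x \<le> 36" using square_le_multiple[OF E(1), of t y 32] n(2) by (simp add: e 4)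
    moreover have "even x" using int e(2) dvd_trans[of 2 4 "x * x"] by simp
    ultimately show ?thesis using square_le_36[of x] e(2) by auto
  qed
qed

lemma parabolic_equations:
  fixes E n t y x z :: int
  assumes E: "E > 0" and n: "n \<in> {1, 3, 9}" "t * t + E * (y * y) = 4 * n"
    and eq: "n * (4 * x + 4) = (n + 9) * t" "n * (4 * z) = (n - 9) * y" and int: "4 dvd x * x + E * (z * z)"
  shows "z = 0 \<and> x \<in> {-6, -4, -2, 0, 2, 4} \<or> E = 3 \<and> x = - 1 \<and> z \<in> {-1, 1}"
proof -
  consider "n = 1" | "n = 3" | "n = 9" using n(1) by auto
  then show ?thesis
  proof cases
    case 1
    have "2 * x + 2 = 5 * t" "z = - 2 * y" using eq 1 by simp_all
    moreover from this have "even t" by presburger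
    then obtain t' where "t = 2 * t'" by (elim evenE)
    ultimately have e: "t = 2 * t'" "x = 5 * t' - 1" "z = - 2 * y" by simp_all
    have q: "4 * (t' * t') + E * (y * y) = 4" using n(2) unfolding e 1 by (simp add: algebra_simps)
    have "E * (z * z) = 4 * (E * (y * y))" by (simp add: e)
    moreover obtain k where "x * x + E * (z * z) = 4 * k" using int by blast
    then have "x * x = 4 * k - E * (z * z)" by (simp only: eq_diff_eq)
    ultimately have "x * x = 2 * (2 * k - 2 * (E * (y * y)))" by (simp only: right_diff_distrib)
    then have "even (x * x)" by (metis dvd_triv_left)
    then have "odd t'" by (simp add: e)
    moreover have "t' \<in> {-2, -1, 0, 1, 2}"
      using square_le_multiple[OF E, of "2 * t'" y 4] q square_le_4[of t'] by auto
    ultimately have t': "t' = 1 \<or> t' = - 1" by auto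
    then have "E * (y * y) = 0" using q by auto
    then show ?thesis using t' E by (auto simp: e)
  next
    case 2
    have "x = t - 1" "y = - 2 * z" using eq 2 by simp_all
    then have q: "t * t + 4 * (E * (z * z)) = 12" using n(2) by (simp add: 2)
    then have "t * t = 2 * (6 - 2 * (E * (z * z)))" by simp
    then have "even (t * t)" by (metis dvd_triv_left)
    then have "even t" by simp
    then obtain t' where t': "t = 2 * t'" by blast
    have q': "t' * t' + E * (z * z) = 3" using q by (simp add: t')
    have "x * x + E * (z * z) = 3 * (t' * t') - 4 * t' + 4"
    proof -
      have "x = 2 * t' - 1" "E * (z * z) = 3 - t' * t'" using q' \<open>x = t - 1\<close> by (simp_all add: t')
      then show ?thesis by (simp only:) (simp add: algebra_simps)
    qed
    then have "even (3 * (t' * t') - 4 * t' + 4)" using int dvd_trans[of 2 4 "x * x + E * (z * z)"] by simp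
    then have "even t'" by simp
    moreover have tz: "t' \<in> {-2, -1, 0, 1, 2}" "z \<in> {-2, -1, 0, 1, 2}"
      using square_le_multiple[OF E, of t' z 3] q' square_le_4[of t'] square_le_4[of z] by auto
    moreover have "t' * t' \<le> 3" using square_le_multiple[OF E, of t' z 3] q' by simp
    ultimately have "t' = 0" by auto
    moreover have "E * 4 \<noteq> 3" by presburger
    ultimately show ?thesis using q' tz(2) \<open>x = t - 1\<close> by (auto simp: t')
  next
    case 3
    have e: "t = 2 * (x + 1)" "z = 0" using eq 3 by simp_all
    have "t \<in> {-6, -5, -4, -3, -2, -1, 0, 1, 2, 3, 4, 5, 6}"
      using square_le_multiple[OF E, of t y 36] n(2) square_le_36[of t] by (simp add: 3)
    then have "- 4 \<le> x" "x \<le> 2" unfolding e by auto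
    moreover have "even x" using int e(2) dvd_trans[of 2 4 "x * x"] by simp
    ultimately have "x \<in> {-4, -2, 0, 2}" unfolding insert_iff empty_iff by presburger
    then show ?thesis using e(2) by auto
  qed
qed

lemma quadratic_integer_square_root:
  assumes D: "D > 0" "squarefree D" and h: "h \<in> imag_quadratic_field D" and sq: "quadratic_integer D (h\<^sup>2)"
  shows "quadratic_integer D h"
proof -
  obtain t y where "h\<^sup>2 = surd (int D) (t, y)" "4 dvd t * t + int D * (y * y)"
    using sq unfolding quadratic_integer_def by blast
  then obtain t' y' where "h = surd (int D) (t', y')" "integral_coords D (t', y')"
    using square_root_coords[OF D h] integral_coords.simps[OF D(1)] by blast
  then show ?thesis unfolding quadratic_integer_def integral_coords.simps[OF D(1)] by blast
qed

lemma imag_quadratic_integers_quadratic_integer: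
  assumes D: "D > 0" "squarefree D" and x: "x \<in> imag_quadratic_integers D"
  shows "quadratic_integer D x"
  using ring_of_integers_coords[OF D x] unfolding quadratic_integer_def integral_coords.simps[OF D(1)] by blast

lemma quadratic_integer_in_field:
  assumes "D > 0" "quadratic_integer D x"
  shows "x \<in> imag_quadratic_field D"
  using assms(2) unfolding quadratic_integer_def field_iff[OF assms(1)] by (auto simp: mult.assoc)

lemma squarefree_not_4_dvd: "squarefree D \<Longrightarrow> \<not> 4 dvd int D"
proof
  assume D: "squarefree D" "4 dvd int D"
  have "int 4 dvd int D" using D(2) by simp
  then have "2\<^sup>2 dvd D" by (simp only: int_dvd_int_iff) simp
  then have "is_unit (2::nat)" by (rule squarefreeD[OF D(1)])
  then show False by simp
qed

lemma integer_square_difference: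
  assumes D: "D > 0" "squarefree D" and u: "quadratic_integer D u" and h: "quadratic_integer D h"
    and eq: "h\<^sup>2 = u\<^sup>2 - of_int N" "N > 0" and u2: "2 * u = surd (int D) (S, T)"
  obtains n t y where "0 < n" "n \<le> N" "n dvd N * N" "t * t + int D * (y * y) = 4 * n"
    "n * S = (n + N) * t" "n * T = (n - N) * y"
proof -
  have f: "(u - h) * (u + h) = of_int N" "(u + h) * (u - h) = of_int N"
    using eq(1) by (simp_all add: algebra_simps power2_eq_square)
  have s: "(u - h) + (u + h) = surd (int D) (S, T)" "(u + h) + (u - h) = surd (int D) (S, T)"
    using u2 by simp_all
  note q = quadratic_integer_diff[OF u h] quadratic_integer_add[OF u h]
  show ?thesis
  proof (cases "cmod (u - h) \<le> cmod (u + h)")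
    case True
    show ?thesis using integer_factor_pair[OF D(1) q f(1) eq(2) True s(1)] that by blast
  next
    case False
    then have "cmod (u + h) \<le> cmod (u - h)" by simp
    then show ?thesis using integer_factor_pair[OF D(1) q(2,1) f(2) eq(2) _ s(2)] that by blast
  qed
qed

lemma divisors_64:
  fixes n :: int
  assumes "0 < n" "n \<le> 8" "n dvd 8 * 8"
  shows "n \<in> {1, 2, 4, 8}"
proof -
  have "n \<in> {1, 2, 3, 4, 5, 6, 7, 8}" using assms(1,2) unfolding insert_iff empty_iff by presburger
  then show ?thesis using assms(3) by auto
qed

lemma divisors_81:
  fixes n :: int
  assumes "0 < n" "n \<le> 9" "n dvd 9 * 9"
  shows "n \<in> {1, 3, 9}"
proof -
  have "n \<in> {1, 2, 3, 4, 5, 6, 7, 8, 9}" using assms(1,2) unfolding insert_iff empty_iff by presburger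
  then show ?thesis using assms(3) by auto
qed

lemma primitive_cube_root_coords:
  assumes D: "D > 0" and p: "p = surd (int D) (x, y)" "p\<^sup>2 + p + 1 = 0"
  shows "D = 3 \<and> x = - 1 \<and> y \<in> {-1, 1}"
proof -
  define s where "s = sqrt (real D)"
  have s: "s * s = real D" "s > 0" using D by (simp_all add: s_def)
  have "Re (p\<^sup>2 + p + 1) = 0" "Im (p\<^sup>2 + p + 1) = 0" using p(2) by simp_all
  then have re: "(real_of_int x * real_of_int x - of_int y * of_int y * (s * s)) / 4 + real_of_int x / 2 + 1 = 0"
    and im: "(real_of_int x + 1) * of_int y * s = 0"
    unfolding p(1) by (simp_all add: power2_eq_square s_def[symmetric] field_simps)
  have "real_of_int (x * x - int D * (y * y) + 2 * x + 4) = of_int 0"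
    using re unfolding s(1) by (simp add: field_simps)
  then have re': "x * x - int D * (y * y) + 2 * x + 4 = 0" by (simp only: of_int_eq_iff)
  have "y \<noteq> 0"
  proof
    assume "y = 0"
    then have "(x + 1) * (x + 1) = - 3" using re' by (simp add: algebra_simps)
    then show False by (metis zero_le_square neg_0_le_iff_le not_numeral_le_zero)
  qed
  then have "real_of_int (x + 1) = of_int 0" using im s(2) by simp
  then have "x + 1 = 0" by (simp only: of_int_eq_iff)
  then have x: "x = - 1" by simp
  then have Dy: "int D * (y * y) = 3" using re' by simp
  moreover have "int D * 4 \<noteq> 3" by presburger
  moreover have "y \<in> {-2, -1, 0, 1, 2}"
    using square_le_multiple[of "int D" 0 y 3] D Dy square_le_4[of y] by auto
  ultimately show ?thesis using x by auto
qed

section \<open>Classification\<close>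

lemma family_key_not_integral:
  assumes "squarefree D" "k \<in> family_key ` set cycle_table" "matches (int D) c d k"
    and "p = surd (int D) c" "q = surd (int D) d"
  shows "\<not> integral_cycles D p q 0 1"
  using assms matched_not_integral[OF assms(1)] by blast

lemma degenerate_family_keys:
  "{(1, (6, 0), (0, 0)), (1, (2, 2), (0, 0)), (3, (5, 1), (0, 0)), (1, (2, 0), (-6, 0)), (1, (2, 0), (-4, 0)),
    (1, (2, 0), (-2, 0)), (1, (2, 0), (0, 0)), (1, (2, 0), (4, 0)), (3, (2, 0), (-1, 1))}
   \<subseteq> family_key ` set cycle_table"
  by (simp add: cycle_table_def cycle_table_1_def cycle_table_2_def cycle_table_3_def cycle_table_4_def
      cycle_table_5_def cycle_table_6_def cycle_table_7_def cycle_table_8_def)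

text \<open>
  The discriminant of the equation for the 3-cycles is \<open>b\<^sup>2 - 8\<close> with \<open>b = p - 1\<close>, so \<open>b\<^sup>2 - h\<^sup>2 = 8\<close> in the ring. The finite
  fixed points have multipliers \<open>p\<close> and \<open>2 - p\<close>, and either may be used to exclude a solution. The four values left are the
  square map and the Chebyshev map.
\<close>

theorem polynomial_family:
  assumes D: "D > 0" "squarefree D" and p: "quadratic_integer D p" "p \<noteq> 1"
    and int: "integral_cycles D p 0 0 1" "integral_cycles D (2 - p) 0 0 1"
  shows "p \<in> {0, 2, 4, - 2}"
proof (rule ccontr)
  assume np: "p \<notin> {0, 2, 4, - 2}"
  obtain x y where xy: "p = surd (int D) (x, y)" "4 dvd x * x + int D * (y * y)"
    using p(1) unfolding quadratic_integer_def by blast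
  have xy': "2 - p = surd (int D) (4 - x, - y)" by (simp add: xy(1) complex_eq_iff field_simps)
  have z: "0 = surd (int D) (0, 0)" by (simp add: complex_eq_iff)
  have no: "\<not> matches (int D) (x, y) (0, 0) k" "\<not> matches (int D) (4 - x, - y) (0, 0) k"
    if "k \<in> family_key ` set cycle_table" for k
    using family_key_not_integral[OF D(2) that _ xy(1) z] family_key_not_integral[OF D(2) that _ xy' z] int by auto
  note keys = degenerate_family_keys[unfolded insert_subset]
  have no6: "\<not> (x = 6 \<and> y = 0)" "\<not> (x = - 2 \<and> y = 0)"
    using no[of "(1, (6, 0), (0, 0))"] keys by auto
  have no2: "\<not> (D = 1 \<and> x = 2 \<and> y \<in> {-2, 2})"
    using no(1)[of "(1, (2, 2), (0, 0))"] keys by auto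
  have no5: "\<not> (D = 3 \<and> x \<in> {5, - 1} \<and> y \<in> {-1, 1})"
    using no[of "(3, (5, 1), (0, 0))"] keys by auto
  have c1: "p\<^sup>2 + p + 1 \<noteq> 0"
    using primitive_cube_root_coords[OF D(1) xy(1)] no5 by auto
  have c2: "(2 - p)\<^sup>2 + (2 - p) + 1 \<noteq> 0"
    using primitive_cube_root_coords[OF D(1) xy'] no5 by auto
  define c where "c = p / 2 - p\<^sup>2 / 4"
  have c4: "4 * c = p * (2 - p)" by (simp add: c_def field_simps power2_eq_square)
  then have c0: "c \<noteq> 0" using np by auto
  obtain s where s: "s\<^sup>2 + s + 2 + c = 0" "quad_cycle p 0 0 1 3 (8 * (1 + c + c * s))"
    using polynomial_three_cycle[OF c1 c2] unfolding c_def by blast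
  define m where "m = 8 * (1 + c + c * s)"
  have "m \<in> imag_quadratic_integers D"
    unfolding m_def by (rule int(1)[unfolded integral_cycles_def, rule_format, OF _ s(2)]) simp
  then have mK: "m \<in> imag_quadratic_field D" by (simp add: imag_quadratic_integers_def)
  have pK: "p \<in> imag_quadratic_field D" using quadratic_integer_in_field[OF D(1) p(1)] .
  have cK: "c \<in> imag_quadratic_field D"
    unfolding c_def by (intro K_diff[OF D(1)] K_divide[OF D(1)] K_power2[OF D(1)] K_numeral[OF D(1)] pK)
  define h where "h = 2 * s + 1"
  have "s = (m / 8 - 1 - c) / c" using c0 by (simp add: m_def field_simps)
  then have "h \<in> imag_quadratic_field D"
    unfolding h_def by (auto intro!: K_diff[OF D(1)] K_add[OF D(1)] K_mult[OF D(1)] K_divide[OF D(1)] K_numeral[OF D(1)] mK cK)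
  moreover have h2: "h\<^sup>2 = (p - 1)\<^sup>2 - of_int 8"
  proof -
    have "h\<^sup>2 = 4 * (s\<^sup>2 + s + 2 + c) - 7 - 4 * c" by (simp add: h_def power2_eq_square algebra_simps)
    also have "\<dots> = (p - 1)\<^sup>2 - of_int 8" unfolding s(1) c4 by (simp add: power2_eq_square algebra_simps)
    finally show ?thesis .
  qed
  moreover have pq: "quadratic_integer D (p - 1)"
    using quadratic_integer_diff[OF p(1) quadratic_integer_of_int[of D 1]] by simp
  moreover have "quadratic_integer D ((p - 1)\<^sup>2 - of_int 8)"
    unfolding power2_eq_square
    by (intro quadratic_integer_diff quadratic_integer_mult quadratic_integer_of_int pq)
  ultimately have h: "quadratic_integer D h" using quadratic_integer_square_root[OF D] by simp
  have u: "2 * (p - 1) = surd (int D) (2 * (x - 2), 2 * y)"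
    by (simp add: xy(1) complex_eq_iff field_simps)
  obtain n t w where n: "0 < n" "n \<le> 8" "n dvd 8 * 8" "t * t + int D * (w * w) = 4 * n"
    "n * (2 * (x - 2)) = (n + 8) * t" "n * (2 * y) = (n - 8) * w"
    using integer_square_difference[OF D pq h h2 _ u] by (metis zero_less_numeral)
  have "(x - 2) * (x - 2) + int D * (y * y) = (x * x + int D * (y * y)) + 4 * (1 - x)" by (simp add: algebra_simps)
  then have "4 dvd (x - 2) * (x - 2) + int D * (y * y)" using xy(2) by (metis dvd_add dvd_triv_left)
  then have "y = 0 \<and> x - 2 \<in> {-6, -4, -2, 0, 2, 4, 6} \<or> int D = 1 \<and> x - 2 = 0 \<and> y \<in> {-2, 2} \<or>
    int D = 3 \<and> x - 2 \<in> {-3, 3} \<and> y \<in> {-1, 1}"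
    using polynomial_equations[OF _ squarefree_not_4_dvd[OF D(2)] divisors_64[OF n(1-3)] n(4-6)] D(1) by simp
  then show False
  proof (elim disjE conjE)
    assume y: "y = 0" and "x - 2 \<in> {-6, -4, -2, 0, 2, 4, 6}"
    then have "x = - 4 \<or> x = - 2 \<or> x = 0 \<or> x = 2 \<or> x = 4 \<or> x = 6 \<or> x = 8" by auto
    moreover have "p = of_int x / 2" by (simp add: xy(1) y complex_eq_iff)
    ultimately show False using np p(2) no6 y by auto
  qed (use no2 no5 in auto)
qed

text \<open>
  The discriminant of the equation for the 3-cycles is \<open>(2 m + 1)\<^sup>2 - 9\<close>, so \<open>9\<close> is a difference of two squares in the ring; no solution
  survives the certificates.
\<close>

theorem parabolic_family:
  assumes D: "D > 0" "squarefree D" and m: "quadratic_integer D m" "m \<noteq> 1"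
    and int: "integral_cycles D m 1 0 1" "integral_cycles D 1 m 0 1"
  shows False
proof -
  obtain x y where xy: "m = surd (int D) (x, y)" "4 dvd x * x + int D * (y * y)"
    using m(1) unfolding quadratic_integer_def by blast
  have one: "1 = surd (int D) (2, 0)" by (simp add: complex_eq_iff)
  have no: "\<not> matches (int D) (2, 0) (x, y) k" if "k \<in> family_key ` set cycle_table" for k
    using family_key_not_integral[OF D(2) that _ one xy(1)] int(2) by auto
  note keys = degenerate_family_keys[unfolded insert_subset]
  have no0: "\<not> (x \<in> {-6, -4, -2, 0, 4} \<and> y = 0)"
    using no[of "(1, (2, 0), (-6, 0))"] no[of "(1, (2, 0), (-4, 0))"] no[of "(1, (2, 0), (-2, 0))"]
      no[of "(1, (2, 0), (0, 0))"] no[of "(1, (2, 0), (4, 0))"] keys by auto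
  have no3: "\<not> (D = 3 \<and> x = - 1 \<and> y \<in> {-1, 1})"
    using no[of "(3, (2, 0), (-1, 1))"] keys by auto
  have c1: "m\<^sup>2 + m + 1 \<noteq> 0"
    using primitive_cube_root_coords[OF D(1) xy(1)] no3 by auto
  define \<gamma> where "\<gamma> = 1 - m"
  have g0: "\<gamma> \<noteq> 0" using m(2) by (simp add: \<gamma>_def)
  obtain v where v: "v\<^sup>2 - 2 * \<gamma> * v + 3 * \<gamma> = 0" "quad_cycle m 1 0 1 3 (19 - 12 * \<gamma> + 2 * \<gamma> * v)"
    using parabolic_three_cycle[OF m(2) c1] unfolding \<gamma>_def by blast
  define l where "l = 19 - 12 * \<gamma> + 2 * \<gamma> * v"
  have "l \<in> imag_quadratic_integers D"
    unfolding l_def by (rule int(1)[unfolded integral_cycles_def, rule_format, OF _ v(2)]) simp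
  then have lK: "l \<in> imag_quadratic_field D" by (simp add: imag_quadratic_integers_def)
  have mK: "m \<in> imag_quadratic_field D" using quadratic_integer_in_field[OF D(1) m(1)] .
  have gK: "\<gamma> \<in> imag_quadratic_field D"
    unfolding \<gamma>_def by (intro K_diff[OF D(1)] K_numeral[OF D(1)] mK)
  define h where "h = 2 * (v - \<gamma>)"
  have "v = (l - 19 + 12 * \<gamma>) / (2 * \<gamma>)" using g0 by (simp add: l_def field_simps)
  then have "h \<in> imag_quadratic_field D"
    unfolding h_def by (auto intro!: K_diff[OF D(1)] K_add[OF D(1)] K_mult[OF D(1)] K_divide[OF D(1)] K_numeral[OF D(1)] lK gK)
  moreover have h2: "h\<^sup>2 = (2 * m + 1)\<^sup>2 - of_int 9"
  proof -
    have "h\<^sup>2 = 4 * (v\<^sup>2 - 2 * \<gamma> * v + 3 * \<gamma>) + 4 * \<gamma>\<^sup>2 - 12 * \<gamma>" by (simp add: h_def power2_eq_square algebra_simps)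
    also have "\<dots> = (2 * m + 1)\<^sup>2 - of_int 9" unfolding v(1) unfolding \<gamma>_def by (simp add: power2_eq_square algebra_simps)
    finally show ?thesis .
  qed
  moreover have uq: "quadratic_integer D (2 * m + 1)"
    using quadratic_integer_add[OF quadratic_integer_mult[OF quadratic_integer_of_int[of D 2] m(1)] quadratic_integer_of_int[of D 1]] by simp
  moreover have "quadratic_integer D ((2 * m + 1)\<^sup>2 - of_int 9)"
    unfolding power2_eq_square
    by (intro quadratic_integer_diff quadratic_integer_of_int quadratic_integer_mult[OF uq uq])
  ultimately have h: "quadratic_integer D h" using quadratic_integer_square_root[OF D] by simp
  have u: "2 * (2 * m + 1) = surd (int D) (4 * x + 4, 4 * y)"
    by (simp add: xy(1) complex_eq_iff field_simps)
  obtain n t w where n: "0 < n" "n \<le> 9" "n dvd 9 * 9" "t * t + int D * (w * w) = 4 * n"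
    "n * (4 * x + 4) = (n + 9) * t" "n * (4 * y) = (n - 9) * w"
    using integer_square_difference[OF D uq h h2 _ u] by (metis zero_less_numeral)
  have "y = 0 \<and> x \<in> {-6, -4, -2, 0, 2, 4} \<or> int D = 3 \<and> x = - 1 \<and> y \<in> {-1, 1}"
    using parabolic_equations[OF _ divisors_81[OF n(1-3)] n(4-6) xy(2)] D(1) by simp
  then show False
  proof (elim disjE conjE)
    assume y: "y = 0" and "x \<in> {-6, -4, -2, 0, 2, 4}"
    moreover have "x \<noteq> 2" using m(2) xy(1) y by (auto simp: complex_eq_iff)
    ultimately show False using no0 by auto
  qed (use no3 in auto)
qed

text \<open>
  The exceptional pairs by algebraic relations: \<open>a\<close> is an integer of norm two, of trace \<open>2\<close>, \<open>0\<close> or \<open>1\<close>, in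
  the fields of discriminant \<open>- 4\<close>, \<open>- 8\<close> and \<open>- 7\<close>.
\<close>

definition lattes_or_inverse_square :: "complex \<Rightarrow> complex \<Rightarrow> bool" where
  "lattes_or_inverse_square x y \<longleftrightarrow> x = - 2 \<and> y = - 2 \<or> (\<exists>a. Im a \<noteq> 0 \<and>
    (a\<^sup>2 = 2 * a - 2 \<and> x = - a \<and> (y = a\<^sup>2 \<or> y = - 4) \<or> a\<^sup>2 = - 2 \<and> x = a \<and> y = - 2 \<or>
     a\<^sup>2 = a - 2 \<and> x = - a \<and> (y = a \<or> y = a - 2)))"

lemma lattes_or_inverse_square_cnj:
  assumes "lattes_or_inverse_square x y"
  shows "lattes_or_inverse_square (cnj x) (cnj y)"
proof -
  have "(cnj a)\<^sup>2 = cnj (a\<^sup>2)" for a by simp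
  then have "Im (cnj a) \<noteq> 0 \<and> ((cnj a)\<^sup>2 = 2 * cnj a - 2 \<and> cnj x = - cnj a \<and> (cnj y = (cnj a)\<^sup>2 \<or> cnj y = - 4) \<or>
      (cnj a)\<^sup>2 = - 2 \<and> cnj x = cnj a \<and> cnj y = - 2 \<or>
      (cnj a)\<^sup>2 = cnj a - 2 \<and> cnj x = - cnj a \<and> (cnj y = cnj a \<or> cnj y = cnj a - 2))"
    if "Im a \<noteq> 0 \<and> (a\<^sup>2 = 2 * a - 2 \<and> x = - a \<and> (y = a\<^sup>2 \<or> y = - 4) \<or> a\<^sup>2 = - 2 \<and> x = a \<and> y = - 2 \<or>
      a\<^sup>2 = a - 2 \<and> x = - a \<and> (y = a \<or> y = a - 2))" for a
    using that by (elim conjE disjE) (simp_all del: complex_cnj_power)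
  note conj = this
  from assms[unfolded lattes_or_inverse_square_def] show ?thesis
  proof
    assume "x = - 2 \<and> y = - 2"
    then show ?thesis unfolding lattes_or_inverse_square_def by simp
  next
    assume "\<exists>a. Im a \<noteq> 0 \<and> (a\<^sup>2 = 2 * a - 2 \<and> x = - a \<and> (y = a\<^sup>2 \<or> y = - 4) \<or> a\<^sup>2 = - 2 \<and> x = a \<and> y = - 2 \<or>
      a\<^sup>2 = a - 2 \<and> x = - a \<and> (y = a \<or> y = a - 2))"
    then show ?thesis unfolding lattes_or_inverse_square_def
      by (elim exE) (rule disjI2, rule exI, erule conj)
  qed
qed

lemma exceptional_cases:
  assumes k: "k \<in> set exceptional" and mt: "matches (int D) c d k"
    and xy: "x = surd (int D) c" "y = surd (int D) d"
  shows "lattes_or_inverse_square x y"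
proof -
  have 1: "lattes_or_inverse_square (surd 1 (-4, 0)) (surd 1 (-4, 0))"
    unfolding lattes_or_inverse_square_def by (intro disjI1) (simp add: complex_eq_iff)
  have 2: "lattes_or_inverse_square (surd 1 (-2, -2)) (surd 1 (0, 4))"
    unfolding lattes_or_inverse_square_def
    by (intro disjI2 exI[of _ "Complex 1 1"]) (simp add: complex_eq_iff power2_eq_square)
  have 3: "lattes_or_inverse_square (surd 1 (-2, 2)) (surd 1 (-8, 0))"
    unfolding lattes_or_inverse_square_def
    by (intro disjI2 exI[of _ "Complex 1 (-1)"]) (simp add: complex_eq_iff power2_eq_square)
  have 4: "lattes_or_inverse_square (surd 2 (0, 2)) (surd 2 (-4, 0))"
    unfolding lattes_or_inverse_square_def
    by (intro disjI2 exI[of _ "Complex 0 (sqrt 2)"]) (simp add: complex_eq_iff power2_eq_square)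
  have 5: "lattes_or_inverse_square (surd 7 (-1, -1)) (surd 7 (1, 1))"
    unfolding lattes_or_inverse_square_def
    by (intro disjI2 exI[of _ "Complex (1 / 2) (sqrt 7 / 2)"]) (simp add: complex_eq_iff power2_eq_square)
  have 6: "lattes_or_inverse_square (surd 7 (-1, 1)) (surd 7 (-3, -1))"
    unfolding lattes_or_inverse_square_def
    by (intro disjI2 exI[of _ "Complex (1 / 2) (- sqrt 7 / 2)"]) (simp add: complex_eq_iff power2_eq_square)
  obtain E c' d' where e: "k = (E, c', d')" by (metis prod.exhaust)
  have G: "lattes_or_inverse_square (surd E c') (surd E d')"
    using k unfolding exceptional_def e list.set insert_iff empty_iff prod.inject
    using 1 2 3 4 5 6 by (elim disjE conjE) (simp_all only: FalseE)
  from mt[unfolded e] show ?thesis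
  proof (cases rule: matches_cases)
    case 1
    then show ?thesis using G xy by (simp only:)
  next
    case 2
    then show ?thesis using lattes_or_inverse_square_cnj[OF G] xy by (simp only:)
  qed
qed

text \<open>
  Each case is matched with a quotient of multiplication by \<open>a\<close> through its \<open>\<kappa>\<close>.
\<close>

lemma exceptional_map:
  assumes f: "rational_map 2 f" "x * y \<noteq> 1" "conjugate f (quadratic x y 0 1)"
    and cases: "lattes_or_inverse_square x y"
  shows "power_map f \<or> lattes_map f"
proof -
  note J = joukowski_lattes_map[OF f(1,3,2)]
  from cases[unfolded lattes_or_inverse_square_def] consider "x = - 2" "y = - 2" |
    a where "Im a \<noteq> 0" "a\<^sup>2 = 2 * a - 2" "x = - a" "y = a\<^sup>2" | a where "Im a \<noteq> 0" "a\<^sup>2 = 2 * a - 2" "x = - a" "y = - 4" |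
    a where "Im a \<noteq> 0" "a\<^sup>2 = - 2" "x = a" "y = - 2" | a where "Im a \<noteq> 0" "a\<^sup>2 = a - 2" "x = - a" "y = a" |
    a where "Im a \<noteq> 0" "a\<^sup>2 = a - 2" "x = - a" "y = a - 2" by blast
  then show ?thesis
  proof cases
    case 1
    then show ?thesis using inverse_square_power_map f(1,3) by blast
  next
    case (2 a)
    have a4: "a^4 = - 4" using 2(2) by algebra
    have "uniformized (qmap 1 0 1 0 (a\<^sup>2) 0)"
      by (rule even_trace_uniformized[OF 2(1), of 2]) (use 2(2) a4 in simp_all)
    moreover have "y * (x + 1) - 2 = 0" using 2(2) unfolding 2(3,4) by algebra
    moreover have "a \<noteq> 0" using 2(1) by auto
    ultimately show ?thesis using J[of 0] 2(4) by simp
  next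
    case (3 a)
    have a4: "a^4 = - 4" using 3(2) by algebra
    have "uniformized (qmap 1 2 1 0 (- 4) 0)"
      by (rule squaring_quotient_uniformized[OF 3(1), of 2]) (use 3(2) a4 in simp_all)
    moreover have "2\<^sup>2 * (1 - x * y) = (y * (x + 1) - 2)\<^sup>2" using 3(2) unfolding 3(3,4) by algebra
    ultimately show ?thesis using J[of 2] 3(4) by simp
  next
    case (4 a)
    have a4: "a^4 = 4" using 4(2) by algebra
    \<comment> \<open>The square of \<open>\<kappa>\<close> is \<open>4 + a^4\<close> with \<open>a^4 = 4\<close>.\<close>
    obtain \<kappa> :: complex where k: "\<kappa>\<^sup>2 = 8" by (metis power2_csqrt)
    have "uniformized (qmap 1 \<kappa> 1 0 (a\<^sup>2) 0)"
      by (rule even_trace_uniformized[OF 4(1), of 0]) (use 4(2) a4 k in simp_all)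
    moreover have "\<kappa>\<^sup>2 * (1 - x * y) = (y * (x + 1) - 2)\<^sup>2" using 4(2) unfolding 4(3,4) k by algebra
    ultimately show ?thesis using J[of \<kappa>] 4(2,4) by simp
  next
    case (5 a)
    have "uniformized (qmap 1 0 1 0 a 0)"
      by (rule trace_one_joukowski_uniformized[OF 5(1,2)])
    moreover have "y * (x + 1) - 2 = 0" using 5(2) unfolding 5(3,4) by algebra
    moreover have "a \<noteq> 0" using 5(1) by auto
    ultimately show ?thesis using J[of 0] 5(4) by simp
  next
    case (6 a)
    have "a\<^sup>2 = of_int 1 * a - 2" using 6(2) by simp
    then have "uniformized (qmap 1 2 1 0 (a\<^sup>2) 0)"
      by (rule odd_trace_uniformized(1)[OF 6(1)]) simp
    moreover have "2\<^sup>2 * (1 - x * y) = (y * (x + 1) - 2)\<^sup>2" using 6(2) unfolding 6(3,4) by algebra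
    moreover have "a\<^sup>2 \<noteq> 0" using 6(1) by auto
    ultimately show ?thesis using J[of 2] 6(2,4) by simp
  qed
qed

lemma inverse_sum_eq_1:
  fixes a b c :: complex
  assumes "b * c + a * c + a * b = a * b * c" "a \<noteq> 0" "b \<noteq> 0" "c \<noteq> 0"
  shows "inverse a + inverse b + inverse c = 1"
proof -
  have "inverse a + inverse b + inverse c = (b * c + a * c + a * b) / (a * b * c)"
    using assms(2-4) by (simp add: field_simps)
  then show ?thesis unfolding assms(1) using assms(2-4) by simp
qed

lemma fixed_point_cycle: "quad_cycle p q 0 1 1 p"
  unfolding quad_cycle_def by (intro conjI exI[of _ 0]) (simp_all add: quad_def quad_deriv_def)

theorem theorem9:
  fixes D :: nat and f :: "rsphere \<Rightarrow> rsphere"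
  assumes "D > 0" and "squarefree D"
    and "rational_map 2 f"
    and "\<And>n C x. is_cycle f n C \<Longrightarrow> n \<le> 5 \<Longrightarrow> x \<in> C \<Longrightarrow>
           multiplier f x \<in> imag_quadratic_integers D"
  shows "power_map f \<or> chebyshev_map f \<or> lattes_map f"
proof -
  note D = assms(1,2) and f = assms(3)
  have int: "integral_cycles D p q s t" if cj: "conjugate f (quadratic p q s t)" for p q s t
    unfolding integral_cycles_def
  proof (intro allI impI)
    fix n m assume n: "n \<le> 5" and m: "quad_cycle p q s t n m"
    obtain x where x: "is_cycle f n (forward_orbit f x)" "multiplier f x = m"
      using multiplier_of_conjugate[OF cj m] by blast
    have "x \<in> forward_orbit f x" unfolding forward_orbit_def by (rule CollectI, rule exI[of _ 0]) simp
    then have "multiplier f x \<in> imag_quadratic_integers D" by (rule assms(4)[OF x(1) n])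
    then show "m \<in> imag_quadratic_integers D" unfolding x(2) .
  qed
  define N where "N = (\<lambda>p q. p * q \<noteq> 1 \<and> conjugate f (quadratic p q 0 1))"
  have swap: "N q p" if "N p q" for p q
    using that quadratic_swap[of p q] conjugate_trans unfolding N_def by (metis mult.commute)
  have third: "N p ((2 - p - q) / (1 - p * q))" if "N p q" "p \<noteq> 1" "q \<noteq> 1" for p q
    using that quadratic_third_fixed_point[of p q] conjugate_trans unfolding N_def by metis
  have mult: "p \<in> imag_quadratic_integers D" if "N p q" for p q
    using that unfolding N_def
    by (intro int[unfolded integral_cycles_def, rule_format, OF _ _ fixed_point_cycle]) auto
  have cyc: "integral_cycles D p q 0 1" if "N p q" for p q using int that unfolding N_def by blast
  have qi: "quadratic_integer D p" if "N p q" for p q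
    using imag_quadratic_integers_quadratic_integer[OF D mult[OF that]] .
  have parabolic: False if N: "N 1 m" for m
  proof -
    have "m \<noteq> 1" using N by (auto simp: N_def)
    then show False using parabolic_family[OF D qi[OF swap[OF N]] _ cyc[OF swap[OF N]] cyc[OF N]] by blast
  qed
  have polynomial: ?thesis if N: "N p 0" for p
  proof -
    have p1: "p \<noteq> 1" using parabolic N by blast
    have "N 0 ((2 - 0 - p) / (1 - 0 * p))" using third[OF swap[OF N]] p1 by simp
    then have N': "N (2 - p) 0" using swap by simp
    have "p \<in> {0, 2, 4, - 2}"
      using polynomial_family[OF D qi[OF N] p1 cyc[OF N] cyc[OF N']] .
    then show ?thesis
      using square_power_map[OF f, of p] quadratic_chebyshev_map[OF f, of p] N unfolding N_def by auto
  qed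
  have catalogued: ?thesis if N: "N p q" and "catalogued D p q" for p q
  proof -
    obtain k c d where k: "k \<in> set catalogue" "matches (int D) c d k" "p = surd (int D) c" "q = surd (int D) d"
      using \<open>catalogued D p q\<close> unfolding catalogued_def by blast
    have "k \<notin> family_key ` set cycle_table"
      using family_key_not_integral[OF D(2) _ k(2-4)] cyc[OF N] by blast
    then have "k \<in> set exceptional" using k(1) by (auto simp: catalogue_def)
    then show ?thesis
      using exceptional_map[OF f _ _ exceptional_cases[OF _ k(2-4)]] N unfolding N_def by blast
  qed
  from quadratic_normal_form[OF f] show ?thesis
  proof
    assume c: "conjugate f (quadratic 0 1 1 0)"
    have "surd 1 (0, 0) = 0" "surd 1 (2, 0) = 1" by (simp_all add: complex_eq_iff)
    then show ?thesis
      using certified_not_integral[OF certified_double_fixed_point_cycle[unfolded double_fixed_point_cycle_def] _ _ _ D(2)]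
        int[OF c] by simp
  next
    assume "\<exists>p q. p * q \<noteq> 1 \<and> conjugate f (quadratic p q 0 1)"
    then obtain p q where N: "N p q" unfolding N_def by blast
    show ?thesis
    proof (cases "p = 1 \<or> q = 1 \<or> p = 0 \<or> q = 0")
      case True
      then show ?thesis using N swap[OF N] parabolic polynomial by blast
    next
      case False
      then have pq: "p \<noteq> 1" "q \<noteq> 1" "p \<noteq> 0" "q \<noteq> 0" by auto
      define r where "r = (2 - p - q) / (1 - p * q)"
      have Npr: "N p r" using third[OF N pq(1,2)] by (simp add: r_def)
      have "2 - q - p = 2 - p - q" "1 - q * p = 1 - p * q" by simp_all
      then have Nqr: "N q r" using third[OF swap[OF N] pq(2,1)] by (simp only: r_def)
      show ?thesis
      proof (cases "r = 0 \<or> r = 1")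
        case True
        then show ?thesis using Npr swap[OF Npr] parabolic polynomial by blast
      next
        case False
        then have r: "r \<noteq> 0" "r \<noteq> 1" by auto
        have e: "1 - p * q \<noteq> 0" using N by (simp add: N_def)
        have nz: "1 - p \<noteq> 0" "1 - q \<noteq> 0" "1 - r \<noteq> 0" using pq r by auto
        have "r * (1 - p * q) = 2 - p - q" using e by (simp add: r_def)
        then have "(1 - q) * (1 - r) + (1 - p) * (1 - r) + (1 - p) * (1 - q) = (1 - p) * (1 - q) * (1 - r)"
          by algebra
        then have "inverse (1 - p) + inverse (1 - q) + inverse (1 - r) = 1"
          using nz by (intro inverse_sum_eq_1)
        then have "some_pair_catalogued D p q r"
          using unit_fraction_sum_catalogued[OF D(2) mult[OF N] pq(3,1) mult[OF swap[OF N]] pq(4,2)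
              mult[OF swap[OF Npr]] r] by blast
        then show ?thesis
          using catalogued N swap[OF N] Npr swap[OF Npr] Nqr swap[OF Nqr] unfolding some_pair_catalogued_def by blast
      qed
    qed
  qed
qed

end
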